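(* Let $F,A\in\mathbb{R}^{m\times n}$, $H\in\mathbb{R}^{p\times n}$, let $Q_0,Q\in\mathbb{R}^{m\times m}$ and $R\in\mathbb{R}^{p\times p}$ be symmetric positive definite, and let $\ell\in\mathbb{R}^m$. Let $\mathscr{S}_g=(A_g,B_g,C_g,D_g)$ be a stabilizable LTI system associated with the dual DAE $\frac{d(F^\top q)}{dt}=A^\top q-H^\top u$, with state dimension $l$ and associated state map $\mathcal{M}_g$. Let $S=\begin{bmatrix}Q^{-1}&0\\0&R^{-1}\end{bmatrix}$ and consider the algebraic Riccati equation for $P$: $$0=PA_g+A_g^\top P-K^\top(D_g^\top SD_g)K+C_g^\top SC_g,\qquad(\mathrm{ARE})$$ $$K=(D_g^\top SD_g)^{-1}(B_g^\top P+D_g^\top SC_g)\ \text{ if }D_g\neq0,\qquad K=0\in\mathbb{R}^{1\times l}\ \text{ if }D_g=0.$$ Given a solution $P=P^\top>0$ of (ARE) with corresponding $K$, let $\hat C_u,\hat D_u$ be the matrices formed by the last $p$ rows of $C_g,D_g$, let $$A_o=(A_g-B_gK)^\top,\quad B_o=(\hat C_u-\hat D_uK)^\top,\quad C_o=\ell^\top F\mathcal{M}_g^\top,$$ and let $v^*,u^*$ be defined on $[0,+\infty)$ by $$\dot v^*(t)=(A_g-B_gK)v^*(t),\quad v^*(0)=\mathcal{M}_g(F^\top\ell),\qquad u^*(t)=(\hat C_u-\hat D_uK)v^*(t).$$ Assume that $(F,A,H)$ is $\ell$-detectable. Then: (i) (ARE) has a unique symmetric positive definite solution $P$, and $A_o$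 (defined from this $P$) is a Hurwitz matrix; (ii) $\check U\in\mathscr{F}$ defined by $\check U(t,s)=u^*(t-s)$, $t\ge s\ge0$, is an infinite horizon minimax observer; (iii) the minimax error is $\sigma(\check U,\ell)=\ell^\top F\mathcal{M}_g^\top P\mathcal{M}_gF^\top\ell$; (iv) $\check U$ can be represented by the LTI system $(A_o,B_o,C_o,0)$, i.e. $\mathscr{O}_{\check U}(y)(t)=C_or(t)$, where $r\in AC([0,+\infty),\mathbb{R}^l)$ solves $$\dot r(t)=A_or(t)+B_oy(t)\ \text{ a.e.},\qquad r(0)=0.$$
   Context: Notation. $M^+$ is the Moore-Penrose pseudoinverse of a matrix $M$. $L^2_{loc}(I)$ denotes functions on an interval $I$ that are square integrable on every compact subinterval; $AC(I)$ denotes absolutely continuous functions (on every compact subinterval if $I=[0,+\infty)$). When $Fx$ (resp. $F^\top q$) is absolutely continuous, $Fx(t)$ (resp. $F^\top q(t)$) denotes the value at $t$ of the absolutely continuous function. An LTI system $\dot x=Ax+Bu$, $y=Cx+Du$ is identified with $(A,B,C,D)$. A matrix is Hurwitz if all its eigenvalues have negative real part. DAE. For $I=[0,t_1]$, $0<t_1\in\mathbb{R}$, a solution on $I$ of the DAE $\frac{d(Fx)}{dt}=Ax+f$, $y=Hx+\eta$ is a tuple $(x,f,y,\eta)\in L^2_{loc}(I,\mathbb{R}^n)\times L^2_{loc}(I,\mathbb{R}^m)\times L^2_{loc}(I,\mathbb{R}^p)\times L^2_{loc}(I,\mathbb{R}^p)$ such that $Fx$ is absolutely continuous, $Fx(t)=Fx(0)+\int_0^t(Ax(s)+f(s))ds$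 for all $t\in I$, and $y(t)=Hx(t)+\eta(t)$ a.e. on $I$. It is admissible if $(Fx(0))^\top Q_0Fx(0)+\int_0^{\tau}(f^\top Qf+\eta^\top R\eta)dt\le1$ for all $\tau\in I$. The set of admissible solutions on $I$ is $\mathscr{EE}(I)$. Observers. For $U\in L^2([0,t],\mathbb{R}^p)$, $\sigma(U,\ell,t):=\sup_{(x,f,y,\eta)\in\mathscr{EE}([0,t])}\big(\ell^\top Fx(t)-\int_0^ty^\top(s)U(s)ds\big)^2$. $\mathscr{F}$ is the set of all maps $U:\{(\tau,s)\mid\tau>0,\ s\in[0,\tau]\}\to\mathbb{R}^p$ such that for every $\tau>0$ the function $U(\tau,\cdot)$ belongs to $L^2([0,\tau],\mathbb{R}^p)$. For $U\in\mathscr{F}$ and $y\in L^2_{loc}(I,\mathbb{R}^p)$, $\mathscr{O}_U(y)(t):=\int_0^ty^\top(s)U(t,s)ds$, and $\sigma(U,\ell):=\limsup_{t\to\infty}\sigma(U(t,\cdot),\ell,t)$. $\check U\in\mathscr{F}$ is an infinite horizon minimax observer if $\sigma(\check U,\ell)=\inf_{U\in\mathscr{F}}\sigma(U,\ell)<+\infty$. $U\in\mathscr{F}$ is represented by an LTI system $(A_o,B_o,C_o,0)$ if for any $y\in L^2_{loc}(I,\mathbb{R}^p)$, where $I=[0,t_1]$, $0<t_1\in\mathbb{R}$, or $I=[0,+\infty)$, one has $\mathscr{O}_U(y)(t)=C_os(t)$ for all $t\in I$, where $\dot s=A_os+B_oy$, $s(0)=0$. Dual DAE. For $I=[0,\tau]$,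 $0<\tau\in\mathbb{R}$, or $I=[0,+\infty)$, a solution on $I$ of the dual DAE $\frac{d(F^\top q)}{dt}=A^\top q-H^\top u$ is a pair $(q,u)\in L^2_{loc}(I,\mathbb{R}^m)\times L^2_{loc}(I,\mathbb{R}^p)$ such that $F^\top q$ is absolutely continuous and $F^\top q(t)=F^\top q(0)+\int_0^t(A^\top q(s)-H^\top u(s))ds$ for all $t\in I$. The set of these is $\mathcal{B}_I(F^\top,A^\top,H^\top)$, and $\mathscr{D}_\ell(I)$ is the subset of those with $F^\top q(0)=F^\top\ell$. $(F,A,H)$ is $\ell$-detectable if there exists $(q,u)\in\mathscr{D}_\ell([0,+\infty))$ with $\lim_{t\to\infty}F^\top q(t)=0$. Associated LTI system. Let $A_a\in\mathbb{R}^{\hat n\times\hat n}$, $B_a\in\mathbb{R}^{\hat n\times k}$, $C_a\in\mathbb{R}^{(m+p)\times\hat n}$, $D_a\in\mathbb{R}^{(m+p)\times k}$ for some $\hat n,k>0$. $\mathscr{S}=(A_a,B_a,C_a,D_a)$ is associated with the dual DAE if: (1) either $k=1$ and $D_a=0$, $B_a=0$, or $D_a$ has full column rank; (2) with $C_s,D_s$ the first $m$ rows of $C_a,D_a$, $F^\top D_s=0$ and $\mathrm{rank}\,F^\top C_s=\hat n$; (3) for every interval $I=[0,\tau]$, $0<\tau\in\mathbb{R}$, or $I=[0,+\infty)$: $(q,u)\in\mathcal{B}_I(F^\top,A^\top,H^\top)$ if and only if there exists $(p,g)\in AC(I,\mathbb{R}^{\hat n})\times L^2_{loc}(I,\mathbb{R}^k)$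 such that $\dot p=A_ap+B_ag$ a.e. and $\begin{bmatrix} q \\ u \end{bmatrix}=C_ap+D_ag$ a.e. The matrix $\mathcal{M}:=(F^\top C_s)^+$ is the state map of $\mathscr{S}$. Stabilizable associated LTI system. Let $\mathscr{S}=(A_a,B_a,C_a,D_a)$ be associated with the dual DAE and let $\mathcal{V}_g\subseteq\mathbb{R}^{\hat n}$ be its stabilizability subspace (the set of initial states that can be steered asymptotically to $0$ by some input), $l=\dim\mathcal{V}_g$. $\mathcal{V}_g$ is $A_a$-invariant and contains $\mathrm{im}\,B_a$, so there is an invertible $T$ with $T(\mathcal{V}_g)=\mathrm{im}\begin{bmatrix}I_l&0\\0&0\end{bmatrix}$ and $$TA_aT^{-1}=\begin{bmatrix}A_g&\star\\0&\star\end{bmatrix},\quad TB_a=\begin{bmatrix}B_g\\0\end{bmatrix},\quad C_aT^{-1}=\begin{bmatrix}C_g&\star\end{bmatrix},$$ $A_g\in\mathbb{R}^{l\times l}$, $B_g\in\mathbb{R}^{l\times k}$, $C_g\in\mathbb{R}^{(m+p)\times l}$. Then $\mathscr{S}_g=(A_g,B_g,C_g,D_g)$ with $D_g=D_a$ is called a stabilizable LTI system associated with the dual DAE, and $\mathcal{M}_g=\begin{bmatrix}I_l&0\end{bmatrix}T\mathcal{M}$ is the associated state map. *)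

theory Defs
  imports "HOL-Analysis.Analysis"
begin

definition sym_pos_def :: "real^'n^'n \<Rightarrow> bool" where
  "sym_pos_def P \<longleftrightarrow> transpose P = P \<and> (\<forall>x. x \<noteq> 0 \<longrightarrow> x \<bullet> (P *v x) > 0)"

text \<open>The Moore-Penrose pseudoinverse, as the unique solution of the four Penrose equations.\<close>

definition pinv :: "real^'n^'m \<Rightarrow> real^'m^'n" where
  "pinv M = (THE X. M ** X ** M = M \<and> X ** M ** X = X \<and>
                    transpose (M ** X) = M ** X \<and> transpose (X ** M) = X ** M)"

definition complex_eigenvalue :: "real^'n^'n \<Rightarrow> complex \<Rightarrow> bool" where
  "complex_eigenvalue M z \<longleftrightarrow>
     (\<exists>v::complex^'n. v \<noteq> 0 \<and> (\<chi> i j. complex_of_real (M $ i $ j)) *v v = z *s v)"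

definition hurwitz :: "real^'n^'n \<Rightarrow> bool" where
  "hurwitz M \<longleftrightarrow> (\<forall>z. complex_eigenvalue M z \<longrightarrow> Re z < 0)"

text \<open>A matrix with \<open>m + p\<close> rows has row index type \<^typ>\<open>'m + 'p\<close>: the first \<open>m\<close> rows are
  indexed by \<^const>\<open>Inl\<close>, the last \<open>p\<close> rows by \<^const>\<open>Inr\<close>.\<close>

definition upper_rows :: "real^'n^('m + 'p::finite) \<Rightarrow> real^'n^'m" where
  "upper_rows M = (\<chi> i. M $ Inl i)"

definition lower_rows :: "real^'n^('m::finite + 'p) \<Rightarrow> real^'n^'p" where
  "lower_rows M = (\<chi> i. M $ Inr i)"

definition stack :: "real^'m \<Rightarrow> real^'p \<Rightarrow> real^('m + 'p)" where
  "stack q u = (\<chi> i. case i of Inl a \<Rightarrow> q $ a | Inr b \<Rightarrow> u $ b)"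

definition block_diag :: "real^'m^'m \<Rightarrow> real^'p^'p \<Rightarrow> real^('m + 'p)^('m + 'p)" where
  "block_diag M N = (\<chi> i j. case i of
       Inl a \<Rightarrow> (case j of Inl b \<Rightarrow> M $ a $ b | Inr _ \<Rightarrow> 0)
     | Inr a \<Rightarrow> (case j of Inl _ \<Rightarrow> 0 | Inr b \<Rightarrow> N $ a $ b))"

definition horizon :: "real set \<Rightarrow> bool" where
  "horizon I \<longleftrightarrow> (\<exists>\<tau>>0. I = {0..\<tau>}) \<or> I = {0..}"

definition L2_on :: "real set \<Rightarrow> (real \<Rightarrow> 'a::euclidean_space) \<Rightarrow> bool" where
  "L2_on I f \<longleftrightarrow> f \<in> borel_measurable (lebesgue_on I) \<and>
                 integrable (lebesgue_on I) (\<lambda>t. (norm (f t))\<^sup>2)"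

definition L2_loc :: "real set \<Rightarrow> (real \<Rightarrow> 'a::euclidean_space) \<Rightarrow> bool" where
  "L2_loc I f \<longleftrightarrow> (\<forall>a b. {a..b} \<subseteq> I \<longrightarrow> L2_on {a..b} f)"

definition abs_cont_on_interval :: "real \<Rightarrow> real \<Rightarrow> (real \<Rightarrow> 'a::real_normed_vector) \<Rightarrow> bool" where
  "abs_cont_on_interval a b f \<longleftrightarrow>
     (\<forall>\<epsilon>>0. \<exists>\<delta>>0. \<forall>D. finite D \<and> (\<forall>(c, d)\<in>D. a \<le> c \<and> c \<le> d \<and> d \<le> b) \<and>
        pairwise (\<lambda>(c, d) (c', d'). disjnt {c<..<d} {c'<..<d'}) D \<and>
        (\<Sum>(c, d)\<in>D. d - c) < \<delta> \<longrightarrow> (\<Sum>(c, d)\<in>D. norm (f d - f c)) < \<epsilon>)"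

definition AC :: "real set \<Rightarrow> (real \<Rightarrow> 'a::real_normed_vector) \<Rightarrow> bool" where
  "AC I f \<longleftrightarrow> (\<forall>a b. {a..b} \<subseteq> I \<longrightarrow> abs_cont_on_interval a b f)"

text \<open>Elements of \<open>L\<^sup>2\<^sub>l\<^sub>o\<^sub>c\<close> are only determined almost everywhere. That \<open>g\<close>, considered as such an
  element, is absolutely continuous means that it agrees a.e. with an absolutely continuous
  function, and its value at a point is then the value of that function (which is unique on
  every interval of positive length).\<close>

definition is_AC_class :: "real set \<Rightarrow> (real \<Rightarrow> 'a::euclidean_space) \<Rightarrow> bool" where
  "is_AC_class I g \<longleftrightarrow> (\<exists>z. AC I z \<and> (AE t in lebesgue_on I. z t = g t))"

definition AC_version :: "real set \<Rightarrow> (real \<Rightarrow> 'a::euclidean_space) \<Rightarrow> real \<Rightarrow> 'a" where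
  "AC_version I g = (SOME z. AC I z \<and> (AE t in lebesgue_on I. z t = g t))"

definition dae_solution ::
  "real^'n^'m \<Rightarrow> real^'n^'m \<Rightarrow> real^'n^'p \<Rightarrow> real set \<Rightarrow>
   (real \<Rightarrow> real^'n) \<Rightarrow> (real \<Rightarrow> real^'m) \<Rightarrow> (real \<Rightarrow> real^'p) \<Rightarrow> (real \<Rightarrow> real^'p) \<Rightarrow> bool" where
  "dae_solution F A H I x f y \<eta> \<longleftrightarrow>
     L2_loc I x \<and> L2_loc I f \<and> L2_loc I y \<and> L2_loc I \<eta> \<and>
     is_AC_class I (\<lambda>t. F *v x t) \<and>
     (\<forall>t\<in>I. AC_version I (\<lambda>t. F *v x t) t =
            AC_version I (\<lambda>t. F *v x t) 0 + (LINT s|lebesgue_on {0..t}. A *v x s + f s)) \<and>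
     (AE t in lebesgue_on I. y t = H *v x t + \<eta> t)"

definition admissible_solutions ::
  "real^'n^'m \<Rightarrow> real^'n^'m \<Rightarrow> real^'n^'p \<Rightarrow> real^'m^'m \<Rightarrow> real^'m^'m \<Rightarrow> real^'p^'p \<Rightarrow> real set \<Rightarrow>
   ((real \<Rightarrow> real^'n) \<times> (real \<Rightarrow> real^'m) \<times> (real \<Rightarrow> real^'p) \<times> (real \<Rightarrow> real^'p)) set" where
  "admissible_solutions F A H Q0 Q R I = {(x, f, y, \<eta>).
     dae_solution F A H I x f y \<eta> \<and>
     (\<forall>\<tau>\<in>I. (let z0 = AC_version I (\<lambda>t. F *v x t) 0 in
        z0 \<bullet> (Q0 *v z0) +
        (LINT t|lebesgue_on {0..\<tau>}. f t \<bullet> (Q *v f t) + \<eta> t \<bullet> (R *v \<eta> t)) \<le> 1))}"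

definition error_at ::
  "real^'n^'m \<Rightarrow> real^'n^'m \<Rightarrow> real^'n^'p \<Rightarrow> real^'m^'m \<Rightarrow> real^'m^'m \<Rightarrow> real^'p^'p \<Rightarrow>
   (real \<Rightarrow> real^'p) \<Rightarrow> real^'m \<Rightarrow> real \<Rightarrow> ereal" where
  "error_at F A H Q0 Q R U ell t =
     (SUP (x, f, y, \<eta>) \<in> admissible_solutions F A H Q0 Q R {0..t}.
        ereal ((ell \<bullet> AC_version {0..t} (\<lambda>t. F *v x t) t
                - (LINT s|lebesgue_on {0..t}. y s \<bullet> U s))\<^sup>2))"

text \<open>Observers are curried, \<open>U \<tau> s\<close>; their values outside \<open>0 \<le> s \<le> \<tau>\<close>, \<open>\<tau> > 0\<close> are never used.\<close>

definition observers :: "(real \<Rightarrow> real \<Rightarrow> real^'p) set" where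
  "observers = {U. \<forall>\<tau>>0. L2_on {0..\<tau>} (U \<tau>)}"

definition observer_output ::
  "(real \<Rightarrow> real \<Rightarrow> real^'p) \<Rightarrow> (real \<Rightarrow> real^'p) \<Rightarrow> real \<Rightarrow> real" where
  "observer_output U y t = (LINT s|lebesgue_on {0..t}. y s \<bullet> U t s)"

definition asymptotic_error ::
  "real^'n^'m \<Rightarrow> real^'n^'m \<Rightarrow> real^'n^'p \<Rightarrow> real^'m^'m \<Rightarrow> real^'m^'m \<Rightarrow> real^'p^'p \<Rightarrow>
   (real \<Rightarrow> real \<Rightarrow> real^'p) \<Rightarrow> real^'m \<Rightarrow> ereal" where
  "asymptotic_error F A H Q0 Q R U ell =
     Limsup at_top (\<lambda>t. error_at F A H Q0 Q R (U t) ell t)"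

definition minimax_observer ::
  "real^'n^'m \<Rightarrow> real^'n^'m \<Rightarrow> real^'n^'p \<Rightarrow> real^'m^'m \<Rightarrow> real^'m^'m \<Rightarrow> real^'p^'p \<Rightarrow>
   real^'m \<Rightarrow> (real \<Rightarrow> real \<Rightarrow> real^'p) \<Rightarrow> bool" where
  "minimax_observer F A H Q0 Q R ell U \<longleftrightarrow>
     U \<in> observers \<and>
     asymptotic_error F A H Q0 Q R U ell =
       (INF V \<in> observers. asymptotic_error F A H Q0 Q R V ell) \<and>
     asymptotic_error F A H Q0 Q R U ell < \<infinity>"

definition lti_trajectory ::
  "real^'n^'n \<Rightarrow> real^'k^'n \<Rightarrow> real set \<Rightarrow> (real \<Rightarrow> real^'n) \<Rightarrow> (real \<Rightarrow> real^'k) \<Rightarrow> bool" where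
  "lti_trajectory A B I p g \<longleftrightarrow>
     AC I p \<and> L2_loc I g \<and>
     (AE t in lebesgue_on I. (p has_vector_derivative (A *v p t + B *v g t)) (at t within I))"

definition represented_by ::
  "(real \<Rightarrow> real \<Rightarrow> real^'p) \<Rightarrow> real^'n^'n \<Rightarrow> real^'p^'n \<Rightarrow> real^'n^1 \<Rightarrow> bool" where
  "represented_by U Ao Bo Co \<longleftrightarrow>
     (\<forall>I y. horizon I \<and> L2_loc I y \<longrightarrow>
        (\<exists>s. lti_trajectory Ao Bo I s y \<and> s 0 = 0 \<and>
             (\<forall>t\<in>I. observer_output U y t = (Co *v s t) $ 1)))"

definition stabilizability_subspace :: "real^'n^'n \<Rightarrow> real^'k^'n \<Rightarrow> (real^'n) set" where
  "stabilizability_subspace A B =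
     {x. \<exists>p g. lti_trajectory A B {0..} p g \<and> p 0 = x \<and> (p \<longlongrightarrow> 0) at_top}"

text \<open>The solution on \<open>[0, \<infinity>)\<close> of \<open>v' = M v\<close>, \<open>v 0 = v0\<close>; its values at negative times are unspecified.\<close>

definition linear_ivp :: "real^'n^'n \<Rightarrow> real^'n \<Rightarrow> real \<Rightarrow> real^'n" where
  "linear_ivp M v0 = (SOME v. v 0 = v0 \<and>
     (\<forall>t\<ge>0. (v has_vector_derivative (M *v v t)) (at t within {0..})))"

definition dual_solution ::
  "real^'n^'m \<Rightarrow> real^'n^'m \<Rightarrow> real^'n^'p \<Rightarrow> real set \<Rightarrow>
   (real \<Rightarrow> real^'m) \<Rightarrow> (real \<Rightarrow> real^'p) \<Rightarrow> bool" where
  "dual_solution F A H I q u \<longleftrightarrow>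
     L2_loc I q \<and> L2_loc I u \<and>
     is_AC_class I (\<lambda>t. transpose F *v q t) \<and>
     (\<forall>t\<in>I. AC_version I (\<lambda>t. transpose F *v q t) t =
            AC_version I (\<lambda>t. transpose F *v q t) 0 +
            (LINT s|lebesgue_on {0..t}. transpose A *v q s - transpose H *v u s))"

definition detectable :: "real^'n^'m \<Rightarrow> real^'n^'m \<Rightarrow> real^'n^'p \<Rightarrow> real^'m \<Rightarrow> bool" where
  "detectable F A H ell \<longleftrightarrow>
     (\<exists>q u. dual_solution F A H {0..} q u \<and>
            AC_version {0..} (\<lambda>t. transpose F *v q t) 0 = transpose F *v ell \<and>
            (AC_version {0..} (\<lambda>t. transpose F *v q t) \<longlongrightarrow> 0) at_top)"

definition associated_lti ::
  "real^'n^'m \<Rightarrow> real^'n^'m \<Rightarrow> real^'n^'p \<Rightarrow>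
   real^'h^'h \<Rightarrow> real^'k^'h \<Rightarrow> real^'h^('m + 'p) \<Rightarrow> real^'k^('m + 'p) \<Rightarrow> bool" where
  "associated_lti F A H Aa Ba Ca Da \<longleftrightarrow>
     (CARD('k) = 1 \<and> Da = 0 \<and> Ba = 0 \<or> rank Da = CARD('k)) \<and>
     transpose F ** upper_rows Da = 0 \<and>
     rank (transpose F ** upper_rows Ca) = CARD('h) \<and>
     (\<forall>I q u. horizon I \<longrightarrow>
        (dual_solution F A H I q u \<longleftrightarrow>
         (\<exists>p g. lti_trajectory Aa Ba I p g \<and>
                (AE t in lebesgue_on I. stack (q t) (u t) = Ca *v p t + Da *v g t))))"

definition state_map :: "real^'n^'m \<Rightarrow> real^'h^('m + 'p::finite) \<Rightarrow> real^'n^'h" where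
  "state_map F Ca = pinv (transpose F ** upper_rows Ca)"

text \<open>\<open>(Ag, Bg, Cg, Dg)\<close> with state map \<open>Mg\<close> arises from \<open>(Aa, Ba, Ca, Da)\<close> through the change of
  basis \<open>T\<close>. The index type \<^typ>\<open>'h\<close> carries no order, so an injection
  \<open>\<iota> :: 'l \<Rightarrow> 'h\<close> singles out the coordinates that are called the first \<open>l\<close> ones.
  The condition on \<open>T ` V\<close> forces \<open>l = dim V\<close>, and all entries not mentioned are arbitrary.\<close>

definition stabilizable_lti ::
  "real^'n^'m \<Rightarrow> real^'h^'h \<Rightarrow> real^'k^'h \<Rightarrow> real^'h^('m + 'p::finite) \<Rightarrow> real^'k^('m + 'p) \<Rightarrow>
   ('l \<Rightarrow> 'h) \<Rightarrow> real^'h^'h \<Rightarrow>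
   real^'l^'l \<Rightarrow> real^'k^'l \<Rightarrow> real^'l^('m + 'p) \<Rightarrow> real^'k^('m + 'p) \<Rightarrow> real^'n^'l \<Rightarrow> bool" where
  "stabilizable_lti F Aa Ba Ca Da \<iota> T Ag Bg Cg Dg Mg \<longleftrightarrow>
     inj \<iota> \<and> invertible T \<and>
     (\<lambda>x. T *v x) ` stabilizability_subspace Aa Ba = {z. \<forall>i. i \<notin> range \<iota> \<longrightarrow> z $ i = 0} \<and>
     (\<forall>i j. (T ** Aa ** matrix_inv T) $ \<iota> i $ \<iota> j = Ag $ i $ j) \<and>
     (\<forall>i j. i \<notin> range \<iota> \<longrightarrow> (T ** Aa ** matrix_inv T) $ i $ \<iota> j = 0) \<and>
     (\<forall>i. (T ** Ba) $ \<iota> i = Bg $ i) \<and>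
     (\<forall>i. i \<notin> range \<iota> \<longrightarrow> (T ** Ba) $ i = 0) \<and>
     (\<forall>i j. (Ca ** matrix_inv T) $ i $ \<iota> j = Cg $ i $ j) \<and>
     Dg = Da \<and>
     (\<forall>i. Mg $ i = (T ** state_map F Ca) $ \<iota> i)"

definition are_gain ::
  "real^'r^'r \<Rightarrow> real^'k^'l \<Rightarrow> real^'l^'r \<Rightarrow> real^'k^'r \<Rightarrow> real^'l^'l \<Rightarrow> real^'l^'k" where
  "are_gain S B C D P =
     (if D \<noteq> 0
      then matrix_inv (transpose D ** S ** D) ** (transpose B ** P + transpose D ** S ** C)
      else 0)"

definition solves_are ::
  "real^'r^'r \<Rightarrow> real^'l^'l \<Rightarrow> real^'k^'l \<Rightarrow> real^'l^'r \<Rightarrow> real^'k^'r \<Rightarrow> real^'l^'l \<Rightarrow> bool" where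
  "solves_are S A B C D P \<longleftrightarrow>
     (let K = are_gain S B C D P in
      0 = P ** A + transpose A ** P - transpose K ** (transpose D ** S ** D) ** K
          + transpose C ** S ** C)"

end

theory Submission
  imports Defs
begin

text \<open>
  The error of an observer is bounded from both sides by a dual optimal control problem. If \<open>(q, u)\<close>
  solves the dual equation with \<open>F\<^sup>T q(0) = F\<^sup>T \<ell>\<close> and the observer uses \<open>u(t - s)\<close>, then
  integrating the derivative of \<open>q(t - s)\<^sup>T F x(s)\<close> gives
  \<open>\<ell>\<^sup>T F x(t) - \<integral> y\<^sup>T u = q(t)\<^sup>T F x(0) + \<integral> (q\<^sup>T f - u\<^sup>T \<eta>)\<close>, so that by Cauchy-Schwarz the squared
  error is at most \<open>q(t)\<^sup>T Q\<^sub>0\<^sup>-\<^sup>1 q(t)\<close> plus the integral of \<open>q\<^sup>T Q\<^sup>-\<^sup>1 q + u\<^sup>T R\<^sup>-\<^sup>1 u\<close>. The associated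
  LTI system turns the minimisation of this integral into a linear quadratic regulator problem. Its
  solution, with the gain of the Riccati equation, has cost \<open>v0\<^sup>T P v0\<close> with \<open>v0 = M\<^sub>g F\<^sup>T \<ell>\<close>, and the
  first term vanishes as \<open>t\<close> grows (\<open>error_identity\<close>, \<open>error_upper_bound\<close>).

  That no observer does better is shown by one solution of the primal equation for each \<open>t\<close>, with
  observation \<open>y = 0\<close> and disturbances proportional to the optimal dual trajectory (\<open>worst_case\<close>).
  Being unable to distinguish it from the zero solution, every observer has at least the error
  \<open>\<bar>\<ell>\<^sup>T F x(t)\<bar>\<close>. The state of this solution is a constant matrix \<open>X\<close> times the costate of the dual
  trajectory. The matrix solves a linear equation of Sylvester type, and by the Fredholm alternative
  its solvability is equivalent to an orthogonality to the exponential solutions of the dual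
  equation, which are all generated by the associated system (\<open>primal_exponential_solution\<close>). The
  part of the costate outside the stabilizability subspace need not decay in the time of the dual
  system; it is given the value 0 at the end of the horizon, which is the initial time of the primal
  solution, and this makes \<open>F x(0)\<close> linear in \<open>v(t)\<close> and hence asymptotically negligible.

  The Riccati equation is solved by Newton's method (Kleinman's iteration) from a stabilising
  feedback, where each step solves a Lyapunov equation. A stabilising feedback is found by
  continuation: \<open>A - \<alpha>I\<close> is stable for large \<open>\<alpha>\<close>, and \<open>\<alpha>\<close> is lowered to 0 in steps whose length is
  bounded below because the solutions for all \<open>\<alpha>\<close> are bounded by the cost of finitely many
  contracting trajectories (\<open>riccati_exists_of_contracting_trajectories\<close>). Coercivity, and with it
  stability of the closed loop and uniqueness of \<open>P\<close>, comes from the state being a linear function of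
  the output \<open>(q, u)\<close>. Since solutions are absolutely continuous functions with derivatives almost
  everywhere, both halves of the fundamental theorem of calculus are needed in that class
  (\<open>fundamental_theorem_abs_cont\<close>, \<open>indefinite_integral_has_derivative_ae\<close>).
\<close>

section \<open>Absolutely continuous functions\<close>

text \<open>Absolute continuity for an indexed family of intervals. Different indices may carry the same
  degenerate interval; such intervals contribute nothing and are discarded.\<close>

lemma abs_cont_on_intervalD_family:
  fixes f :: "real \<Rightarrow> 'a::real_normed_vector"
  assumes "abs_cont_on_interval a b f" and "\<epsilon> > 0"
  shows "\<exists>\<delta>>0. \<forall>(I::'i set) c d. finite I \<longrightarrow> (\<forall>i\<in>I. a \<le> c i \<and> c i \<le> d i \<and> d i \<le> b) \<longrightarrow>
      pairwise (\<lambda>i j. disjnt {c i<..<d i} {c j<..<d j}) I \<longrightarrow> (\<Sum>i\<in>I. d i - c i) < \<delta> \<longrightarrow>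
      (\<Sum>i\<in>I. norm (f (d i) - f (c i))) < \<epsilon>"
proof -
  obtain \<delta> where "\<delta> > 0" and \<delta>: "\<And>D. finite D \<and> (\<forall>(c, d)\<in>D. a \<le> c \<and> c \<le> d \<and> d \<le> b) \<and>
        pairwise (\<lambda>(c, d) (c', d'). disjnt {c<..<d} {c'<..<d'}) D \<and>
        (\<Sum>(c, d)\<in>D. d - c) < \<delta> \<longrightarrow> (\<Sum>(c, d)\<in>D. norm (f d - f c)) < \<epsilon>"
    using assms unfolding abs_cont_on_interval_def by meson
  show ?thesis
  proof (intro exI[of _ \<delta>] conjI \<open>\<delta> > 0\<close> allI impI)
    fix I :: "'i set" and c d
    assume fin: "finite I" and cd: "\<forall>i\<in>I. a \<le> c i \<and> c i \<le> d i \<and> d i \<le> b"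
      and pw: "pairwise (\<lambda>i j. disjnt {c i<..<d i} {c j<..<d j}) I"
      and less: "(\<Sum>i\<in>I. d i - c i) < \<delta>"
    define J where "J = {i\<in>I. c i < d i}"
    define g where "g = (\<lambda>i. (c i, d i))"
    have "J \<subseteq> I" "finite J" using fin by (auto simp: J_def)
    have inj: "inj_on g J"
    proof (rule inj_onI, rule ccontr)
      fix i j assume ij: "i \<in> J" "j \<in> J" "g i = g j" "i \<noteq> j"
      then have "disjnt {c i<..<d i} {c i<..<d i}"
        using pw \<open>J \<subseteq> I\<close> unfolding pairwise_def g_def by (metis prod.inject subsetD)
      then show False using ij(1) by (simp add: disjnt_def J_def)
    qed
    have zero: "c i = d i" if "i \<in> I - J" for i using that cd by (force simp: J_def)
    have "(\<Sum>(c, d)\<in>g ` J. d - c) = (\<Sum>i\<in>J. d i - c i)"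
      by (subst sum.reindex[OF inj]) (simp add: g_def o_def)
    also have "\<dots> = (\<Sum>i\<in>I. d i - c i)"
      by (rule sum.mono_neutral_left) (use zero fin \<open>J \<subseteq> I\<close> in auto)
    finally have 1: "(\<Sum>(c, d)\<in>g ` J. d - c) < \<delta>" using less by simp
    have 2: "pairwise (\<lambda>(c, d) (c', d'). disjnt {c<..<d} {c'<..<d'}) (g ` J)"
      using pw \<open>J \<subseteq> I\<close> unfolding pairwise_def g_def by clarsimp (metis subsetD)
    have 3: "\<forall>(c, d)\<in>g ` J. a \<le> c \<and> c \<le> d \<and> d \<le> b"
      using cd \<open>J \<subseteq> I\<close> by (auto simp: g_def)
    have "(\<Sum>(c, d)\<in>g ` J. norm (f d - f c)) < \<epsilon>"
      by (rule \<delta>[THEN mp]) (intro conjI finite_imageI \<open>finite J\<close> 1 2 3)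
    moreover have "(\<Sum>(c, d)\<in>g ` J. norm (f d - f c)) = (\<Sum>i\<in>J. norm (f (d i) - f (c i)))"
      by (subst sum.reindex[OF inj]) (simp add: g_def o_def)
    moreover have "\<dots> = (\<Sum>i\<in>I. norm (f (d i) - f (c i)))"
      by (rule sum.mono_neutral_left) (use zero fin \<open>J \<subseteq> I\<close> in auto)
    ultimately show "(\<Sum>i\<in>I. norm (f (d i) - f (c i))) < \<epsilon>" by simp
  qed
qed

lemma abs_cont_on_intervalI_lipschitz:
  fixes f :: "real \<Rightarrow> 'a::real_normed_vector"
  assumes "\<And>s t. a \<le> s \<Longrightarrow> s \<le> t \<Longrightarrow> t \<le> b \<Longrightarrow> norm (f t - f s) \<le> L * (t - s)"
  shows "abs_cont_on_interval a b f"
  unfolding abs_cont_on_interval_def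
proof (intro allI impI)
  fix \<epsilon> :: real assume "\<epsilon> > 0"
  define M where "M = max L 0 + 1"
  have "M > 0" "L \<le> M" by (auto simp: M_def)
  show "\<exists>\<delta>>0. \<forall>D. finite D \<and> (\<forall>(c, d)\<in>D. a \<le> c \<and> c \<le> d \<and> d \<le> b) \<and>
        pairwise (\<lambda>(c, d) (c', d'). disjnt {c<..<d} {c'<..<d'}) D \<and>
        (\<Sum>(c, d)\<in>D. d - c) < \<delta> \<longrightarrow> (\<Sum>(c, d)\<in>D. norm (f d - f c)) < \<epsilon>"
  proof (intro exI[of _ "\<epsilon> / M"] conjI allI impI)
    show "\<epsilon> / M > 0" using \<open>\<epsilon> > 0\<close> \<open>M > 0\<close> by simp
    fix D assume D: "finite D \<and> (\<forall>(c, d)\<in>D. a \<le> c \<and> c \<le> d \<and> d \<le> b) \<and>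
        pairwise (\<lambda>(c, d) (c', d'). disjnt {c<..<d} {c'<..<d'}) D \<and>
        (\<Sum>(c, d)\<in>D. d - c) < \<epsilon> / M"
    have "(\<Sum>(c, d)\<in>D. norm (f d - f c)) \<le> (\<Sum>(c, d)\<in>D. M * (d - c))"
    proof (rule sum_mono, clarify)
      fix c d assume "(c, d) \<in> D"
      then have *: "a \<le> c" "c \<le> d" "d \<le> b" using D by auto
      have "norm (f d - f c) \<le> L * (d - c)" using assms * by blast
      also have "\<dots> \<le> M * (d - c)" using * \<open>L \<le> M\<close> by (intro mult_right_mono) auto
      finally show "norm (f d - f c) \<le> M * (d - c)" .
    qed
    also have "\<dots> = M * (\<Sum>(c, d)\<in>D. d - c)" by (simp add: sum_distrib_left case_prod_unfold)
    also have "\<dots> < \<epsilon>" using D \<open>M > 0\<close> by (simp add: field_simps)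
    finally show "(\<Sum>(c, d)\<in>D. norm (f d - f c)) < \<epsilon>" .
  qed
qed

lemma abs_cont_imp_continuous_on:
  fixes f :: "real \<Rightarrow> 'a::real_normed_vector"
  assumes "abs_cont_on_interval a b f"
  shows "continuous_on {a..b} f"
  unfolding continuous_on_iff
proof (intro ballI allI impI)
  fix x \<epsilon> :: real assume x: "x \<in> {a..b}" and "\<epsilon> > 0"
  obtain \<delta> where "\<delta> > 0" and \<delta>: "\<forall>(I::unit set) c d. finite I \<longrightarrow>
      (\<forall>i\<in>I. a \<le> c i \<and> c i \<le> d i \<and> d i \<le> b) \<longrightarrow>
      pairwise (\<lambda>i j. disjnt {c i<..<d i} {c j<..<d j}) I \<longrightarrow> (\<Sum>i\<in>I. d i - c i) < \<delta> \<longrightarrow>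
      (\<Sum>i\<in>I. norm (f (d i) - f (c i))) < \<epsilon>"
    using abs_cont_on_intervalD_family[OF assms \<open>\<epsilon> > 0\<close>, where 'i = "unit"] by blast
  have *: "norm (f t - f s) < \<epsilon>" if "a \<le> s" "s \<le> t" "t \<le> b" "t - s < \<delta>" for s t
    using \<delta>[rule_format, of "{()}" "\<lambda>_. s" "\<lambda>_. t"] that by simp
  show "\<exists>d>0. \<forall>x'\<in>{a..b}. dist x' x < d \<longrightarrow> dist (f x') (f x) < \<epsilon>"
  proof (intro exI[of _ \<delta>] conjI ballI impI \<open>\<delta> > 0\<close>)
    fix y assume "y \<in> {a..b}" "dist y x < \<delta>"
    then show "dist (f y) (f x) < \<epsilon>"
      using *[of x y] *[of y x] x by (cases "x \<le> y") (auto simp: dist_norm norm_minus_commute)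
  qed
qed

lemma abs_cont_bilinear:
  fixes prod :: "'a::real_normed_vector \<Rightarrow> 'b::real_normed_vector \<Rightarrow> 'c::real_normed_vector"
  assumes bl: "bounded_bilinear prod"
    and f: "abs_cont_on_interval a b f" and g: "abs_cont_on_interval a b g"
  shows "abs_cont_on_interval a b (\<lambda>t. prod (f t) (g t))"
proof -
  interpret bounded_bilinear prod by (rule bl)
  obtain K where K: "K > 0" "\<And>x y. norm (prod x y) \<le> norm x * norm y * K"
    using pos_bounded by blast
  have "bounded (f ` {a..b})" "bounded (g ` {a..b})"
    using f g by (auto intro!: compact_imp_bounded compact_continuous_image abs_cont_imp_continuous_on)
  then obtain Mf Mg where Mf: "\<And>x. x \<in> {a..b} \<Longrightarrow> norm (f x) \<le> Mf" and "Mf > 0"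
    and Mg: "\<And>x. x \<in> {a..b} \<Longrightarrow> norm (g x) \<le> Mg" and "Mg > 0"
    unfolding bounded_pos by (metis imageI)
  show ?thesis
    unfolding abs_cont_on_interval_def
  proof (intro allI impI)
    fix \<epsilon> :: real assume "\<epsilon> > 0"
    define ef where "ef = \<epsilon> / (2 * (K * Mg))"
    define eg where "eg = \<epsilon> / (2 * (K * Mf))"
    have "ef > 0" "eg > 0" using \<open>\<epsilon> > 0\<close> K \<open>Mf > 0\<close> \<open>Mg > 0\<close> by (auto simp: ef_def eg_def)
    have "\<exists>\<delta>>0. \<forall>D. finite D \<and> (\<forall>(c, d)\<in>D. a \<le> c \<and> c \<le> d \<and> d \<le> b) \<and>
        pairwise (\<lambda>(c, d) (c', d'). disjnt {c<..<d} {c'<..<d'}) D \<and>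
        (\<Sum>(c, d)\<in>D. d - c) < \<delta> \<longrightarrow> (\<Sum>(c, d)\<in>D. norm (f d - f c)) < ef"
      using f \<open>ef > 0\<close> unfolding abs_cont_on_interval_def by blast
    then obtain df where "df > 0" and
      df: "\<And>D. finite D \<and> (\<forall>(c, d)\<in>D. a \<le> c \<and> c \<le> d \<and> d \<le> b) \<and>
        pairwise (\<lambda>(c, d) (c', d'). disjnt {c<..<d} {c'<..<d'}) D \<and>
        (\<Sum>(c, d)\<in>D. d - c) < df \<longrightarrow> (\<Sum>(c, d)\<in>D. norm (f d - f c)) < ef"
      by blast
    have "\<exists>\<delta>>0. \<forall>D. finite D \<and> (\<forall>(c, d)\<in>D. a \<le> c \<and> c \<le> d \<and> d \<le> b) \<and>
        pairwise (\<lambda>(c, d) (c', d'). disjnt {c<..<d} {c'<..<d'}) D \<and>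
        (\<Sum>(c, d)\<in>D. d - c) < \<delta> \<longrightarrow> (\<Sum>(c, d)\<in>D. norm (g d - g c)) < eg"
      using g \<open>eg > 0\<close> unfolding abs_cont_on_interval_def by blast
    then obtain dg where "dg > 0" and
      dg: "\<And>D. finite D \<and> (\<forall>(c, d)\<in>D. a \<le> c \<and> c \<le> d \<and> d \<le> b) \<and>
        pairwise (\<lambda>(c, d) (c', d'). disjnt {c<..<d} {c'<..<d'}) D \<and>
        (\<Sum>(c, d)\<in>D. d - c) < dg \<longrightarrow> (\<Sum>(c, d)\<in>D. norm (g d - g c)) < eg"
      by blast
    show "\<exists>\<delta>>0. \<forall>D. finite D \<and> (\<forall>(c, d)\<in>D. a \<le> c \<and> c \<le> d \<and> d \<le> b) \<and>
        pairwise (\<lambda>(c, d) (c', d'). disjnt {c<..<d} {c'<..<d'}) D \<and>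
        (\<Sum>(c, d)\<in>D. d - c) < \<delta> \<longrightarrow> (\<Sum>(c, d)\<in>D. norm (prod (f d) (g d) - prod (f c) (g c))) < \<epsilon>"
    proof (intro exI[of _ "min df dg"] conjI allI impI)
      fix D assume D: "finite D \<and> (\<forall>(c, d)\<in>D. a \<le> c \<and> c \<le> d \<and> d \<le> b) \<and>
        pairwise (\<lambda>(c, d) (c', d'). disjnt {c<..<d} {c'<..<d'}) D \<and>
        (\<Sum>(c, d)\<in>D. d - c) < min df dg"
      note D1 = D[THEN conjunct1] and D2 = D[THEN conjunct2, THEN conjunct1]
        and D3 = D[THEN conjunct2, THEN conjunct2, THEN conjunct1]
        and D4 = D[THEN conjunct2, THEN conjunct2, THEN conjunct2]
      have sf: "(\<Sum>(c, d)\<in>D. norm (f d - f c)) < ef"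
        by (rule df[THEN mp]) (intro conjI D1 D2 D3, use D4 in simp)
      have sg: "(\<Sum>(c, d)\<in>D. norm (g d - g c)) < eg"
        by (rule dg[THEN mp]) (intro conjI D1 D2 D3, use D4 in simp)
      have "(\<Sum>(c, d)\<in>D. norm (prod (f d) (g d) - prod (f c) (g c)))
        \<le> (\<Sum>(c, d)\<in>D. K * Mg * norm (f d - f c) + K * Mf * norm (g d - g c))"
      proof (rule sum_mono, clarify)
        fix c d assume "(c, d) \<in> D"
        then have cd: "c \<in> {a..b}" "d \<in> {a..b}" using D by auto
        have "prod (f d) (g d) - prod (f c) (g c) = prod (f d - f c) (g d) + prod (f c) (g d - g c)"
          by (simp add: diff_left diff_right)
        also have "norm \<dots> \<le> norm (f d - f c) * norm (g d) * K + norm (f c) * norm (g d - g c) * K"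
          by (rule order_trans[OF norm_triangle_ineq add_mono]) (rule K(2))+
        also have "\<dots> \<le> norm (f d - f c) * Mg * K + Mf * norm (g d - g c) * K"
          using Mf[OF cd(1)] Mg[OF cd(2)] K(1)
          by (intro add_mono mult_right_mono mult_left_mono) auto
        finally show "norm (prod (f d) (g d) - prod (f c) (g c))
           \<le> K * Mg * norm (f d - f c) + K * Mf * norm (g d - g c)" by (simp add: ac_simps)
      qed
      also have "\<dots> = K * Mg * (\<Sum>(c, d)\<in>D. norm (f d - f c)) + K * Mf * (\<Sum>(c, d)\<in>D. norm (g d - g c))"
        by (simp add: sum.distrib sum_distrib_left case_prod_unfold)
      also have "\<dots> < K * Mg * ef + K * Mf * eg"
        using sf sg K \<open>Mf > 0\<close> \<open>Mg > 0\<close> by (intro add_strict_mono mult_strict_left_mono) auto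
      also have "\<dots> = \<epsilon>" using K \<open>Mf > 0\<close> \<open>Mg > 0\<close> by (simp add: ef_def eg_def field_simps)
      finally show "(\<Sum>(c, d)\<in>D. norm (prod (f d) (g d) - prod (f c) (g c))) < \<epsilon>" .
    qed (use \<open>df > 0\<close> \<open>dg > 0\<close> in auto)
  qed
qed

lemma abs_cont_const: "abs_cont_on_interval a b (\<lambda>t. c)"
  by (rule abs_cont_on_intervalI_lipschitz[where L = 0]) auto

lemma abs_cont_linear:
  assumes "bounded_linear h" "abs_cont_on_interval a b f"
  shows "abs_cont_on_interval a b (\<lambda>t. h (f t))"
proof -
  have "bounded_bilinear (\<lambda>(r::real) x. r *\<^sub>R h x)"
    by (intro bounded_bilinear.comp[OF bounded_bilinear_scaleR] bounded_linear_ident assms)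
  from abs_cont_bilinear[OF this abs_cont_const[of a b 1] assms(2)] show ?thesis by simp
qed

lemma abs_cont_C1:
  fixes f :: "real \<Rightarrow> 'a::real_normed_vector"
  assumes "\<And>t. t \<in> {a..b} \<Longrightarrow> (f has_vector_derivative f' t) (at t within {a..b})"
    and "continuous_on {a..b} f'"
  shows "abs_cont_on_interval a b f"
proof -
  have "bounded (f' ` {a..b})" by (intro compact_imp_bounded compact_continuous_image assms) simp
  then obtain L where L: "\<And>t. t \<in> {a..b} \<Longrightarrow> norm (f' t) \<le> L" unfolding bounded_pos by (metis imageI)
  show ?thesis
  proof (rule abs_cont_on_intervalI_lipschitz[where L = L])
    fix s t assume st: "a \<le> s" "s \<le> t" "t \<le> b"
    have "norm (f t - f s) \<le> L * norm (t - s)"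
      using L st assms(1)
      by (intro differentiable_bound[where S = "{a..b}" and f' = "\<lambda>x h. h *\<^sub>R f' x"])
        (auto simp: has_vector_derivative_def  onorm_scaleR_left
           bounded_linear_ident onorm_id)
    then show "norm (f t - f s) \<le> L * (t - s)" using st by simp
  qed
qed

text \<open>Riemann sums of the derivative are compared with the increments of \<open>f\<close>. On intervals tagged
  outside \<open>N\<close> the gauge makes the difference quotient accurate, and the intervals tagged in \<open>N\<close> lie
  in an open set of small measure, where absolute continuity bounds the increments.\<close>

lemma fundamental_theorem_abs_cont:
  fixes f h :: "real \<Rightarrow> 'a::euclidean_space"
  assumes "a \<le> b" and ac: "abs_cont_on_interval a b f" and N: "negligible N"
    and der: "\<And>x. x \<in> {a..b} - N \<Longrightarrow> (f has_vector_derivative h x) (at x within {a..b})"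
  shows "(h has_integral (f b - f a)) {a..b}"
proof -
  define h' where "h' = (\<lambda>x. if x \<in> N then 0 else h x)"
  have "(h' has_integral (f b - f a)) {a..b}"
    unfolding has_integral_factor_content_real
  proof (intro allI impI)
    fix e :: real assume "e > 0"
    show "\<exists>\<gamma>. gauge \<gamma> \<and> (\<forall>p. p tagged_division_of {a..b} \<and> \<gamma> fine p \<longrightarrow>
        norm ((\<Sum>(x, k)\<in>p. measure lborel k *\<^sub>R h' x) - (f b - f a)) \<le> e * measure lborel {a..b})"
    proof (cases "a = b")
      case True
      show ?thesis
      proof (intro exI[of _ "\<lambda>x. ball x 1"] conjI allI impI)
        fix p assume "p tagged_division_of {a..b} \<and> (\<lambda>x. ball x 1) fine p"
        then have "(\<Sum>(x, k)\<in>p. measure lborel k *\<^sub>R h' x) = 0"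
          using True by (intro sum_content_null[of a b]) auto
        then show "norm ((\<Sum>(x, k)\<in>p. measure lborel k *\<^sub>R h' x) - (f b - f a)) \<le> e * measure lborel {a..b}"
          using True by simp
      qed (auto simp: gauge_def)
    next
      case False
      then have "a < b" using \<open>a \<le> b\<close> by simp
      define e' where "e' = e * (b - a) / 2"
      have "e' > 0" using \<open>a < b\<close> \<open>e > 0\<close> by (simp add: e'_def)
      obtain \<delta> where "\<delta> > 0" and \<delta>: "\<forall>(I::(real \<times> real set) set) c d. finite I \<longrightarrow>
      (\<forall>i\<in>I. a \<le> c i \<and> c i \<le> d i \<and> d i \<le> b) \<longrightarrow>
      pairwise (\<lambda>i j. disjnt {c i<..<d i} {c j<..<d j}) I \<longrightarrow> (\<Sum>i\<in>I. d i - c i) < \<delta> \<longrightarrow>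
      (\<Sum>i\<in>I. norm (f (d i) - f (c i))) < e'"
    using abs_cont_on_intervalD_family[OF ac \<open>e' > 0\<close>, where 'i = "(real \<times> real set)"] by blast
      have "N \<in> sets lebesgue" using N by (simp add: negligible_imp_sets)
      then obtain U where U: "open U" "N \<subseteq> U" "U - N \<in> lmeasurable" "emeasure lebesgue (U - N) < ennreal \<delta>"
        using sets_lebesgue_outer_open \<open>\<delta> > 0\<close> by blast
      have Um: "U \<in> lmeasurable"
        using U N by (metis Un_Diff_cancel2 fmeasurable.Un negligible_iff_measure sup.absorb1)
      have "U - (U - N) \<subseteq> N" by auto
      then have "measure lebesgue (U - N) = measure lebesgue U"
        using N by (intro measure_negligible_symdiff Um) (auto intro: negligible_subset)
      then have mU: "measure lebesgue U < \<delta>"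
        using U \<open>\<delta> > 0\<close> by (simp add: emeasure_eq_measure2 fmeasurableD2 ennreal_less_iff)
      have "\<exists>d>0. \<forall>y\<in>{a..b}. \<bar>y - x\<bar> < d \<longrightarrow> norm (f y - f x - (y - x) *\<^sub>R h x) \<le> e/2 * \<bar>y - x\<bar>"
        if "x \<in> {a..b} - N" for x
        using der[OF that] \<open>e > 0\<close> unfolding has_vector_derivative_def has_derivative_within_alt
        by (auto dest!: spec[of _ "e/2"])
      then obtain d where d: "\<And>x. x \<in> {a..b} - N \<Longrightarrow> d x > 0"
        "\<And>x y. x \<in> {a..b} - N \<Longrightarrow> y \<in> {a..b} \<Longrightarrow> \<bar>y - x\<bar> < d x \<Longrightarrow>
            norm (f y - f x - (y - x) *\<^sub>R h x) \<le> e/2 * \<bar>y - x\<bar>"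
        by metis
      define \<gamma> where "\<gamma> x = (if x \<in> N then U else if x \<in> {a..b} then ball x (d x) else ball x 1)" for x
      have "gauge \<gamma>" unfolding gauge_def using U d(1) by (auto simp: \<gamma>_def)
      have riemann: "norm ((\<Sum>(x, k)\<in>p. measure lborel k *\<^sub>R h' x) - (f b - f a)) \<le> e * measure lborel {a..b}"
        if p: "p tagged_division_of {a..b}" and fine: "\<gamma> fine p" for p
      proof -
        have finp: "finite p" using p by blast
        define F where "F = (\<lambda>(x, k). measure lborel k *\<^sub>R h' x - (f (Sup k) - f (Inf k)))"
        define p1 where "p1 = {(x, k) \<in> p. x \<in> N}"
        define p2 where "p2 = {(x, k) \<in> p. x \<notin> N}"
        have "p = p1 \<union> p2" "p1 \<inter> p2 = {}" "finite p1" "finite p2" using finp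
          by (auto simp: p1_def p2_def case_prod_unfold intro: finite_subset[OF _ finp])
        have tag: "\<exists>c d. k = {c..d} \<and> a \<le> c \<and> c \<le> x \<and> x \<le> d \<and> d \<le> b" if xkp: "(x, k) \<in> p" for x k
        proof -
          obtain c d where "k = cbox c d" "x \<in> k" "k \<subseteq> {a..b}"
            using tagged_division_ofD(2-4)[OF p xkp] by blast
          then show ?thesis by (intro exI[of _ c] exI[of _ d]) (auto simp: cbox_interval)
        qed
        have "(\<Sum>(x, k)\<in>p. f (Sup k) - f (Inf k)) = f b - f a"
          using additive_tagged_division_1[OF \<open>a \<le> b\<close> p] by simp
        then have "(\<Sum>(x, k)\<in>p. measure lborel k *\<^sub>R h' x) - (f b - f a) = sum F p"
          by (simp add: F_def case_prod_unfold sum_subtractf)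
        also have "\<dots> = sum F p1 + sum F p2"
          using \<open>p = p1 \<union> p2\<close> \<open>p1 \<inter> p2 = {}\<close> \<open>finite p1\<close> \<open>finite p2\<close> by (simp add: sum.union_disjoint)
        also have "norm \<dots> \<le> e' + e'"
        proof (rule order_trans[OF norm_triangle_ineq add_mono])
          have "norm (sum F p2) \<le> (\<Sum>(x,k)\<in>p2. e/2 * measure lborel k)"
          proof (rule sum_norm_le, clarify)
            fix x k assume xk: "(x, k) \<in> p2"
            then have "(x, k) \<in> p" "x \<notin> N" by (auto simp: p2_def)
            then obtain c d' where k: "k = {c..d'}" "a \<le> c" "c \<le> x" "x \<le> d'" "d' \<le> b" using tag by blast
            then have xN: "x \<in> {a..b} - N" using \<open>x \<notin> N\<close> by auto
            have "k \<subseteq> \<gamma> x" using fine \<open>(x, k) \<in> p\<close> by (auto simp: fine_def)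
            then have "k \<subseteq> ball x (d x)" using xN by (simp add: \<gamma>_def)
            moreover have "c \<in> k" "d' \<in> k" using k by auto
            ultimately have *: "\<bar>c - x\<bar> < d x" "\<bar>d' - x\<bar> < d x" by (auto simp: dist_real_def)
            have "F (x, k) = (f c - f x - (c - x) *\<^sub>R h x) - (f d' - f x - (d' - x) *\<^sub>R h x)"
              using k xN by (simp add: F_def h'_def algebra_simps)
            also have "norm \<dots> \<le> e/2 * \<bar>c - x\<bar> + e/2 * \<bar>d' - x\<bar>"
              using d(2)[OF xN _ *(1)] d(2)[OF xN _ *(2)] k
              by (intro order_trans[OF norm_triangle_ineq4 add_mono]) auto
            also have "\<dots> = e/2 * measure lborel k" using k by (simp add: field_simps)
            finally show "norm (F (x, k)) \<le> e/2 * measure lborel k" .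
          qed
          also have "\<dots> \<le> (\<Sum>(x,k)\<in>p. e/2 * measure lborel k)"
            using \<open>e > 0\<close> finp by (intro sum_mono2) (auto simp: p2_def)
          also have "\<dots> = e/2 * (\<Sum>(x,k)\<in>p. measure lborel k)"
            by (simp add: sum_distrib_left case_prod_unfold)
          also have "\<dots> = e'"
            using additive_content_tagged_division[of p a b] p \<open>a \<le> b\<close> by (simp add: e'_def cbox_interval)
          finally show "norm (sum F p2) \<le> e'" .
          have disj: "pairwise (\<lambda>i j. disjnt {Inf (snd i)<..<Sup (snd i)} {Inf (snd j)<..<Sup (snd j)}) p"
          proof (rule pairwiseI)
            fix i j assume ij: "i \<in> p" "j \<in> p" "i \<noteq> j"
            obtain x k y l where eq: "i = (x, k)" "j = (y, l)" by (cases i, cases j) auto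
            have xy: "(x, k) \<in> p" "(y, l) \<in> p" using ij eq by auto
            have "interior k \<inter> interior l = {}"
              using tagged_division_ofD(5)[OF p xy] ij eq by blast
            moreover obtain c d c' d' where "k = {c..d}" "c \<le> d" "l = {c'..d'}" "c' \<le> d'"
              using tag[OF xy(1)] tag[OF xy(2)] by force
            ultimately show "disjnt {Inf (snd i)<..<Sup (snd i)} {Inf (snd j)<..<Sup (snd j)}"
              using eq by (simp add: disjnt_def)
          qed
          have "(\<Sum>i\<in>p1. norm (f (Sup (snd i)) - f (Inf (snd i)))) < e'"
          proof (rule \<delta>[rule_format, OF \<open>finite p1\<close>])
            show "pairwise (\<lambda>i j. disjnt {Inf (snd i)<..<Sup (snd i)} {Inf (snd j)<..<Sup (snd j)}) p1"
              by (rule pairwise_subset[OF disj]) (auto simp: p1_def)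
            show "a \<le> Inf (snd i) \<and> Inf (snd i) \<le> Sup (snd i) \<and> Sup (snd i) \<le> b" if "i \<in> p1" for i
              using that tag[of "fst i" "snd i"] by (auto simp: p1_def)
            have "(\<Sum>i\<in>p1. Sup (snd i) - Inf (snd i)) = (\<Sum>i\<in>p1. measure lebesgue {Inf (snd i)<..<Sup (snd i)})"
            proof (rule sum.cong[OF refl])
              fix i assume "i \<in> p1"
              then show "Sup (snd i) - Inf (snd i) = measure lebesgue {Inf (snd i)<..<Sup (snd i)}"
                using tag[of "fst i" "snd i"] by (force simp: p1_def)
            qed
            also have "\<dots> = measure lebesgue (\<Union>i\<in>p1. {Inf (snd i)<..<Sup (snd i)})"
            proof (rule measure_UNION'[symmetric, OF \<open>finite p1\<close>])
              show "pairwise (\<lambda>i j. disjnt {Inf (snd i)<..<Sup (snd i)} {Inf (snd j)<..<Sup (snd j)}) p1"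
                by (rule pairwise_subset[OF disj]) (auto simp: p1_def)
            qed auto
            also have "\<dots> \<le> measure lebesgue U"
            proof (rule measure_mono_fmeasurable[OF _ _ Um])
              show "(\<Union>i\<in>p1. {Inf (snd i)<..<Sup (snd i)}) \<subseteq> U"
              proof clarify
                fix x k y assume xk: "(x, k) \<in> p1" and y: "y \<in> {Inf (snd (x, k))<..<Sup (snd (x, k))}"
                then have "x \<in> N" "k \<subseteq> \<gamma> x" using fine by (auto simp: p1_def fine_def)
                then have "k \<subseteq> U" by (simp add: \<gamma>_def)
                moreover have "y \<in> k" using y tag[of x k] xk by (auto simp: p1_def)
                ultimately show "y \<in> U" by auto
              qed
              show "(\<Union>i\<in>p1. {Inf (snd i)<..<Sup (snd i)}) \<in> sets lebesgue"
                using \<open>finite p1\<close> by (intro sets.finite_UN) auto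
            qed
            finally show "(\<Sum>i\<in>p1. Sup (snd i) - Inf (snd i)) < \<delta>" using mU by simp
          qed
          moreover have "norm (sum F p1) \<le> (\<Sum>i\<in>p1. norm (f (Sup (snd i)) - f (Inf (snd i))))"
            by (rule sum_norm_le) (auto simp: F_def p1_def h'_def norm_minus_commute)
          ultimately show "norm (sum F p1) \<le> e'" by simp
        qed
        finally show ?thesis using \<open>a \<le> b\<close> by (simp add: e'_def)
      qed
      show ?thesis
        by (intro exI[of _ \<gamma>] conjI \<open>gauge \<gamma>\<close> allI impI) (use riemann in simp)
    qed
  qed
  then show ?thesis
    by (rule has_integral_spike[OF N, rotated]) (auto simp: h'_def)
qed

section \<open>Differentiation of indefinite integrals\<close>

text \<open>Almost every point is a point of differentiability of an indefinite integral. The points where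
  the difference quotient stays \<open>\<epsilon>\<close> away from the integrand along a sequence are covered, in the
  sense of Vitali, by intervals on which the Riemann sum is far from the integral; Henstock's lemma
  bounds the total length of any disjoint family of these.\<close>

lemma indefinite_integral_has_derivative_ae:
  fixes f :: "real \<Rightarrow> 'a::euclidean_space"
  assumes int: "f integrable_on {a..b}"
  obtains N where "negligible N"
    "\<And>x. x \<in> {a..b} - N \<Longrightarrow>
       ((\<lambda>t. integral {a..t} f) has_vector_derivative f x) (at x within {a..b})"
proof -
  define F where "F = (\<lambda>t. integral {a..t} f)"
  define E where "E \<epsilon> = {x\<in>{a<..<b}. \<forall>d>0. \<exists>y\<in>{a..b}. y \<noteq> x \<and> \<bar>y - x\<bar> < d \<and>
      norm (F y - F x - (y - x) *\<^sub>R f x) > \<epsilon> * \<bar>y - x\<bar>}" for \<epsilon>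
  have Fdiff: "F v - F u = integral {u..v} f" if "a \<le> u" "u \<le> v" "v \<le> b" for u v
  proof -
    have "f integrable_on {a..v}" by (rule integrable_subinterval_real[OF int]) (use that in auto)
    then have "integral {a..u} f + integral {u..v} f = integral {a..v} f"
      using that by (intro Henstock_Kurzweil_Integration.integral_combine) auto
    then show ?thesis by (simp add: F_def algebra_simps)
  qed
  have neg: "negligible (E \<epsilon>)" if "\<epsilon> > 0" for \<epsilon>
    unfolding negligible_outer_le
  proof (intro allI impI)
    fix \<eta> :: real assume "\<eta> > 0"
    then have "\<eta> * \<epsilon> > 0" using \<open>\<epsilon> > 0\<close> by simp
    moreover have "f integrable_on cbox a b" using int by (simp add: cbox_interval)
    ultimately obtain \<gamma> where "gauge \<gamma>" and \<gamma>: "\<And>p. \<lbrakk>p tagged_partial_division_of (cbox a b); \<gamma> fine p\<rbrakk> \<Longrightarrow>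
             sum (\<lambda>(x,k). norm(measure lborel k *\<^sub>R f x - integral k f)) p < \<eta> * \<epsilon>"
      using Henstock_lemma[of f a b "\<eta> * \<epsilon>"] by blast
    define K where "K = {(x, y). x \<in> E \<epsilon> \<and> y \<in> {a..b} \<and> y \<noteq> x \<and> {min x y..max x y} \<subseteq> \<gamma> x \<and>
      norm (F y - F x - (y - x) *\<^sub>R f x) > \<epsilon> * \<bar>y - x\<bar>}"
    define c where "c = (\<lambda>(x::real, y). (x + y) / 2)"
    define r where "r = (\<lambda>(x::real, y). \<bar>y - x\<bar> / 2)"
    have cb: "cball (c (x, y)) (r (x, y)) = {min x y..max x y}" for x y
      by (auto simp: c_def r_def cball_eq_atLeastAtMost min_def max_def field_simps abs_if)
    have "\<exists>i. i \<in> K \<and> x \<in> cball (c i) (r i) \<and> r i < d" if xE: "x \<in> E \<epsilon>" and "d > 0" for x d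
    proof -
      have "open (\<gamma> x)" "x \<in> \<gamma> x" using \<open>gauge \<gamma>\<close> by (auto simp: gauge_def)
      then obtain d0 where d0: "d0 > 0" "ball x d0 \<subseteq> \<gamma> x" by (meson openE)
      have "min d d0 > 0" using d0 \<open>d > 0\<close> by simp
      then obtain y where y: "y \<in> {a..b}" "y \<noteq> x" "\<bar>y - x\<bar> < min d d0"
          "norm (F y - F x - (y - x) *\<^sub>R f x) > \<epsilon> * \<bar>y - x\<bar>"
        using xE unfolding E_def by blast
      have "{min x y..max x y} \<subseteq> ball x d0"
        using y(3) by (auto simp: dist_real_def min_def max_def split: if_splits)
      then have "(x, y) \<in> K" using y d0 xE by (auto simp: K_def)
      moreover have "x \<in> cball (c (x, y)) (r (x, y))" by (simp add: cb)
      moreover have "r (x, y) < d" using y(3) \<open>d > 0\<close> by (simp add: r_def)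
      ultimately show ?thesis by blast
    qed
    moreover have "0 < r i" if "i \<in> K" for i using that by (auto simp: K_def r_def)
    ultimately obtain C where C: "countable C" "C \<subseteq> K"
        "pairwise (\<lambda>i j. disjnt (cball (c i) (r i)) (cball (c j) (r j))) C"
        "negligible (E \<epsilon> - (\<Union>i\<in>C. cball (c i) (r i)))"
      using Vitali_covering_theorem_cballs[of K r "E \<epsilon>" c] by blast
    have bound: "measure lebesgue (\<Union>i\<in>J. cball (c i) (r i)) \<le> \<eta>" if J: "J \<subseteq> C" "finite J" for J
    proof -
      define k where "k = (\<lambda>(x::real, y). (x, {min x y..max x y}))"
      have pwJ: "pairwise (\<lambda>i j. disjnt (cball (c i) (r i)) (cball (c j) (r j))) J"
        using C(3) J(1) by (rule pairwise_subset)
      have sndk: "snd (k i) = cball (c i) (r i)" for i by (cases i) (simp only: cb, simp add: k_def)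
      have ne: "cball (c i) (r i) \<noteq> {}" for i by (cases i) (simp add: cb)
      have inj: "inj_on k J"
      proof (rule inj_onI, rule ccontr)
        fix i j assume ij: "i \<in> J" "j \<in> J" "k i = k j" "i \<noteq> j"
        have "disjnt (snd (k i)) (snd (k j))" using pairwiseD[OF pwJ ij(1,2,4)] by (simp only: sndk)
        then have "snd (k i) = {}" using ij(3) by (simp add: disjnt_def)
        then show False using ne[of i] by (simp only: sndk)
      qed
      have "k ` J tagged_partial_division_of cbox a b"
        unfolding tagged_partial_division_of_def
      proof (intro conjI allI impI)
        show "finite (k ` J)" using J by simp
        fix x l assume "(x, l) \<in> k ` J"
        then obtain y where y: "(x, y) \<in> K" "l = {min x y..max x y}" using J C(2) by (auto simp: k_def)
        then have "x \<in> {a..b}" "y \<in> {a..b}" by (auto simp: K_def E_def)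
        then show "x \<in> l" "l \<subseteq> cbox a b" using y by (auto simp: cbox_interval min_def max_def split: if_splits)
        show "\<exists>a b. l = cbox a b" using y by (auto simp: cbox_interval)
      next
        fix x1 l1 x2 l2 assume *: "(x1, l1) \<in> k ` J \<and> (x2, l2) \<in> k ` J \<and> (x1, l1) \<noteq> (x2, l2)"
        then obtain i j where ij: "i \<in> J" "j \<in> J" "k i = (x1, l1)" "k j = (x2, l2)" by (metis imageE)
        have "i \<noteq> j" using * ij(3,4) by metis
        then have "disjnt (snd (k i)) (snd (k j))" unfolding sndk by (rule pairwiseD[OF pwJ ij(1,2)])
        then have "l1 \<inter> l2 = {}" using ij(3,4) by (simp add: disjnt_def)
        then show "interior l1 \<inter> interior l2 = {}" using interior_subset by blast
      qed
      moreover have "\<gamma> fine (k ` J)"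
        using J C(2) by (force simp: fine_def k_def K_def)
      ultimately have less: "sum (\<lambda>(x,k). norm(measure lborel k *\<^sub>R f x - integral k f)) (k ` J) < \<eta> * \<epsilon>"
        by (rule \<gamma>)
      have "\<epsilon> * measure lebesgue (cball (c i) (r i))
          \<le> (\<lambda>(x,k). norm(measure lborel k *\<^sub>R f x - integral k f)) (k i)" if iJ: "i \<in> J" for i
      proof -
        obtain x y where i: "i = (x, y)" by (cases i)
        then have K: "(x, y) \<in> K" using iJ J C(2) by auto
        then have xy: "x \<in> {a..b}" "y \<in> {a..b}" "y \<noteq> x"
          "norm (F y - F x - (y - x) *\<^sub>R f x) > \<epsilon> * \<bar>y - x\<bar>" by (auto simp: K_def E_def)
        have m: "measure lebesgue {min x y..max x y} = \<bar>y - x\<bar>" by (auto simp: min_def max_def)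
        have "norm (\<bar>y - x\<bar> *\<^sub>R f x - integral {min x y..max x y} f)
            = norm (F y - F x - (y - x) *\<^sub>R f x)"
        proof (cases "x \<le> y")
          case True
          then have "integral {min x y..max x y} f = F y - F x" using Fdiff[of x y] xy by simp
          then show ?thesis using True by (simp add: norm_minus_commute)
        next
          case False
          then have "integral {min x y..max x y} f = F x - F y" using Fdiff[of y x] xy by simp
          moreover have "\<bar>y - x\<bar> *\<^sub>R f x - (F x - F y) = F y - F x - (y - x) *\<^sub>R f x"
            using False by (simp add: algebra_simps)
          ultimately show ?thesis by metis
        qed
        then show ?thesis using xy(4) i m by (simp add: cb k_def)
      qed
      then have "(\<Sum>i\<in>J. \<epsilon> * measure lebesgue (cball (c i) (r i)))
          \<le> (\<Sum>i\<in>J. (\<lambda>(x,k). norm(measure lborel k *\<^sub>R f x - integral k f)) (k i))"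
        by (rule sum_mono)
      also have "\<dots> = sum (\<lambda>(x,k). norm(measure lborel k *\<^sub>R f x - integral k f)) (k ` J)"
        by (simp add: sum.reindex[OF inj] o_def)
      finally have "\<epsilon> * (\<Sum>i\<in>J. measure lebesgue (cball (c i) (r i))) < \<epsilon> * \<eta>"
        using less by (simp add: sum_distrib_left mult.commute)
      then have "(\<Sum>i\<in>J. measure lebesgue (cball (c i) (r i))) \<le> \<eta>" using \<open>\<epsilon> > 0\<close> by simp
      moreover have "measure lebesgue (\<Union>i\<in>J. cball (c i) (r i)) = (\<Sum>i\<in>J. measure lebesgue (cball (c i) (r i)))"
        by (rule measure_UNION'[OF J(2) _ pwJ]) auto
      ultimately show ?thesis by simp
    qed
    have U: "(\<Union>i\<in>C. cball (c i) (r i)) \<in> lmeasurable" "measure lebesgue (\<Union>i\<in>C. cball (c i) (r i)) \<le> \<eta>"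
      by (rule fmeasurable_UN_bound measure_UN_bound, use C(1) bound in auto)+
    define V where "V = E \<epsilon> - (\<Union>i\<in>C. cball (c i) (r i))"
    have V: "V \<in> lmeasurable" "measure lebesgue V = 0"
      using C(4) by (auto simp: V_def negligible_imp_measurable negligible_imp_measure0)
    show "\<exists>T. E \<epsilon> \<subseteq> T \<and> T \<in> lmeasurable \<and> measure lebesgue T \<le> \<eta>"
    proof (intro exI conjI)
      show "E \<epsilon> \<subseteq> V \<union> (\<Union>i\<in>C. cball (c i) (r i))" by (auto simp: V_def)
      show "V \<union> (\<Union>i\<in>C. cball (c i) (r i)) \<in> lmeasurable" using U V by auto
      show "measure lebesgue (V \<union> (\<Union>i\<in>C. cball (c i) (r i))) \<le> \<eta>"
        using measure_Un_le[of V lebesgue "\<Union>i\<in>C. cball (c i) (r i)"] U V by (simp add: fmeasurableD)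
    qed
  qed
  \<comment> \<open>the sets \<open>E\<close> only contain interior points\<close>
  define N where "N = {a, b} \<union> (\<Union>n::nat. E (1 / Suc n))"
  have negU: "negligible (\<Union>n::nat. E (1 / Suc n))"
    by (rule negligible_countable_Union) (use neg in auto)
  have "negligible {a, b}" by (rule negligible_finite) auto
  then have "negligible N" unfolding N_def using negU by (rule negligible_Un)
  moreover have "(F has_vector_derivative f x) (at x within {a..b})" if x: "x \<in> {a..b} - N" for x
    unfolding has_vector_derivative_def has_derivative_within_alt
  proof (intro conjI bounded_linear_scaleR_left allI impI)
    fix e :: real assume "e > 0"
    then obtain n where n: "1 / Suc n < e" using nat_approx_posE by metis
    have "x \<notin> E (1 / Suc n)" "x \<in> {a<..<b}" using x by (auto simp: N_def)
    then obtain d where "d > 0" and d: "\<And>y. y \<in> {a..b} \<Longrightarrow> y \<noteq> x \<Longrightarrow> \<bar>y - x\<bar> < d \<Longrightarrow>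
        norm (F y - F x - (y - x) *\<^sub>R f x) \<le> 1 / Suc n * \<bar>y - x\<bar>"
      unfolding E_def by force
    show "\<exists>d>0. \<forall>y\<in>{a..b}. norm (y - x) < d \<longrightarrow> norm (F y - F x - (y - x) *\<^sub>R f x) \<le> e * norm (y - x)"
    proof (intro exI[of _ d] conjI ballI impI \<open>d > 0\<close>)
      fix y assume y: "y \<in> {a..b}" "norm (y - x) < d"
      show "norm (F y - F x - (y - x) *\<^sub>R f x) \<le> e * norm (y - x)"
      proof (cases "y = x")
        case False
        then have "norm (F y - F x - (y - x) *\<^sub>R f x) \<le> 1 / Suc n * \<bar>y - x\<bar>" using d y by simp
        also have "\<dots> \<le> e * \<bar>y - x\<bar>" using n by (intro mult_right_mono) auto
        finally show ?thesis by simp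
      qed simp
    qed
  qed
  ultimately show ?thesis using that[of N] by (simp add: F_def)
qed

lemma AE_lebesgue_on_subset:
  assumes "AE t in lebesgue_on I. P t" "J \<subseteq> I" "I \<in> sets lebesgue" "J \<in> sets lebesgue"
  shows "AE t in lebesgue_on J. P t"
proof -
  have "AE t in lebesgue. t \<in> I \<longrightarrow> P t"
    using assms(1) by (subst AE_restrict_space_iff[symmetric]) (use assms in auto)
  then have "AE t in lebesgue. t \<in> J \<longrightarrow> P t" by eventually_elim (use assms in auto)
  then show ?thesis by (subst AE_restrict_space_iff) (use assms in auto)
qed

lemma AE_lebesgue_on_iff:
  assumes "I \<in> sets lebesgue"
  shows "(AE t in lebesgue_on I. P t) \<longleftrightarrow> (\<exists>N. negligible N \<and> (\<forall>t\<in>I - N. P t))"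
proof -
  have "(AE t in lebesgue_on I. P t) \<longleftrightarrow> (AE t in lebesgue. t \<in> I \<longrightarrow> P t)"
    by (subst AE_restrict_space_iff) (use assms in auto)
  also have "\<dots> \<longleftrightarrow> (\<exists>N. negligible N \<and> (\<forall>t\<in>I - N. P t))"
  proof
    assume "AE t in lebesgue. t \<in> I \<longrightarrow> P t"
    then obtain N where "\<And>t. t \<in> space lebesgue - N \<Longrightarrow> t \<in> I \<longrightarrow> P t" "N \<in> null_sets lebesgue"
      by (rule AE_E3) blast
    then show "\<exists>N. negligible N \<and> (\<forall>t\<in>I - N. P t)"
      by (intro exI[of _ N]) (auto simp: negligible_iff_null_sets)
  next
    assume "\<exists>N. negligible N \<and> (\<forall>t\<in>I - N. P t)"
    then obtain N where "negligible N" "\<forall>t\<in>I - N. P t" by blast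
    then show "AE t in lebesgue. t \<in> I \<longrightarrow> P t"
      by (intro AE_I'[of N]) (auto simp: negligible_iff_null_sets)
  qed
  finally show ?thesis .
qed

lemma horizon_sets: "horizon I \<Longrightarrow> I \<in> sets lebesgue"
  by (auto simp: horizon_def)

lemma horizon_Icc: "0 < \<tau> \<Longrightarrow> horizon {0..\<tau>}"
  by (auto simp: horizon_def)

lemma horizon_Ici: "horizon {0..}"
  by (auto simp: horizon_def)

lemma horizon_0: "horizon I \<Longrightarrow> 0 \<in> I"
  by (auto simp: horizon_def)

lemma horizon_Icc_subset: "horizon I \<Longrightarrow> t \<in> I \<Longrightarrow> {0..t} \<subseteq> I"
  by (auto simp: horizon_def)

text \<open>A continuous function that lies in a closed set almost everywhere lies in it everywhere.\<close>

lemma AE_closed_imp_everywhere: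
  fixes f :: "real \<Rightarrow> 'a::metric_space"
  assumes I: "horizon I" and f: "continuous_on I f" and "closed C"
    and ae: "AE t in lebesgue_on I. f t \<in> C" and "t \<in> I"
  shows "f t \<in> C"
proof (rule ccontr)
  assume "f t \<notin> C"
  then have "f t \<in> - C" "open (- C)" using \<open>closed C\<close> by auto
  then obtain e where "e > 0" and "ball (f t) e \<subseteq> - C" by (meson openE)
  then have e: "y \<notin> C" if "dist y (f t) < e" for y using that by (auto simp: dist_commute)
  obtain d where "d > 0" and d: "\<And>s. s \<in> I \<Longrightarrow> dist s t < d \<Longrightarrow> dist (f s) (f t) < e"
    using f \<open>t \<in> I\<close> \<open>e > 0\<close> unfolding continuous_on_iff by meson
  have "\<exists>u v. u < v \<and> {u..v} \<subseteq> I \<and> (\<forall>s\<in>{u..v}. dist s t < d)"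
  proof (cases "\<exists>\<tau>>0. I = {0..\<tau>} \<and> t = \<tau>")
    case True
    then show ?thesis using \<open>d > 0\<close> \<open>t \<in> I\<close>
      by (intro exI[of _ "max 0 (t - d/2)"] exI[of _ t]) (auto simp: dist_real_def)
  next
    case False
    then consider "I = {0..}" "t \<ge> 0" | \<tau> where "I = {0..\<tau>}" "0 \<le> t" "t < \<tau>"
      using I \<open>t \<in> I\<close> by (fastforce simp: horizon_def)
    then show ?thesis
    proof cases
      case 1
      then show ?thesis using \<open>d > 0\<close>
        by (intro exI[of _ t] exI[of _ "t + d/2"]) (auto simp: dist_real_def)
    next
      case 2
      then show ?thesis using \<open>d > 0\<close>
        by (intro exI[of _ t] exI[of _ "min \<tau> (t + d/2)"]) (auto simp: dist_real_def)
    qed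
  qed
  then obtain u v where uv: "u < v" "{u..v} \<subseteq> I" "\<forall>s\<in>{u..v}. dist s t < d" by blast
  obtain N where N: "negligible N" "\<forall>s\<in>I - N. f s \<in> C"
    using ae AE_lebesgue_on_iff[OF horizon_sets[OF I]] by blast
  have "{u..v} \<subseteq> N" using uv N(2) d e by (meson DiffI subset_iff)
  then have "negligible {u..v}" using N(1) negligible_subset by blast
  then show False using uv(1) negligible_interval(1)[of u v] by (simp add: cbox_interval box_real)
qed

lemma AC_imp_continuous_on:
  assumes "horizon I" "AC I f"
  shows "continuous_on I f"
proof -
  have *: "continuous_on {a..b} f" if "{a..b} \<subseteq> I" for a b
    using assms that by (auto simp: AC_def intro: abs_cont_imp_continuous_on)
  from \<open>horizon I\<close> show ?thesis
    unfolding horizon_def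
  proof
    assume I: "I = {0..}"
    show ?thesis
      unfolding continuous_on_eq_continuous_within
    proof
      fix x assume "x \<in> I"
      have "continuous (at x within {0..x+1}) f"
        using *[of 0 "x+1"] I \<open>x \<in> I\<close> by (auto simp: continuous_on_eq_continuous_within)
      moreover have "at x within {0..x+1} = at x within I"
        by (rule at_within_nhd[of x "{x-1<..<x+1}"]) (use I in auto)
      ultimately show "continuous (at x within I) f" by simp
    qed
  qed (use * in auto)
qed

lemma AC_eq_of_AE_eq:
  fixes z w :: "real \<Rightarrow> 'a::real_normed_vector"
  assumes "horizon I" "AC I z" "AC I w" "AE t in lebesgue_on I. z t = w t" "t \<in> I"
  shows "z t = w t"
proof -
  have "z t - w t \<in> {0}"
    by (rule AE_closed_imp_everywhere[where f = "\<lambda>t. z t - w t", OF assms(1) _ _ _ assms(5)])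
       (use assms in \<open>auto intro!: continuous_on_diff dest: AC_imp_continuous_on\<close>)
  then show ?thesis by simp
qed

lemma AC_version_props:
  assumes "is_AC_class I g"
  shows "AC I (AC_version I g)" "AE t in lebesgue_on I. AC_version I g t = g t"
proof -
  have "\<exists>z. AC I z \<and> (AE t in lebesgue_on I. z t = g t)" using assms by (simp add: is_AC_class_def)
  from someI_ex[OF this] show "AC I (AC_version I g)" "AE t in lebesgue_on I. AC_version I g t = g t"
    unfolding AC_version_def by auto
qed

lemma AC_version_eq:
  assumes "horizon I" "AC I z" "AE t in lebesgue_on I. z t = g t" "t \<in> I"
  shows "AC_version I g t = z t"
proof -
  have c: "is_AC_class I g" using assms by (auto simp: is_AC_class_def)
  have "AE t in lebesgue_on I. AC_version I g t = z t"
    using AC_version_props(2)[OF c] assms(3) by eventually_elim simp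
  then show ?thesis by (rule AC_eq_of_AE_eq[OF assms(1) AC_version_props(1)[OF c] assms(2) _ assms(4)])
qed

section \<open>Square integrable functions\<close>

lemma abs_cont_subinterval:
  assumes "abs_cont_on_interval a b f" "a \<le> c" "d \<le> b"
  shows "abs_cont_on_interval c d f"
  unfolding abs_cont_on_interval_def
proof (intro allI impI)
  fix \<epsilon> :: real assume "\<epsilon> > 0"
  then obtain \<delta> where "\<delta> > 0" and \<delta>: "\<forall>D. finite D \<and> (\<forall>(c, d)\<in>D. a \<le> c \<and> c \<le> d \<and> d \<le> b) \<and>
        pairwise (\<lambda>(c, d) (c', d'). disjnt {c<..<d} {c'<..<d'}) D \<and>
        (\<Sum>(c, d)\<in>D. d - c) < \<delta> \<longrightarrow> (\<Sum>(c, d)\<in>D. norm (f d - f c)) < \<epsilon>"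
    using assms(1) unfolding abs_cont_on_interval_def by blast
  show "\<exists>\<delta>>0. \<forall>D. finite D \<and> (\<forall>(c', d')\<in>D. c \<le> c' \<and> c' \<le> d' \<and> d' \<le> d) \<and>
        pairwise (\<lambda>(c, d) (c', d'). disjnt {c<..<d} {c'<..<d'}) D \<and>
        (\<Sum>(c, d)\<in>D. d - c) < \<delta> \<longrightarrow> (\<Sum>(c, d)\<in>D. norm (f d - f c)) < \<epsilon>"
  proof (intro exI[of _ \<delta>] conjI \<open>\<delta> > 0\<close> allI impI)
    fix D assume D: "finite D \<and> (\<forall>(c', d')\<in>D. c \<le> c' \<and> c' \<le> d' \<and> d' \<le> d) \<and>
        pairwise (\<lambda>(c, d) (c', d'). disjnt {c<..<d} {c'<..<d'}) D \<and>
        (\<Sum>(c, d)\<in>D. d - c) < \<delta>"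
    have 1: "\<forall>(c', d')\<in>D. a \<le> c' \<and> c' \<le> d' \<and> d' \<le> b"
    proof clarify
      fix c' d' assume "(c', d') \<in> D"
      then show "a \<le> c' \<and> c' \<le> d' \<and> d' \<le> b"
        using D[THEN conjunct2, THEN conjunct1] assms(2,3) by force
    qed
    show "(\<Sum>(c, d)\<in>D. norm (f d - f c)) < \<epsilon>"
      by (rule \<delta>[rule_format])
        (intro conjI 1 D[THEN conjunct1] D[THEN conjunct2, THEN conjunct2])
  qed
qed

lemma AC_iff_initial:
  assumes "horizon I"
  shows "AC I f \<longleftrightarrow> (\<forall>\<tau>\<in>I. abs_cont_on_interval 0 \<tau> f)"
proof
  assume "AC I f"
  then show "\<forall>\<tau>\<in>I. abs_cont_on_interval 0 \<tau> f"
    using horizon_Icc_subset[OF assms] by (auto simp: AC_def)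
next
  assume *: "\<forall>\<tau>\<in>I. abs_cont_on_interval 0 \<tau> f"
  show "AC I f"
    unfolding AC_def
  proof (intro allI impI)
    fix a b assume ab: "{a..b} \<subseteq> I"
    show "abs_cont_on_interval a b f"
    proof (cases "a \<le> b")
      case True
      then have "a \<in> I" "b \<in> I" using ab by auto
      then have "0 \<le> a" "abs_cont_on_interval 0 b f" using * assms by (auto simp: horizon_def)
      then show ?thesis using abs_cont_subinterval[of 0 b f a b] by simp
    next
      case False
      then show ?thesis by (intro abs_cont_on_intervalI_lipschitz[where L = 0]) auto
    qed
  qed
qed

lemma AC_bilinear:
  fixes prod :: "'a::real_normed_vector \<Rightarrow> 'b::real_normed_vector \<Rightarrow> 'c::real_normed_vector"
  assumes "bounded_bilinear prod" "AC I f" "AC I g"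
  shows "AC I (\<lambda>t. prod (f t) (g t))"
  unfolding AC_def
  by (intro allI impI abs_cont_bilinear[OF assms(1)]) (use assms(2,3) in \<open>auto simp: AC_def\<close>)

lemma AC_linear:
  assumes "bounded_linear h" "AC I f"
  shows "AC I (\<lambda>t. h (f t))"
  unfolding AC_def
  by (intro allI impI abs_cont_linear[OF assms(1)]) (use assms(2) in \<open>auto simp: AC_def\<close>)

lemma AC_C1:
  assumes "\<And>t. (f has_vector_derivative f' t) (at t)" "continuous_on UNIV f'"
  shows "AC I f"
  unfolding AC_def
proof (intro allI impI abs_cont_C1[where f' = f'])
  show "(f has_vector_derivative f' t) (at t within {a..b})" for a b t
    by (rule has_vector_derivative_at_within[OF assms(1)])
  show "continuous_on {a..b} f'" for a b
    by (rule continuous_on_subset[OF assms(2) subset_UNIV])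
qed

lemma integrable_lebesgue_on_mono:
  fixes f :: "real \<Rightarrow> 'a::euclidean_space"
  assumes "integrable (lebesgue_on S) f" "T \<subseteq> S" "S \<in> sets lebesgue" "T \<in> sets lebesgue"
  shows "integrable (lebesgue_on T) f"
proof -
  have "set_integrable lebesgue S f"
    using assms integrable_restrict_space[of S lebesgue f] by (simp add: set_integrable_def)
  then have "set_integrable lebesgue T f"
    by (rule set_integrable_subset) (use assms in auto)
  then show ?thesis
    using assms integrable_restrict_space[of T lebesgue f] by (simp add: set_integrable_def)
qed

lemma L2_on_subset:
  assumes "L2_on {a..b} f" "{c..d} \<subseteq> {a..b}"
  shows "L2_on {c..d} f"
  using assms unfolding L2_on_def
  by (auto intro: measurable_restrict_mono[OF _ assms(2)] integrable_lebesgue_on_mono[OF _ assms(2)])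

lemma L2_loc_iff_initial:
  assumes "horizon I"
  shows "L2_loc I f \<longleftrightarrow> (\<forall>\<tau>\<in>I. L2_on {0..\<tau>} f)"
proof
  assume "L2_loc I f"
  then show "\<forall>\<tau>\<in>I. L2_on {0..\<tau>} f"
    using horizon_Icc_subset[OF assms] by (auto simp: L2_loc_def)
next
  assume *: "\<forall>\<tau>\<in>I. L2_on {0..\<tau>} f"
  show "L2_loc I f"
    unfolding L2_loc_def
  proof (intro allI impI)
    fix a b assume ab: "{a..b} \<subseteq> I"
    show "L2_on {a..b} f"
    proof (cases "a \<le> b")
      case True
      then have "a \<in> I" "b \<in> I" using ab by auto
      then show ?thesis using L2_on_subset[of 0 b f a b] * assms by (auto simp: horizon_def)
    next
      case False
      then have "{a..b} = {}" by auto
      moreover have "L2_on {0..0} f" using * horizon_0[OF assms] by blast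
      ultimately show ?thesis using L2_on_subset[of 0 0 f a b] by auto
    qed
  qed
qed

lemma finite_measure_Icc: "finite_measure (lebesgue_on {a..b::real})"
  by (rule finite_measure_lebesgue_on) auto

lemma L2_on_imp_integrable:
  fixes f :: "real \<Rightarrow> 'a::euclidean_space"
  assumes "L2_on {a..b} f"
  shows "integrable (lebesgue_on {a..b}) f"
proof (rule Bochner_Integration.integrable_bound)
  interpret finite_measure "lebesgue_on {a..b}" by (rule finite_measure_Icc)
  show "integrable (lebesgue_on {a..b}) (\<lambda>t. 1 + (norm (f t))\<^sup>2)"
    using assms by (intro Bochner_Integration.integrable_add) (auto simp: L2_on_def)
  show "f \<in> borel_measurable (lebesgue_on {a..b})" using assms by (simp add: L2_on_def)
  have "norm x \<le> 1 + (norm x)\<^sup>2" for x :: 'a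
  proof -
    have "0 \<le> (norm x - 1)\<^sup>2" by simp
    then have "2 * norm x \<le> 1 + (norm x)\<^sup>2" by (simp add: power2_eq_square algebra_simps)
    then show ?thesis using norm_ge_zero[of x] by linarith
  qed
  then show "AE x in lebesgue_on {a..b}. norm (f x) \<le> norm (1 + (norm (f x))\<^sup>2)"
    by (intro always_eventually allI) (simp add: add_nonneg_nonneg)
qed

lemma borel_measurable_bilinear:
  fixes prod :: "'a::euclidean_space \<Rightarrow> 'b::euclidean_space \<Rightarrow> 'c::euclidean_space"
  assumes "bounded_bilinear prod" "f \<in> borel_measurable M" "g \<in> borel_measurable M"
  shows "(\<lambda>t. prod (f t) (g t)) \<in> borel_measurable M"
  by (rule borel_measurable_continuous_Pair[OF assms(2,3)])
     (intro bounded_bilinear.continuous_on[OF assms(1)] continuous_intros)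

lemma L2_on_bilinear_integrable:
  fixes prod :: "'a::euclidean_space \<Rightarrow> 'b::euclidean_space \<Rightarrow> 'c::euclidean_space"
  assumes bl: "bounded_bilinear prod" and f: "L2_on S f" and g: "L2_on S g"
  shows "integrable (lebesgue_on S) (\<lambda>t. prod (f t) (g t))"
proof -
  obtain K where K: "K > 0" "\<And>x y. norm (prod x y) \<le> norm x * norm y * K"
    using bounded_bilinear.pos_bounded[OF bl] by blast
  show ?thesis
  proof (rule Bochner_Integration.integrable_bound)
    show "integrable (lebesgue_on S) (\<lambda>t. K * ((norm (f t))\<^sup>2 + (norm (g t))\<^sup>2))"
      using f g by (simp add: L2_on_def)
    show "(\<lambda>t. prod (f t) (g t)) \<in> borel_measurable (lebesgue_on S)"
      using f g by (intro borel_measurable_bilinear[OF bl]) (auto simp: L2_on_def)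
    have "norm (prod x y) \<le> K * ((norm x)\<^sup>2 + (norm y)\<^sup>2)" for x y
    proof -
      have "norm x * norm y \<le> (norm x)\<^sup>2 + (norm y)\<^sup>2"
      proof -
        have "0 \<le> (norm x - norm y)\<^sup>2" by simp
        then have "2 * (norm x * norm y) \<le> (norm x)\<^sup>2 + (norm y)\<^sup>2"
          by (simp add: power2_eq_square algebra_simps)
        moreover have "0 \<le> norm x * norm y" by simp
        ultimately show ?thesis by linarith
      qed
      then show ?thesis using K(2)[of x y] K(1) by (smt (verit) mult.commute mult_left_mono)
    qed
    then show "AE x in lebesgue_on S. norm (prod (f x) (g x)) \<le> norm (K * ((norm (f x))\<^sup>2 + (norm (g x))\<^sup>2))"
      using K(1) by (intro always_eventually allI) simp
  qed
qed

lemma L2_on_inner_integrable: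
  assumes "L2_on S f" "L2_on S g"
  shows "integrable (lebesgue_on S) (\<lambda>t. f t \<bullet> g t)"
  by (rule L2_on_bilinear_integrable[OF bounded_bilinear_inner assms])

lemma continuous_bilinear_L2_on:
  fixes prod :: "'a::euclidean_space \<Rightarrow> 'b::euclidean_space \<Rightarrow> 'c::euclidean_space"
  assumes bl: "bounded_bilinear prod" and f: "continuous_on {a..b} f" and g: "L2_on {a..b} g"
  shows "L2_on {a..b} (\<lambda>t. prod (f t) (g t))"
proof -
  obtain K where K: "K > 0" "\<And>x y. norm (prod x y) \<le> norm x * norm y * K"
    using bounded_bilinear.pos_bounded[OF bl] by blast
  have "bounded (f ` {a..b})" by (intro compact_imp_bounded compact_continuous_image f) simp
  then obtain M where M: "M > 0" "\<And>t. t \<in> {a..b} \<Longrightarrow> norm (f t) \<le> M"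
    unfolding bounded_pos by (metis imageI)
  have meas: "(\<lambda>t. prod (f t) (g t)) \<in> borel_measurable (lebesgue_on {a..b})"
    using g continuous_imp_measurable_on_sets_lebesgue[OF f]
    by (intro borel_measurable_bilinear[OF bl]) (auto simp: L2_on_def)
  moreover have "integrable (lebesgue_on {a..b}) (\<lambda>t. (norm (prod (f t) (g t)))\<^sup>2)"
  proof (rule Bochner_Integration.integrable_bound)
    show "integrable (lebesgue_on {a..b}) (\<lambda>t. (M * K)\<^sup>2 * (norm (g t))\<^sup>2)"
      using g by (simp add: L2_on_def)
    show "(\<lambda>t. (norm (prod (f t) (g t)))\<^sup>2) \<in> borel_measurable (lebesgue_on {a..b})"
      using meas by simp
    have "(norm (prod (f t) (g t)))\<^sup>2 \<le> (M * K)\<^sup>2 * (norm (g t))\<^sup>2" if "t \<in> {a..b}" for t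
    proof -
      have "norm (prod (f t) (g t)) \<le> norm (f t) * norm (g t) * K" by (rule K)
      also have "\<dots> \<le> M * norm (g t) * K" using M(2)[OF that] K(1) by (intro mult_right_mono) auto
      finally have "(norm (prod (f t) (g t)))\<^sup>2 \<le> (M * norm (g t) * K)\<^sup>2" by (intro power_mono) auto
      then show ?thesis by (simp add: power_mult_distrib ac_simps)
    qed
    then show "AE t in lebesgue_on {a..b}. norm ((norm (prod (f t) (g t)))\<^sup>2) \<le> norm ((M * K)\<^sup>2 * (norm (g t))\<^sup>2)"
      by (intro AE_I2) simp
  qed
  ultimately show ?thesis by (simp add: L2_on_def)
qed

lemma L2_on_const: "L2_on {a..b} (\<lambda>t. c)"
proof -
  interpret finite_measure "lebesgue_on {a..b}" by (rule finite_measure_Icc)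
  show ?thesis by (simp add: L2_on_def)
qed

lemma L2_on_continuous:
  fixes f :: "real \<Rightarrow> 'a::euclidean_space"
  assumes "continuous_on {a..b} f"
  shows "L2_on {a..b} f"
proof -
  have "bounded_bilinear (\<lambda>(x::'a) (r::real). r *\<^sub>R x)"
    using bounded_bilinear.flip[OF bounded_bilinear_scaleR] by simp
  from continuous_bilinear_L2_on[OF this assms L2_on_const[of _ _ 1]] show ?thesis by simp
qed

lemma L2_on_linear:
  fixes f :: "real \<Rightarrow> 'a::euclidean_space" and h :: "'a \<Rightarrow> 'b::euclidean_space"
  assumes "bounded_linear h" "L2_on {a..b} f"
  shows "L2_on {a..b} (\<lambda>t. h (f t))"
proof -
  have "bounded_bilinear (\<lambda>(r::real) x. r *\<^sub>R h x)"
    by (intro bounded_bilinear.comp[OF bounded_bilinear_scaleR] bounded_linear_ident assms)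
  from continuous_bilinear_L2_on[OF this continuous_on_const[of _ 1] assms(2)] show ?thesis by simp
qed

lemma L2_on_matrix:
  fixes f :: "real \<Rightarrow> real^'a" and M :: "real^'a^'b"
  shows "L2_on {a..b} f \<Longrightarrow> L2_on {a..b} (\<lambda>t. M *v f t)"
  by (rule L2_on_linear[OF matrix_vector_mul_bounded_linear])

lemma L2_on_add:
  fixes f :: "real \<Rightarrow> 'a::euclidean_space"
  assumes "L2_on S f" "L2_on S g"
  shows "L2_on S (\<lambda>t. f t + g t)"
proof -
  have meas: "(\<lambda>t. f t + g t) \<in> borel_measurable (lebesgue_on S)"
    using assms by (auto simp: L2_on_def)
  moreover have "integrable (lebesgue_on S) (\<lambda>t. (norm (f t + g t))\<^sup>2)"
  proof -
    have "(norm (f t + g t))\<^sup>2 = (norm (f t))\<^sup>2 + (norm (g t))\<^sup>2 + 2 * (f t \<bullet> g t)" for t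
      by (simp add: power2_norm_eq_inner inner_add_left inner_add_right inner_commute)
    then show ?thesis using assms L2_on_inner_integrable[OF assms] by (simp add: L2_on_def)
  qed
  ultimately show ?thesis by (simp add: L2_on_def)
qed

lemma LINT_eq_integral:
  fixes h :: "real \<Rightarrow> 'a::euclidean_space"
  assumes "integrable (lebesgue_on {a..b}) h" "t \<le> b"
  shows "(LINT s|lebesgue_on {a..t}. h s) = integral {a..t} h"
  by (rule lebesgue_integral_eq_integral)
     (use assms in \<open>auto intro: integrable_lebesgue_on_mono\<close>)

text \<open>The bound \<open>\<bar>h\<bar> \<le> \<bar>h\<bar>\<^sup>2 / 2k + k / 2\<close> splits the increments into a part controlled by the
  \<open>L\<^sup>2\<close> norm and a part controlled by the total length.\<close>

lemma abs_cont_indefinite_integral: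
  fixes h :: "real \<Rightarrow> 'a::euclidean_space"
  assumes h: "L2_on {a..b} h"
  shows "abs_cont_on_interval a b (\<lambda>t. integral {a..t} h)"
  unfolding abs_cont_on_interval_def
proof (intro allI impI)
  fix \<epsilon> :: real assume "\<epsilon> > 0"
  define w where "w = (\<lambda>t. (norm (h t))\<^sup>2)"
  have hint: "h integrable_on {a..b}"
    using L2_on_imp_integrable[OF h] by (rule integrable_on_lebesgue_on) auto
  have wint: "w integrable_on {a..b}"
    unfolding w_def by (rule integrable_on_lebesgue_on) (use h in \<open>auto simp: L2_on_def\<close>)
  define W where "W = integral {a..b} w"
  have "W \<ge> 0" unfolding W_def by (rule integral_nonneg[OF wint]) (simp add: w_def)
  \<comment> \<open>\<open>W + 1\<close> instead of \<open>W\<close> keeps \<open>k\<close> positive\<close>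
  define k where "k = (W + 1) / \<epsilon>"
  have "k > 0" using \<open>\<epsilon> > 0\<close> \<open>W \<ge> 0\<close> by (simp add: k_def)
  have kW: "W / (2 * k) < \<epsilon> / 2"
    using \<open>\<epsilon> > 0\<close> \<open>W \<ge> 0\<close> by (simp add: k_def field_simps)
  show "\<exists>\<delta>>0. \<forall>D. finite D \<and> (\<forall>(c, d)\<in>D. a \<le> c \<and> c \<le> d \<and> d \<le> b) \<and>
        pairwise (\<lambda>(c, d) (c', d'). disjnt {c<..<d} {c'<..<d'}) D \<and>
        (\<Sum>(c, d)\<in>D. d - c) < \<delta> \<longrightarrow>
        (\<Sum>(c, d)\<in>D. norm (integral {a..d} h - integral {a..c} h)) < \<epsilon>"
  proof (intro exI[of _ "\<epsilon> / k"] conjI allI impI)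
    show "\<epsilon> / k > 0" using \<open>\<epsilon> > 0\<close> \<open>k > 0\<close> by simp
    fix D assume D: "finite D \<and> (\<forall>(c, d)\<in>D. a \<le> c \<and> c \<le> d \<and> d \<le> b) \<and>
        pairwise (\<lambda>(c, d) (c', d'). disjnt {c<..<d} {c'<..<d'}) D \<and>
        (\<Sum>(c, d)\<in>D. d - c) < \<epsilon> / k"
    note D1 = D[THEN conjunct1] and D2 = D[THEN conjunct2, THEN conjunct1]
      and D3 = D[THEN conjunct2, THEN conjunct2, THEN conjunct1]
      and D4 = D[THEN conjunct2, THEN conjunct2, THEN conjunct2]
    define J where "J = (\<lambda>(c::real, d). {c..d})"
    have inj: "inj_on J D"
    proof (rule inj_onI)
      fix i j assume "i \<in> D" "j \<in> D" "J i = J j"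
      moreover obtain c d c' d' where "i = (c, d)" "j = (c', d')" by (cases i, cases j) auto
      ultimately show "i = j" using D2 by (force simp: J_def)
    qed
    have div: "(J ` D) division_of (\<Union>(J ` D))"
      unfolding division_of_def
    proof (intro conjI ballI impI)
      show "finite (J ` D)" using D1 by simp
      fix k assume "k \<in> J ` D"
      then show "k \<subseteq> \<Union>(J ` D)" by blast
      obtain c d where cd: "(c, d) \<in> D" "k = {c..d}" using \<open>k \<in> J ` D\<close> by (auto simp: J_def)
      then show "k \<noteq> {}" "\<exists>a b. k = cbox a b" using D2 by (auto simp: cbox_interval)
      fix k' assume "k' \<in> J ` D" "k \<noteq> k'"
      then obtain c' d' where cd': "(c', d') \<in> D" "k' = {c'..d'}" by (auto simp: J_def)
      then have "(c, d) \<noteq> (c', d')" using cd \<open>k \<noteq> k'\<close> by auto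
      from pairwiseD[OF D3 cd(1) cd'(1) this] have "disjnt {c<..<d} {c'<..<d'}" by simp
      then show "interior k \<inter> interior k' = {}" using cd cd' by (simp add: disjnt_def)
    qed simp
    have sub: "{c..d} \<subseteq> {a..b}" if "(c, d) \<in> D" for c d using D2 that by force
    have wsub: "w integrable_on {c..d}" if "(c, d) \<in> D" for c d
      by (rule integrable_subinterval_real[OF wint sub[OF that]])
    have "\<Union>(J ` D) \<subseteq> {a..b}"
    proof (rule Union_least)
      fix X assume "X \<in> J ` D"
      then obtain c d where "(c, d) \<in> D" "X = {c..d}" by (auto simp: J_def)
      then show "X \<subseteq> {a..b}" using sub by blast
    qed
    moreover have wU: "w integrable_on \<Union>(J ` D)"
      by (rule integrable_combine_division[OF div]) (use wsub in \<open>auto simp: J_def\<close>)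
    ultimately have "integral (\<Union>(J ` D)) w \<le> W"
      unfolding W_def by (intro integral_subset_le wint) (auto simp: w_def)
    moreover have "integral (\<Union>(J ` D)) w = (\<Sum>(c, d)\<in>D. integral {c..d} w)"
      unfolding integral_combine_division_topdown[OF wU div] sum.reindex[OF inj]
      by (simp add: J_def o_def case_prod_unfold)
    ultimately have sumw: "(\<Sum>(c, d)\<in>D. integral {c..d} w) \<le> W" by simp
    have "(\<Sum>(c, d)\<in>D. norm (integral {a..d} h - integral {a..c} h))
      \<le> (\<Sum>(c, d)\<in>D. integral {c..d} w / (2 * k) + k / 2 * (d - c))"
    proof (rule sum_mono, clarify)
      fix c d assume cd: "(c, d) \<in> D"
      then have le: "a \<le> c" "c \<le> d" "d \<le> b" using D2 by auto
      have "h integrable_on {a..d}" by (rule integrable_subinterval_real[OF hint]) (use le in auto)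
      then have "integral {a..c} h + integral {c..d} h = integral {a..d} h"
        using le by (intro Henstock_Kurzweil_Integration.integral_combine) auto
      then have "integral {a..d} h - integral {a..c} h = integral {c..d} h"
        by (metis add_diff_cancel_left')
      then have "norm (integral {a..d} h - integral {a..c} h) = norm (integral {c..d} h)" by simp
      also have "\<dots> \<le> integral {c..d} (\<lambda>t. w t / (2 * k) + k / 2)"
      proof (rule integral_norm_bound_integral)
        show "h integrable_on {c..d}" by (rule integrable_subinterval_real[OF hint sub[OF cd]])
        show "(\<lambda>t. w t / (2 * k) + k / 2) integrable_on {c..d}"
          using wsub[OF cd] by (intro integrable_add integrable_on_divide integrable_const_ivl) auto
        fix t assume "t \<in> {c..d}"
        have "0 \<le> (norm (h t) - k)\<^sup>2" by simp
        then show "norm (h t) \<le> w t / (2 * k) + k / 2"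
          using \<open>k > 0\<close> by (simp add: w_def field_simps power2_eq_square)
      qed
      also have "\<dots> = integral {c..d} w / (2 * k) + k / 2 * (d - c)"
        using wsub[OF cd] le
        by (subst integral_add) (auto intro!: integrable_on_divide integrable_const_ivl)
      finally show "norm (integral {a..d} h - integral {a..c} h) \<le> integral {c..d} w / (2 * k) + k / 2 * (d - c)" .
    qed
    also have "\<dots> = (\<Sum>(c, d)\<in>D. integral {c..d} w) / (2 * k) + k / 2 * (\<Sum>(c, d)\<in>D. d - c)"
      by (simp add: sum.distrib sum_distrib_left sum_divide_distrib case_prod_unfold)
    also have "\<dots> < \<epsilon> / 2 + \<epsilon> / 2"
    proof (rule add_le_less_mono)
      have "(\<Sum>(c, d)\<in>D. integral {c..d} w) / (2 * k) \<le> W / (2 * k)"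
        using sumw \<open>k > 0\<close> by (intro divide_right_mono) auto
      then show "(\<Sum>(c, d)\<in>D. integral {c..d} w) / (2 * k) \<le> \<epsilon> / 2" using kW by simp
      show "k / 2 * (\<Sum>(c, d)\<in>D. d - c) < \<epsilon> / 2"
        using D4 \<open>k > 0\<close> by (simp add: field_simps)
    qed
    finally show "(\<Sum>(c, d)\<in>D. norm (integral {a..d} h - integral {a..c} h)) < \<epsilon>" by simp
  qed
qed

lemma AE_horizonI:
  assumes I: "horizon I" and ae: "\<And>\<tau>. \<tau> \<in> I \<Longrightarrow> 0 < \<tau> \<Longrightarrow> AE t in lebesgue_on {0..\<tau>}. P t"
  shows "AE t in lebesgue_on I. P t"
  using I unfolding horizon_def
proof
  assume I0: "I = {0..}"
  have "\<forall>n. \<exists>N. negligible N \<and> (\<forall>t\<in>{0..real (Suc n)} - N. P t)"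
    using ae[of "real (Suc _)"] I0 by (subst AE_lebesgue_on_iff[symmetric]) auto
  then obtain N where N: "\<And>n. negligible (N n)" "\<And>n. \<forall>t\<in>{0..real (Suc n)} - N n. P t" by metis
  have "negligible (\<Union>n. N n)" by (rule negligible_countable_Union) (use N in auto)
  moreover have "P t" if "t \<in> I - (\<Union>n. N n)" for t
  proof -
    obtain n where "t \<le> real n" using real_arch_simple by blast
    then have "t \<in> {0..real (Suc n)} - N n" using that I0 by auto
    then show ?thesis using N(2) by blast
  qed
  ultimately show ?thesis using AE_lebesgue_on_iff[OF horizon_sets[OF I]] by blast
qed (use ae in auto)

lemma AE_derivative_horizon:
  assumes I: "horizon I"
    and ae: "\<And>\<tau>. \<tau> \<in> I \<Longrightarrow> 0 < \<tau> \<Longrightarrow>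
        AE t in lebesgue_on {0..\<tau>}. (f has_vector_derivative h t) (at t within {0..\<tau>})"
  shows "AE t in lebesgue_on I. (f has_vector_derivative h t) (at t within I)"
  using I unfolding horizon_def
proof
  assume I0: "I = {0..}"
  show ?thesis
  proof (rule AE_horizonI[OF I])
    fix \<tau> assume "\<tau> \<in> I" "0 < \<tau>"
    have *: "at t within {0..\<tau>+1} = at t within I" if "t \<in> {0..\<tau>}" for t
      by (rule at_within_nhd[of t "{t-1<..<t+1}"]) (use I0 that in auto)
    have "AE t in lebesgue_on {0..\<tau>+1}. (f has_vector_derivative h t) (at t within {0..\<tau>+1})"
      by (rule ae) (use \<open>0 < \<tau>\<close> I0 in auto)
    then have "AE t in lebesgue_on {0..\<tau>}. (f has_vector_derivative h t) (at t within {0..\<tau>+1})"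
      by (rule AE_lebesgue_on_subset) auto
    then show "AE t in lebesgue_on {0..\<tau>}. (f has_vector_derivative h t) (at t within I)"
      using AE_space by eventually_elim (use * in auto)
  qed
qed (use ae in auto)

lemma AE_derivative_subset:
  assumes "horizon I" "AE t in lebesgue_on I. (f has_vector_derivative h t) (at t within I)" "\<tau> \<in> I"
  shows "AE t in lebesgue_on {0..\<tau>}. (f has_vector_derivative h t) (at t within {0..\<tau>})"
proof -
  have sub: "{0..\<tau>} \<subseteq> I" using assms horizon_Icc_subset by blast
  have "AE t in lebesgue_on {0..\<tau>}. (f has_vector_derivative h t) (at t within I)"
    by (rule AE_lebesgue_on_subset[OF assms(2) sub]) (use assms horizon_sets in auto)
  then show ?thesis
    by eventually_elim (rule has_vector_derivative_within_subset[OF _ sub])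
qed

lemma indefinite_integral_horizon:
  fixes h :: "real \<Rightarrow> 'a::euclidean_space"
  assumes I: "horizon I" and h: "L2_loc I h"
  shows "AC I (\<lambda>t. c + (LINT s|lebesgue_on {0..t}. h s))"
    and "AE t in lebesgue_on I.
      ((\<lambda>t. c + (LINT s|lebesgue_on {0..t}. h s)) has_vector_derivative h t) (at t within I)"
proof -
  let ?F = "\<lambda>t. c + (LINT s|lebesgue_on {0..t}. h s)"
  have L2: "L2_on {0..\<tau>} h" if "\<tau> \<in> I" for \<tau> using h that L2_loc_iff_initial[OF I] by blast
  have eq: "(LINT s|lebesgue_on {0..t}. h s) = integral {0..t} h" if "\<tau> \<in> I" "t \<le> \<tau>" for t \<tau>
    by (rule LINT_eq_integral[OF L2_on_imp_integrable[OF L2[OF that(1)]] that(2)])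
  show "AC I ?F"
    unfolding AC_iff_initial[OF I]
  proof
    fix \<tau> assume "\<tau> \<in> I"
    have "?F t - ?F s = integral {0..t} h - integral {0..s} h" if "s \<le> \<tau>" "t \<le> \<tau>" for s t
      using eq[OF \<open>\<tau> \<in> I\<close>] that by simp
    then have "norm (?F t - ?F s) = norm (integral {0..t} h - integral {0..s} h)" if "s \<le> \<tau>" "t \<le> \<tau>" for s t
      using that by simp
    then have cong: "(\<Sum>(c, d)\<in>D. norm (?F d - ?F c)) = (\<Sum>(c, d)\<in>D. norm (integral {0..d} h - integral {0..c} h))"
      if "\<forall>(c, d)\<in>D. 0 \<le> c \<and> c \<le> d \<and> d \<le> \<tau>" for D
      using that by (intro sum.cong refl) force
    show "abs_cont_on_interval 0 \<tau> ?F"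
      using abs_cont_indefinite_integral[OF L2[OF \<open>\<tau> \<in> I\<close>]]
      unfolding abs_cont_on_interval_def using cong by (metis (no_types, lifting))
  qed
  show "AE t in lebesgue_on I. (?F has_vector_derivative h t) (at t within I)"
  proof (rule AE_derivative_horizon[OF I])
    fix \<tau> assume "\<tau> \<in> I" "0 < \<tau>"
    have "h integrable_on {0..\<tau>}"
      by (rule integrable_on_lebesgue_on[OF L2_on_imp_integrable[OF L2[OF \<open>\<tau> \<in> I\<close>]]]) auto
    then obtain N where N: "negligible N" "\<And>x. x \<in> {0..\<tau>} - N \<Longrightarrow>
       ((\<lambda>t. integral {0..t} h) has_vector_derivative h x) (at x within {0..\<tau>})"
      using indefinite_integral_has_derivative_ae by blast
    have "(?F has_vector_derivative h x) (at x within {0..\<tau>})" if x: "x \<in> {0..\<tau>} - N" for x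
    proof -
      have "((\<lambda>t. c + integral {0..t} h) has_vector_derivative h x) (at x within {0..\<tau>})"
        using has_vector_derivative_add[OF has_vector_derivative_const N(2)[OF x]] by simp
      then show ?thesis
        by (rule has_vector_derivative_transform[rotated 2]) (use eq[OF \<open>\<tau> \<in> I\<close>] x in auto)
    qed
    then show "AE t in lebesgue_on {0..\<tau>}. (?F has_vector_derivative h t) (at t within {0..\<tau>})"
      using N(1) by (subst AE_lebesgue_on_iff) auto
  qed
qed

lemma fundamental_theorem_AE:
  fixes f h :: "real \<Rightarrow> 'a::euclidean_space"
  assumes "a \<le> b" and ac: "abs_cont_on_interval a b f"
    and ae: "AE t in lebesgue_on {a..b}. (f has_vector_derivative h t) (at t within {a..b})"
  shows "(h has_integral (f b - f a)) {a..b}"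
proof -
  obtain N where "negligible N" "\<forall>t\<in>{a..b} - N. (f has_vector_derivative h t) (at t within {a..b})"
    using ae by (subst (asm) AE_lebesgue_on_iff) auto
  then show ?thesis using fundamental_theorem_abs_cont[OF assms(1,2)] by blast
qed

lemma fundamental_theorem_LINT:
  fixes f h :: "real \<Rightarrow> 'a::euclidean_space"
  assumes "a \<le> b" "abs_cont_on_interval a b f"
    "AE t in lebesgue_on {a..b}. (f has_vector_derivative h t) (at t within {a..b})"
    "integrable (lebesgue_on {a..b}) h"
  shows "(LINT t|lebesgue_on {a..b}. h t) = f b - f a"
  using fundamental_theorem_AE[OF assms(1-3)] lebesgue_integral_eq_integral[OF assms(4)]
  by (auto dest: integral_unique)

section \<open>The matrix exponential\<close>

lemma bounded_bilinear_matrix_vector_mult: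
  "bounded_bilinear ((*v) :: real^'a^'b \<Rightarrow> real^'a \<Rightarrow> real^'b)"
proof -
  have "bilinear ((*v) :: real^'a^'b \<Rightarrow> real^'a \<Rightarrow> real^'b)"
    unfolding bilinear_def
    by (auto intro!: linearI simp: matrix_vector_right_distrib matrix_vector_mult_add_rdistrib
        scaleR_matrix_vector_assoc matrix_vector_mult_scaleR)
  then show ?thesis by (simp add: bilinear_conv_bounded_bilinear)
qed

lemma bounded_bilinear_matrix_matrix_mult:
  "bounded_bilinear ((**) :: real^'a^'b \<Rightarrow> real^'c^'a \<Rightarrow> real^'c^'b)"
proof -
  have "bilinear ((**) :: real^'a^'b \<Rightarrow> real^'c^'a \<Rightarrow> real^'c^'b)"
    unfolding bilinear_def
    by (auto intro!: linearI simp: vec_eq_iff matrix_matrix_mult_def sum.distrib sum_distrib_left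
        algebra_simps)
  then show ?thesis by (simp add: bilinear_conv_bounded_bilinear)
qed

lemma has_vector_derivative_matrixI:
  fixes f :: "real \<Rightarrow> real^'a^'b"
  assumes "\<And>i j. ((\<lambda>t. f t $ i $ j) has_vector_derivative f' $ i $ j) (at t within S)"
  shows "(f has_vector_derivative f') (at t within S)"
  unfolding has_vector_derivative_def
proof (subst has_derivative_componentwise_within, intro ballI)
  fix b :: "real^'a^'b" assume "b \<in> Basis"
  then obtain i j where b: "b = axis i (axis j 1)" by (auto simp: Basis_vec_def)
  show "((\<lambda>x. f x \<bullet> b) has_derivative (\<lambda>x. (x *\<^sub>R f') \<bullet> b)) (at t within S)"
    using assms[of i j] by (simp add: b inner_axis has_vector_derivative_def)
qed

text \<open>Powers of a square matrix.\<close>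

definition matpow :: "real^'n^'n \<Rightarrow> nat \<Rightarrow> real^'n^'n" where
  "matpow G k = (((**) G) ^^ k) (mat 1)"

text \<open>The matrix exponential \<open>exp(tG)\<close>, by the power series of its entries.\<close>

definition matrix_flow :: "real^'n^'n \<Rightarrow> real \<Rightarrow> real^'n^'n" where
  "matrix_flow G t = (\<chi> i j. \<Sum>k. (matpow G k $ i $ j / fact k) * t ^ k)"

lemma matpow_0 [simp]: "matpow G 0 = mat 1"
  and matpow_Suc [simp]: "matpow G (Suc k) = G ** matpow G k"
  by (simp_all add: matpow_def)

lemma matpow_intertwine:
  fixes M :: "real^'a^'b"
  assumes "M ** G1 = G2 ** M"
  shows "M ** matpow G1 k = matpow G2 k ** M"
proof (induction k)
  case (Suc k)
  have "M ** (G1 ** matpow G1 k) = G2 ** (M ** matpow G1 k)"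
    by (simp add: matrix_mul_assoc assms)
  then show ?case using Suc by (simp add: matrix_mul_assoc)
qed simp

lemma matpow_bound:
  fixes G :: "real^'n^'n"
  obtains B where "B \<ge> 0" "\<And>k i j. \<bar>matpow G k $ i $ j\<bar> \<le> B ^ k"
proof -
  define B where "B = (\<Sum>i\<in>UNIV. \<Sum>l\<in>UNIV. \<bar>G $ i $ l\<bar>)"
  have "B \<ge> 0" by (auto simp: B_def intro!: sum_nonneg)
  have row: "(\<Sum>l\<in>UNIV. \<bar>G $ i $ l\<bar>) \<le> B" for i
    unfolding B_def by (rule member_le_sum) (auto intro!: sum_nonneg)
  have "\<bar>matpow G k $ i $ j\<bar> \<le> B ^ k" for k i j
  proof (induction k arbitrary: i j)
    case (Suc k)
    have "\<bar>matpow G (Suc k) $ i $ j\<bar> \<le> (\<Sum>l\<in>UNIV. \<bar>G $ i $ l * matpow G k $ l $ j\<bar>)"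
      by (simp add: matrix_matrix_mult_def sum_abs)
    also have "\<dots> \<le> (\<Sum>l\<in>UNIV. \<bar>G $ i $ l\<bar> * B ^ k)"
      unfolding abs_mult by (intro sum_mono mult_left_mono Suc) auto
    also have "\<dots> = (\<Sum>l\<in>UNIV. \<bar>G $ i $ l\<bar>) * B ^ k" by (simp add: sum_distrib_right)
    also have "\<dots> \<le> B * B ^ k" using row \<open>B \<ge> 0\<close> by (intro mult_right_mono) auto
    finally show ?case by simp
  qed (simp add: mat_def)
  with \<open>B \<ge> 0\<close> show ?thesis by (rule that)
qed

lemma matrix_flow_summable:
  "summable (\<lambda>k. (matpow G k $ i $ j / fact k) * t ^ k)"
proof -
  obtain B where B: "B \<ge> 0" "\<And>k i j. \<bar>matpow G k $ i $ j\<bar> \<le> B ^ k"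
    using matpow_bound[of G] by blast
  show ?thesis
  proof (rule summable_comparison_test')
    show "summable (\<lambda>k. inverse (fact k) * (B * \<bar>t\<bar>) ^ k)" by (rule summable_exp)
    fix k :: nat assume "k \<ge> 0"
    have "\<bar>matpow G k $ i $ j\<bar> * \<bar>t\<bar> ^ k \<le> B ^ k * \<bar>t\<bar> ^ k"
      by (intro mult_right_mono B) auto
    then show "norm ((matpow G k $ i $ j / fact k) * t ^ k) \<le> inverse (fact k) * (B * \<bar>t\<bar>) ^ k"
      by (simp add: abs_mult power_abs power_mult_distrib divide_simps)
  qed
qed

lemma matrix_flow_nth: "matrix_flow G t $ i $ j = (\<Sum>k. (matpow G k $ i $ j / fact k) * t ^ k)"
  by (simp add: matrix_flow_def)

lemma matrix_flow_mult_left: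
  "(M ** matrix_flow G t) $ i $ j = (\<Sum>k. ((M ** matpow G k) $ i $ j / fact k) * t ^ k)"
proof -
  have "(M ** matrix_flow G t) $ i $ j
      = (\<Sum>l\<in>UNIV. \<Sum>k. M $ i $ l * ((matpow G k $ l $ j / fact k) * t ^ k))"
    by (simp only: matrix_matrix_mult_def vec_lambda_beta matrix_flow_nth suminf_mult[OF matrix_flow_summable])
  also have "\<dots> = (\<Sum>k. \<Sum>l\<in>UNIV. M $ i $ l * ((matpow G k $ l $ j / fact k) * t ^ k))"
    by (intro suminf_sum[symmetric] summable_mult matrix_flow_summable)
  also have "\<dots> = (\<Sum>k. ((M ** matpow G k) $ i $ j / fact k) * t ^ k)"
    unfolding matrix_matrix_mult_def vec_lambda_beta sum_divide_distrib sum_distrib_right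
    by (simp add: ac_simps)
  finally show ?thesis .
qed

lemma matrix_flow_mult_right:
  "(matrix_flow G t ** M) $ i $ j = (\<Sum>k. ((matpow G k ** M) $ i $ j / fact k) * t ^ k)"
proof -
  have "(matrix_flow G t ** M) $ i $ j
      = (\<Sum>l\<in>UNIV. \<Sum>k. ((matpow G k $ i $ l / fact k) * t ^ k) * M $ l $ j)"
    by (simp only: matrix_matrix_mult_def vec_lambda_beta matrix_flow_nth suminf_mult2[OF matrix_flow_summable])
  also have "\<dots> = (\<Sum>k. \<Sum>l\<in>UNIV. ((matpow G k $ i $ l / fact k) * t ^ k) * M $ l $ j)"
    by (intro suminf_sum[symmetric] summable_mult2 matrix_flow_summable)
  also have "\<dots> = (\<Sum>k. ((matpow G k ** M) $ i $ j / fact k) * t ^ k)"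
    unfolding matrix_matrix_mult_def vec_lambda_beta sum_divide_distrib sum_distrib_right
    by (simp add: ac_simps)
  finally show ?thesis .
qed

lemma matrix_flow_intertwine:
  fixes M :: "real^'a^'b"
  assumes "M ** G1 = G2 ** M"
  shows "M ** matrix_flow G1 t = matrix_flow G2 t ** M"
  by (simp add: vec_eq_iff matrix_flow_mult_left matrix_flow_mult_right matpow_intertwine[OF assms])

lemma matrix_flow_0 [simp]: "matrix_flow G 0 = mat 1"
proof -
  have "(\<Sum>k. (matpow G k $ i $ j / fact k) * 0 ^ k) = (mat 1 :: real^'a^'a) $ i $ j" for i j
    using powser_zero[of "\<lambda>k. matpow G k $ i $ j / fact k"] by simp
  then show ?thesis by (simp add: vec_eq_iff matrix_flow_nth)
qed

lemma matpow_transpose: "matpow (transpose G) k = transpose (matpow G k)"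
proof (induction k)
  case (Suc k)
  have "matpow G k ** G = G ** matpow G k" using matpow_intertwine[of G G G k] by simp
  then show ?case using Suc by (simp flip: matrix_transpose_mul)
qed (simp add: transpose_mat)

lemma matrix_flow_transpose: "matrix_flow (transpose G) t = transpose (matrix_flow G t)"
  unfolding vec_eq_iff matrix_flow_nth matpow_transpose
  by (simp add: transpose_def matrix_flow_nth)

lemma matrix_flow_has_vector_derivative:
  "(matrix_flow G has_vector_derivative (G ** matrix_flow G t)) (at t within S)"
proof (rule has_vector_derivative_matrixI)
  fix i j
  let ?c = "\<lambda>k. matpow G k $ i $ j / fact k"
  have "((\<lambda>x. \<Sum>k. ?c k * x ^ k) has_field_derivative (\<Sum>k. diffs ?c k * t ^ k)) (at t)"
    by (rule termdiffs_strong_converges_everywhere) (rule matrix_flow_summable)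
  moreover have "diffs ?c k = (G ** matpow G k) $ i $ j / fact k" for k
  proof -
    have "real (Suc k) * (x / fact (Suc k)) = x / fact k" for x :: real
      by (simp add: fact_Suc del: of_nat_Suc)
    then show ?thesis by (simp only: diffs_def matpow_Suc)
  qed
  ultimately have "((\<lambda>x. \<Sum>k. ?c k * x ^ k) has_field_derivative (G ** matrix_flow G t) $ i $ j) (at t)"
    by (simp add: matrix_flow_mult_left)
  then show "((\<lambda>x. matrix_flow G x $ i $ j) has_vector_derivative (G ** matrix_flow G t) $ i $ j) (at t within S)"
    by (auto simp: matrix_flow_nth has_real_derivative_iff_has_vector_derivative
        intro: has_vector_derivative_at_within)
qed

lemma matrix_flow_commute: "G ** matrix_flow G t = matrix_flow G t ** G"
  by (rule matrix_flow_intertwine) simp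

lemma continuous_on_matrix_flow: "continuous_on S (matrix_flow G)"
  by (rule continuous_on_vector_derivative) (rule matrix_flow_has_vector_derivative)

lemma continuous_on_matrix_flow' [continuous_intros]:
  "continuous_on S f \<Longrightarrow> continuous_on S (\<lambda>t. matrix_flow G (f t))"
  by (rule continuous_on_compose2[OF continuous_on_matrix_flow]) auto

lemma matrix_flow_vector_derivative:
  "((\<lambda>t. matrix_flow G t *v x) has_vector_derivative (G *v (matrix_flow G t *v x))) (at t within S)"
  using bounded_linear.has_vector_derivative[OF
      bounded_bilinear.bounded_linear_left[OF bounded_bilinear_matrix_vector_mult]
      matrix_flow_has_vector_derivative[of G t S], of x]
  by (simp add: matrix_vector_mul_assoc)

lemma matrix_flow_reverse_derivative:
  "((\<lambda>s. matrix_flow G (t - s)) has_vector_derivative (- (G ** matrix_flow G (t - s)))) (at s within S)"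
proof -
  have "((\<lambda>s. t - s) has_vector_derivative -1) (at s within S)"
    by (auto intro!: derivative_eq_intros)
  from vector_diff_chain_within[OF this matrix_flow_has_vector_derivative]
  show ?thesis by (simp add: o_def)
qed

text \<open>Uniqueness, in the class of absolutely continuous functions: \<open>exp((t - s)G) w(s)\<close> has
  derivative zero almost everywhere.\<close>

lemma matrix_flow_unique_AE:
  fixes w :: "real \<Rightarrow> real^'n"
  assumes ac: "abs_cont_on_interval 0 \<tau> w"
    and ae: "AE t in lebesgue_on {0..\<tau>}. (w has_vector_derivative (G *v w t)) (at t within {0..\<tau>})"
    and t: "t \<in> {0..\<tau>}"
  shows "w t = matrix_flow G t *v w 0"
proof -
  have sub: "{0..t} \<subseteq> {0..\<tau>}" using t by auto
  let ?u = "\<lambda>s. matrix_flow G (t - s) *v w s"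
  have "abs_cont_on_interval 0 t (\<lambda>s. matrix_flow G (t - s))"
    by (rule abs_cont_C1[OF matrix_flow_reverse_derivative])
      (intro continuous_intros bounded_bilinear.continuous_on[OF bounded_bilinear_matrix_matrix_mult])
  moreover have "abs_cont_on_interval 0 t w" using abs_cont_subinterval[OF ac] t by auto
  ultimately have acu: "abs_cont_on_interval 0 t ?u"
    by (rule abs_cont_bilinear[OF bounded_bilinear_matrix_vector_mult])
  have "AE s in lebesgue_on {0..t}. (w has_vector_derivative (G *v w s)) (at s within {0..\<tau>})"
    by (rule AE_lebesgue_on_subset[OF ae sub]) auto
  then have "AE s in lebesgue_on {0..t}. (?u has_vector_derivative 0) (at s within {0..t})"
  proof eventually_elim
    case (elim s)
    have "(w has_vector_derivative (G *v w s)) (at s within {0..t})"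
      by (rule has_vector_derivative_within_subset[OF elim sub])
    from bounded_bilinear.has_vector_derivative[OF bounded_bilinear_matrix_vector_mult
        matrix_flow_reverse_derivative[of G t s "{0..t}"] this]
    show ?case
      by (simp add: matrix_vector_mul_assoc matrix_flow_commute
          bounded_bilinear.minus_left[OF bounded_bilinear_matrix_vector_mult])
  qed
  from fundamental_theorem_AE[OF _ acu this] have "((\<lambda>_. 0::real^'n) has_integral (?u t - ?u 0)) {0..t}"
    using t by auto
  moreover have "((\<lambda>_. 0::real^'n) has_integral 0) {0..t}" by (rule has_integral_0)
  ultimately have "?u t - ?u 0 = 0" by (rule has_integral_unique)
  then show ?thesis by simp
qed

lemma matrix_flow_unique:
  fixes w :: "real \<Rightarrow> real^'n"
  assumes "\<And>t. t \<in> {0..\<tau>} \<Longrightarrow> (w has_vector_derivative (G *v w t)) (at t within {0..\<tau>})"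
    and "t \<in> {0..\<tau>}"
  shows "w t = matrix_flow G t *v w 0"
proof (rule matrix_flow_unique_AE[OF _ _ assms(2)])
  have "continuous_on {0..\<tau>} w"
    by (rule continuous_on_vector_derivative[OF assms(1)])
  then show "abs_cont_on_interval 0 \<tau> w"
    by (intro abs_cont_C1[OF assms(1)] linear_continuous_on_compose[OF _ matrix_vector_mul_linear])
  show "AE t in lebesgue_on {0..\<tau>}. (w has_vector_derivative (G *v w t)) (at t within {0..\<tau>})"
    by (rule AE_I2) (use assms(1) in simp)
qed

lemma matrix_flow_add: "matrix_flow G (s + t) = matrix_flow G s ** matrix_flow G t"
proof -
  let ?f = "\<lambda>r. matrix_flow G (s + t - r) ** matrix_flow G r"
  have "(?f has_vector_derivative 0) (at r within UNIV)" for r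
    using bounded_bilinear.has_vector_derivative[OF bounded_bilinear_matrix_matrix_mult
        matrix_flow_reverse_derivative[of G "s + t" r UNIV] matrix_flow_has_vector_derivative[of G r UNIV]]
    by (simp add: matrix_mul_assoc matrix_flow_commute[of G "s + t - r"]
        bounded_bilinear.minus_left[OF bounded_bilinear_matrix_matrix_mult])
  then obtain c where "\<And>r. ?f r = c"
    using has_vector_derivative_zero_constant[of UNIV ?f] by auto
  then have "?f 0 = c" "?f t = c" by blast+
  then show ?thesis by simp
qed

lemma linear_ivp_eq_flow:
  assumes "t \<ge> 0"
  shows "linear_ivp M v0 t = matrix_flow M t *v v0"
proof -
  let ?P = "\<lambda>v. v 0 = v0 \<and> (\<forall>t\<ge>0. (v has_vector_derivative (M *v v t)) (at t within {0..}))"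
  have "?P (\<lambda>t. matrix_flow M t *v v0)" by (simp add: matrix_flow_vector_derivative)
  from someI[of ?P, OF this] have P: "?P (linear_ivp M v0)" unfolding linear_ivp_def .
  have "linear_ivp M v0 t = matrix_flow M t *v linear_ivp M v0 0"
  proof (rule matrix_flow_unique[of t])
    fix s assume "s \<in> {0..t}"
    then have "(linear_ivp M v0 has_vector_derivative M *v linear_ivp M v0 s) (at s within {0..})"
      using P by auto
    then show "(linear_ivp M v0 has_vector_derivative M *v linear_ivp M v0 s) (at s within {0..t})"
      by (rule has_vector_derivative_within_subset) auto
  qed (use assms in auto)
  then show ?thesis using P by simp
qed

section \<open>Stability and the Lyapunov equation\<close>

lemma inner_matrix_vector_transpose:
  fixes M :: "real^'a^'b"
  shows "x \<bullet> (M *v y) = (transpose M *v x) \<bullet> y"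
  by (metis dot_lmul_matrix transpose_matrix_vector)

lemma matrix_vector_mult_minus_right: "M *v (- x) = - (M *v (x :: real^'a))"
  by (rule bounded_bilinear.minus_right[OF bounded_bilinear_matrix_vector_mult])

lemma matrix_vector_mult_minus_left: "(- M) *v x = - (M *v (x :: real^'a))"
  by (rule bounded_bilinear.minus_left[OF bounded_bilinear_matrix_vector_mult])

lemmas mv_simps = matrix_vector_right_distrib matrix_vector_mult_diff_distrib
  matrix_vector_mult_add_rdistrib matrix_vector_mult_diff_rdistrib
  matrix_vector_mult_minus_left matrix_vector_mult_minus_right

lemma transpose_add: "transpose (X + Y) = transpose X + transpose (Y :: real^'a^'b)"
  and transpose_diff: "transpose (X - Y) = transpose X - transpose (Y :: real^'a^'b)"
  and transpose_minus: "transpose (- X) = - transpose (X :: real^'a^'b)"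
  by (simp_all add: transpose_def vec_eq_iff)

lemma matrix_vector_scaleR_left: "(c *\<^sub>R M) *v x = c *\<^sub>R (M *v (x :: real^'a))"
  by (simp add: scaleR_matrix_vector_assoc)

lemma symmetric_inner:
  fixes P :: "real^'n^'n"
  assumes "transpose P = P"
  shows "(P *v x) \<bullet> y = x \<bullet> (P *v y)" "x \<bullet> (P *v y) = y \<bullet> (P *v x)"
  using inner_matrix_vector_transpose[of x P y] assms by (simp_all add: inner_commute)

lemma quadratic_form_upper:
  fixes M :: "real^'n^'n"
  obtains b where "b > 0" "\<And>x. \<bar>x \<bullet> (M *v x)\<bar> \<le> b * (x \<bullet> x)"
proof -
  obtain K where K: "K > 0" "\<And>x y. norm (x *v y) \<le> norm (x :: real^'n^'n) * norm (y :: real^'n) * K"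
    using bounded_bilinear.pos_bounded[OF bounded_bilinear_matrix_vector_mult[where 'a='n and 'b='n]] by blast
  show ?thesis
  proof (rule that[of "norm M * K + 1"])
    show "norm M * K + 1 > 0" using K(1) by (simp add: add_nonneg_pos)
    fix x :: "real^'n"
    have "\<bar>x \<bullet> (M *v x)\<bar> \<le> norm x * norm (M *v x)" by (rule Cauchy_Schwarz_ineq2)
    also have "\<dots> \<le> norm x * (norm M * norm x * K)" by (intro mult_left_mono K) auto
    also have "\<dots> = norm M * K * (x \<bullet> x)" by (simp add: dot_square_norm power2_eq_square)
    also have "\<dots> \<le> (norm M * K + 1) * (x \<bullet> x)" by (intro mult_right_mono) auto
    finally show "\<bar>x \<bullet> (M *v x)\<bar> \<le> (norm M * K + 1) * (x \<bullet> x)" .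
  qed
qed

lemma quadratic_form_lower:
  fixes M :: "real^'n^'n"
  assumes "\<And>x. x \<noteq> 0 \<Longrightarrow> x \<bullet> (M *v x) > 0"
  obtains m where "m > 0" "\<And>x. m * (x \<bullet> x) \<le> x \<bullet> (M *v x)"
proof -
  have "sphere 0 1 \<noteq> ({} :: (real^'n) set)" by simp
  moreover have "continuous_on (sphere 0 1) (\<lambda>x::real^'n. x \<bullet> (M *v x))"
    by (intro continuous_intros linear_continuous_on matrix_vector_mul_bounded_linear)
  ultimately obtain u :: "real^'n" where u: "u \<in> sphere 0 1" "\<forall>y\<in>sphere 0 1. u \<bullet> (M *v u) \<le> y \<bullet> (M *v y)"
    using continuous_attains_inf[OF compact_sphere] by blast
  then have "u \<noteq> 0" by auto
  show ?thesis
  proof (rule that)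
    show "u \<bullet> (M *v u) > 0" by (rule assms[OF \<open>u \<noteq> 0\<close>])
    fix x :: "real^'n"
    show "u \<bullet> (M *v u) * (x \<bullet> x) \<le> x \<bullet> (M *v x)"
    proof (cases "x = 0")
      case False
      let ?y = "(1 / norm x) *\<^sub>R x"
      have "?y \<in> sphere 0 1" using False by simp
      then have "u \<bullet> (M *v u) \<le> ?y \<bullet> (M *v ?y)" using u(2) by blast
      also have "\<dots> = (x \<bullet> (M *v x)) / (x \<bullet> x)"
        by (simp add: matrix_vector_mult_scaleR dot_square_norm power2_eq_square)
      finally show ?thesis using False by (simp add: pos_le_divide_eq)
    qed simp
  qed
qed

text \<open>Every solution of \<open>x' = Gx\<close> tends to 0.\<close>

definition stable_matrix :: "real^'n^'n \<Rightarrow> bool" where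
  "stable_matrix G \<longleftrightarrow> (\<forall>x. ((\<lambda>t. matrix_flow G t *v x) \<longlongrightarrow> 0) at_top)"

lemma quadratic_form_along_flow:
  fixes P G :: "real^'n^'n"
  assumes "transpose P = P"
  defines "v \<equiv> \<lambda>x t. matrix_flow G t *v x"
  shows "((\<lambda>t. v x t \<bullet> (P *v v x t)) has_real_derivative 2 * (v x t \<bullet> (P *v (G *v v x t)))) (at t within S)"
proof -
  have d: "(v x has_vector_derivative G *v v x t) (at t within S)"
    unfolding v_def by (rule matrix_flow_vector_derivative)
  have "((\<lambda>t. P *v v x t) has_vector_derivative P *v (G *v v x t)) (at t within S)"
    by (rule bounded_linear.has_vector_derivative[OF matrix_vector_mul_bounded_linear d])
  from bounded_bilinear.has_vector_derivative[OF bounded_bilinear_inner d this]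
  show ?thesis
    unfolding has_real_derivative_iff_has_vector_derivative
    by (simp add: symmetric_inner(2)[OF assms(1), of "G *v v x t"] inner_commute)
qed

lemma lyapunov_stable:
  fixes P G :: "real^'n^'n"
  assumes P: "sym_pos_def P" and dec: "\<And>x. x \<noteq> 0 \<Longrightarrow> x \<bullet> (P *v (G *v x)) < 0"
  shows "stable_matrix G"
  unfolding stable_matrix_def
proof
  fix x0
  have sym: "transpose P = P" and pos: "\<And>x. x \<noteq> 0 \<Longrightarrow> x \<bullet> (P *v x) > 0"
    using P by (auto simp: sym_pos_def_def)
  obtain p where p: "p > 0" "\<And>x. p * (x \<bullet> x) \<le> x \<bullet> (P *v x)" using quadratic_form_lower[OF pos] by blast
  obtain b where b: "b > 0" "\<And>x. \<bar>x \<bullet> (P *v x)\<bar> \<le> b * (x \<bullet> x)" using quadratic_form_upper[of P] by blast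
  have "x \<bullet> ((- (P ** G)) *v x) > 0" if "x \<noteq> 0" for x
    using dec[OF that] by (simp add: mv_simps matrix_vector_mul_assoc)
  then obtain m where m: "m > 0" "\<And>x. m * (x \<bullet> x) \<le> x \<bullet> ((- (P ** G)) *v x)"
    using quadratic_form_lower[of "- (P ** G)"] by blast
  define c where "c = 2 * m / b"
  have "c > 0" using m b by (simp add: c_def)
  define v where "v = (\<lambda>t. matrix_flow G t *v x0)"
  define V where "V = (\<lambda>t. v t \<bullet> (P *v v t))"
  define V' where "V' = (\<lambda>t. 2 * (v t \<bullet> (P *v (G *v v t))))"
  have V': "(V has_real_derivative V' t) (at t)" for t
    unfolding V_def V'_def v_def by (rule quadratic_form_along_flow[OF sym])
  have V'_le: "V' t \<le> - c * V t" for t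
  proof -
    have "V t \<le> b * (v t \<bullet> v t)" using b(2)[of "v t"] by (simp add: V_def)
    then have "c * V t \<le> c * (b * (v t \<bullet> v t))" using \<open>c > 0\<close> by (intro mult_left_mono) auto
    also have "\<dots> = 2 * (m * (v t \<bullet> v t))" using b(1) by (simp add: c_def)
    also have "\<dots> \<le> - V' t" using m(2)[of "v t"] by (simp add: V'_def mv_simps matrix_vector_mul_assoc)
    finally show ?thesis by simp
  qed
  have decay: "V t * exp (c * t) \<le> V 0" if "t \<ge> 0" for t
  proof -
    have "V t * exp (c * t) \<le> V 0 * exp (c * 0)"
    proof (rule DERIV_nonpos_imp_nonincreasing[OF that])
      fix s assume "0 \<le> s" "s \<le> t"
      have "((\<lambda>t. V t * exp (c * t)) has_real_derivative (V' s * exp (c * s) + c * exp (c * s) * V s)) (at s)"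
        by (auto intro!: derivative_eq_intros V')
      moreover have "V' s * exp (c * s) + c * exp (c * s) * V s = (V' s + c * V s) * exp (c * s)"
        by (simp add: algebra_simps)
      moreover have "\<dots> \<le> 0" using V'_le[of s] by (intro mult_nonpos_nonneg) auto
      ultimately show "\<exists>y. ((\<lambda>t. V t * exp (c * t)) has_real_derivative y) (at s) \<and> y \<le> 0" by auto
    qed
    then show ?thesis by simp
  qed
  have "((\<lambda>t. V 0 / p * exp (- c * t)) \<longlongrightarrow> V 0 / p * 0) at_top"
    using \<open>c > 0\<close> by (intro tendsto_intros filterlim_compose[OF exp_at_bot]) real_asymp
  then have lim: "((\<lambda>t. V 0 / p * exp (- c * t)) \<longlongrightarrow> 0) at_top" by simp
  have "((\<lambda>t. (norm (v t))\<^sup>2) \<longlongrightarrow> 0) at_top"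
  proof (rule tendsto_sandwich[OF _ _ tendsto_const lim])
    show "\<forall>\<^sub>F t in at_top. (norm (v t))\<^sup>2 \<le> V 0 / p * exp (- c * t)"
      using eventually_ge_at_top[of 0]
    proof eventually_elim
      case (elim t)
      have "p * (norm (v t))\<^sup>2 \<le> V t" using p(2)[of "v t"] by (simp add: V_def dot_square_norm)
      also have "V t \<le> V 0 * exp (- c * t)"
        using decay[OF elim] by (simp add: exp_minus field_simps)
      finally show ?case using p(1) by (simp add: field_simps)
    qed
  qed auto
  then have "((\<lambda>t. sqrt ((norm (v t))\<^sup>2)) \<longlongrightarrow> sqrt 0) at_top" by (rule tendsto_real_sqrt)
  then show "((\<lambda>t. matrix_flow G t *v x0) \<longlongrightarrow> 0) at_top"
    by (simp add: v_def tendsto_norm_zero_iff)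
qed

text \<open>If \<open>w\<close> is an eigenvector of \<open>G\<^sup>T\<close> for \<open>z\<close>, then \<open>w\<^sup>T exp(tG) x = exp(zt) w\<^sup>T x\<close>.\<close>

lemma stable_imp_hurwitz_transpose:
  fixes G :: "real^'n^'n"
  assumes "stable_matrix G"
  shows "hurwitz (transpose G)"
  unfolding hurwitz_def
proof (intro allI impI)
  fix z assume "complex_eigenvalue (transpose G) z"
  then obtain w :: "complex^'n" where "w \<noteq> 0"
    and ev: "(\<chi> i j. complex_of_real (transpose G $ i $ j)) *v w = z *s w"
    unfolding complex_eigenvalue_def by blast
  then obtain k where k: "w $ k \<noteq> 0" by (auto simp: vec_eq_iff)
  have ev': "(\<Sum>i\<in>UNIV. complex_of_real (G $ i $ j) * w $ i) = z * w $ j" for j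
    using arg_cong[OF ev, of "\<lambda>x. x $ j"]
    by (simp add: matrix_vector_mult_def transpose_def)
  define v where "v = (\<lambda>t. matrix_flow G t *v axis k 1)"
  define h where "h = (\<lambda>t. \<Sum>i\<in>UNIV. w $ i * complex_of_real (v t $ i))"
  have "(h has_vector_derivative z * h t) (at t)" for t
  proof -
    have "((\<lambda>t. v t $ i) has_vector_derivative (G *v v t) $ i) (at t)" for i
      unfolding v_def
      by (rule bounded_linear.has_vector_derivative[OF bounded_linear_vec_nth matrix_flow_vector_derivative])
    then have "(h has_vector_derivative (\<Sum>i\<in>UNIV. w $ i * complex_of_real ((G *v v t) $ i))) (at t)"
      unfolding h_def
      by (intro has_vector_derivative_sum has_vector_derivative_mult_right)
         (rule bounded_linear.has_vector_derivative[OF bounded_linear_of_real])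
    also have "(\<Sum>i\<in>UNIV. w $ i * complex_of_real ((G *v v t) $ i))
        = (\<Sum>i\<in>UNIV. \<Sum>j\<in>UNIV. complex_of_real (G $ i $ j) * w $ i * complex_of_real (v t $ j))"
      by (simp add: matrix_vector_mult_def sum_distrib_left ac_simps)
    also have "\<dots> = (\<Sum>j\<in>UNIV. (\<Sum>i\<in>UNIV. complex_of_real (G $ i $ j) * w $ i) * complex_of_real (v t $ j))"
      by (subst sum.swap) (simp add: sum_distrib_right)
    also have "\<dots> = z * h t" by (simp only: ev' h_def sum_distrib_left mult.assoc)
    finally show ?thesis .
  qed
  note dh = this
  have "((\<lambda>t. exp (- (z * complex_of_real t)) * h t) has_vector_derivative 0) (at t within UNIV)" for t
  proof -
    have "((\<lambda>x. exp (- (z * x))) has_field_derivative (exp (- (z * complex_of_real t)) * (- z))) (at (complex_of_real t))"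
      by (auto intro!: derivative_eq_intros)
    then have "((\<lambda>t. exp (- (z * complex_of_real t))) has_vector_derivative (exp (- (z * complex_of_real t)) * (- z))) (at t)"
      by (rule has_vector_derivative_real_field)
    from has_vector_derivative_mult[OF this dh] show ?thesis by (simp add: algebra_simps)
  qed
  then obtain c where c: "\<And>t. exp (- (z * complex_of_real t)) * h t = c"
    using has_vector_derivative_zero_constant[of UNIV "\<lambda>t. exp (- (z * complex_of_real t)) * h t"] by auto
  have "c = h 0" using c[of 0] by simp
  have h0: "h 0 = w $ k" by (simp add: h_def v_def axis_def if_distrib cong: if_cong)
  have "norm (h t) = exp (Re z * t) * norm (w $ k)" for t
  proof -
    have "h t = exp (z * complex_of_real t) * h 0"
      using c[of t] \<open>c = h 0\<close> by (simp add: exp_minus field_simps)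
    then show ?thesis by (simp add: h0 norm_mult)
  qed
  moreover have "((\<lambda>t. norm (h t)) \<longlongrightarrow> 0) at_top"
  proof -
    have "(v \<longlongrightarrow> 0) at_top" using assms unfolding stable_matrix_def v_def by blast
    then have "((\<lambda>t. v t $ i) \<longlongrightarrow> 0) at_top" for i using tendsto_vec_nth by fastforce
    then have "(h \<longlongrightarrow> (\<Sum>i\<in>UNIV. w $ i * complex_of_real 0)) at_top"
      unfolding h_def by (intro tendsto_sum tendsto_mult tendsto_const tendsto_of_real)
    then show ?thesis by (simp add: tendsto_norm_zero_iff)
  qed
  ultimately have lim: "((\<lambda>t. exp (Re z * t) * norm (w $ k)) \<longlongrightarrow> 0) at_top" by simp
  show "Re z < 0"
  proof (rule ccontr)
    assume "\<not> Re z < 0"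
    then have rz: "1 \<le> exp (Re z * t)" if "0 \<le> t" for t using that by simp
    have "\<forall>\<^sub>F t in at_top. norm (w $ k) \<le> exp (Re z * t) * norm (w $ k)"
      using eventually_ge_at_top[of "0::real"]
      by eventually_elim (use rz mult_right_mono[of 1 _ "norm (w $ k)"] in force)
    then have "norm (w $ k) \<le> 0" by (rule tendsto_lowerbound[OF lim]) simp
    then show False using k by simp
  qed
qed

lemma matrix_eqI_inner:
  fixes M N :: "real^'a^'b"
  assumes "\<And>x y. x \<bullet> (M *v y) = x \<bullet> (N *v y)"
  shows "M = N"
  by (metis assms matrix_eq vector_eq_ldot)

lemma stable_sylvester_zero:
  fixes G1 :: "real^'a^'a" and G2 :: "real^'b^'b" and X :: "real^'b^'a"
  assumes "stable_matrix G1" "stable_matrix G2" "transpose G1 ** X + X ** G2 = 0"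
  shows "X = 0"
proof (rule matrix_eqI_inner)
  fix x :: "real^'a" and y :: "real^'b"
  define v where "v = (\<lambda>t. matrix_flow G1 t *v x)"
  define w where "w = (\<lambda>t. matrix_flow G2 t *v y)"
  have "((\<lambda>t. v t \<bullet> (X *v w t)) has_vector_derivative 0) (at t within UNIV)" for t
  proof -
    have dv: "(v has_vector_derivative G1 *v v t) (at t)" and dw: "(w has_vector_derivative G2 *v w t) (at t)"
      unfolding v_def w_def by (rule matrix_flow_vector_derivative)+
    have "((\<lambda>t. X *v w t) has_vector_derivative X *v (G2 *v w t)) (at t)"
      by (rule bounded_linear.has_vector_derivative[OF matrix_vector_mul_bounded_linear dw])
    from bounded_bilinear.has_vector_derivative[OF bounded_bilinear_inner dv this]
    have "((\<lambda>t. v t \<bullet> (X *v w t)) has_vector_derivative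
        (v t \<bullet> (X *v (G2 *v w t)) + (G1 *v v t) \<bullet> (X *v w t))) (at t)" .
    moreover have "v t \<bullet> (X *v (G2 *v w t)) + (G1 *v v t) \<bullet> (X *v w t)
        = v t \<bullet> ((transpose G1 ** X + X ** G2) *v w t)"
      using inner_matrix_vector_transpose[of "v t" "transpose G1" "X *v w t"]
      by (simp add: mv_simps inner_add_right flip: matrix_vector_mul_assoc)
    ultimately show ?thesis by (simp add: assms(3))
  qed
  then obtain c where c: "\<And>t. v t \<bullet> (X *v w t) = c"
    using has_vector_derivative_zero_constant[of UNIV "\<lambda>t. v t \<bullet> (X *v w t)"] by auto
  have "(v \<longlongrightarrow> 0) at_top" "(w \<longlongrightarrow> 0) at_top"
    using assms(1,2) unfolding stable_matrix_def v_def w_def by blast+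
  then have "((\<lambda>t. v t \<bullet> (X *v w t)) \<longlongrightarrow> 0 \<bullet> (X *v 0)) at_top"
    by (intro tendsto_inner bounded_linear.tendsto[OF matrix_vector_mul_bounded_linear])
  then have "c = 0" by (simp add: c tendsto_const_iff)
  then show "x \<bullet> (X *v y) = x \<bullet> (0 *v y)" using c[of 0] by (simp add: v_def w_def)
qed

text \<open>The Lyapunov operator of a stable matrix is injective, hence surjective.\<close>

lemma lyapunov_equation_solvable:
  fixes G M :: "real^'n^'n"
  assumes "stable_matrix G" and "transpose M = M"
  obtains P where "transpose P = P" "transpose G ** P + P ** G = M"
proof -
  let ?L = "\<lambda>P. transpose G ** P + P ** G"
  have lin: "linear ?L"
    by (intro linear_compose_add bounded_linear.linear
        bounded_bilinear.bounded_linear_right[OF bounded_bilinear_matrix_matrix_mult]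
        bounded_bilinear.bounded_linear_left[OF bounded_bilinear_matrix_matrix_mult])
  have inj: "inj ?L"
    unfolding linear_injective_0[OF lin] using stable_sylvester_zero[OF assms(1) assms(1)] by blast
  have "surj ?L" using linear_inj_imp_surj[OF lin inj] .
  then have "M \<in> range ?L" by (simp only: UNIV_I)
  then obtain P where P: "?L P = M" by (elim rangeE) (erule that[OF sym])
  have "?L (transpose P) = transpose (?L P)" by (simp add: transpose_add matrix_transpose_mul)
  then have "?L (transpose P) = M" by (simp add: P assms(2))
  then have "?L (transpose P) = ?L P" by (rule trans[OF _ P[symmetric]])
  then have "transpose P = P" by (rule injD[OF inj])
  then show ?thesis using P by (rule that)
qed

lemma lyapunov_psd:
  fixes P G :: "real^'n^'n"
  assumes "stable_matrix G" and sym: "transpose P = P" and dec: "\<And>x. x \<bullet> (P *v (G *v x)) \<le> 0"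
  shows "0 \<le> x \<bullet> (P *v x)"
proof -
  define v where "v = (\<lambda>t. matrix_flow G t *v x)"
  define V where "V = (\<lambda>t. v t \<bullet> (P *v v t))"
  have "V t \<le> V 0" if "t \<ge> 0" for t
  proof (rule DERIV_nonpos_imp_nonincreasing[OF that])
    fix s assume "0 \<le> s" "s \<le> t"
    have "(V has_real_derivative 2 * (v s \<bullet> (P *v (G *v v s)))) (at s)"
      unfolding V_def v_def by (rule quadratic_form_along_flow[OF sym])
    then show "\<exists>y. (V has_real_derivative y) (at s) \<and> y \<le> 0" using dec[of "v s"] by auto
  qed
  then have ev: "\<forall>\<^sub>F t in at_top. V t \<le> V 0" by (intro eventually_mono[OF eventually_ge_at_top[of 0]])
  have "(v \<longlongrightarrow> 0) at_top" using assms(1) unfolding stable_matrix_def v_def by blast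
  then have "(V \<longlongrightarrow> 0 \<bullet> (P *v 0)) at_top"
    unfolding V_def by (intro tendsto_inner bounded_linear.tendsto[OF matrix_vector_mul_bounded_linear])
  then have "0 \<bullet> (P *v 0) \<le> V 0" by (rule tendsto_upperbound[OF _ ev]) simp
  then show ?thesis by (simp add: V_def v_def)
qed

lemma psd_inner_zero:
  fixes P :: "real^'n^'n"
  assumes sym: "transpose P = P" and psd: "\<And>x. 0 \<le> x \<bullet> (P *v x)" and "x \<bullet> (P *v x) = 0"
  shows "P *v x = 0"
proof (rule ccontr)
  assume "P *v x \<noteq> 0"
  define y where "y = P *v x"
  define a where "a = y \<bullet> y"
  define b where "b = y \<bullet> (P *v y)"
  have "a > 0" using \<open>P *v x \<noteq> 0\<close> by (simp add: a_def y_def)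
  have "b \<ge> 0" using psd by (simp add: b_def)
  \<comment> \<open>the form at \<open>x - s y\<close> is \<open>s (s b - 2 a)\<close>, which is negative for small \<open>s\<close>\<close>
  define s where "s = a / (b + 1)"
  have "s > 0" using \<open>a > 0\<close> \<open>b \<ge> 0\<close> by (simp add: s_def)
  have "0 \<le> (x - s *\<^sub>R y) \<bullet> (P *v (x - s *\<^sub>R y))" by (rule psd)
  also have "\<dots> = s * (s * b - 2 * a)"
    using assms(3) symmetric_inner(2)[OF sym, of x y]
    by (simp add: mv_simps matrix_vector_mult_scaleR inner_diff_left inner_diff_right
        a_def b_def flip: y_def) (simp add: algebra_simps)
  finally have "0 \<le> s * b - 2 * a" using \<open>s > 0\<close> by (simp add: zero_le_mult_iff)
  moreover have "s * b \<le> a" using \<open>a > 0\<close> \<open>b \<ge> 0\<close> by (simp add: s_def field_simps)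
  ultimately show False using \<open>a > 0\<close> by simp
qed

section \<open>The algebraic Riccati equation\<close>

lemma tendsto_matrix_vector_left:
  fixes M :: "'c \<Rightarrow> real^'a^'b"
  shows "(M \<longlongrightarrow> M') F \<Longrightarrow> ((\<lambda>n. M n *v x) \<longlongrightarrow> M' *v x) F"
  by (rule bounded_linear.tendsto[OF bounded_bilinear.bounded_linear_left[OF bounded_bilinear_matrix_vector_mult]])

lemma tendsto_matrix_vector_right:
  fixes X :: "real^'a^'b"
  shows "(w \<longlongrightarrow> w') F \<Longrightarrow> ((\<lambda>n. X *v w n) \<longlongrightarrow> X *v w') F"
  by (rule bounded_linear.tendsto[OF matrix_vector_mul_bounded_linear])

lemma tendsto_matrix_mult_right:
  fixes X :: "real^'b^'c" and M :: "'d \<Rightarrow> real^'a^'b"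
  shows "(M \<longlongrightarrow> M') F \<Longrightarrow> ((\<lambda>n. X ** M n) \<longlongrightarrow> X ** M') F"
  by (rule bounded_linear.tendsto[OF bounded_bilinear.bounded_linear_right[OF bounded_bilinear_matrix_matrix_mult]])

text \<open>The data of the linear quadratic problem with running cost
  \<open>(Cx + Dg)\<^sup>T S (Cx + Dg)\<close>. The matrix \<open>Wi\<close> is an inverse of \<open>D\<^sup>T S D\<close> as far as it is used;
  this covers both invertible \<open>D\<^sup>T S D\<close> and, with \<open>Wi = 0\<close>, the case \<open>B = D = 0\<close>. The matrix \<open>N\<close> recovers the state from
  \<open>Cx + Dg\<close>, which makes the running cost coercive in the state.\<close>

locale lq_problem =
  fixes B :: "real^'k^'l" and C :: "real^'l^'r" and D :: "real^'k^'r" and S :: "real^'r^'r"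
    and Wi :: "real^'k^'k" and N :: "real^'r^'l"
  assumes S: "sym_pos_def S"
    and WiB: "transpose D ** S ** D ** Wi ** transpose B = transpose B"
    and WiD: "transpose D ** S ** D ** Wi ** transpose D = transpose D"
    and NC: "N ** C = mat 1" and ND: "N ** D = 0"
begin

text \<open>The running cost.\<close>

definition cost :: "real^'l \<Rightarrow> real^'k \<Rightarrow> real" where
  "cost x g = (C *v x + D *v g) \<bullet> (S *v (C *v x + D *v g))"

text \<open>The optimal feedback that belongs to the value matrix \<open>P\<close>; the input is \<open>g = - gain P x\<close>.\<close>

definition gain :: "real^'l^'l \<Rightarrow> real^'l^'k" where
  "gain P = Wi ** (transpose B ** P + transpose D ** S ** C)"

text \<open>The rate of change of \<open>x\<^sup>T P x + \<integral> cost\<close> along \<open>x' = Ax + Bg\<close>.\<close>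

definition dissipation :: "real^'l^'l \<Rightarrow> real^'l^'l \<Rightarrow> real^'l \<Rightarrow> real^'k \<Rightarrow> real" where
  "dissipation A P x g = 2 * (x \<bullet> (P *v (A *v x + B *v g))) + cost x g"

text \<open>The algebraic Riccati equation, as an identity of quadratic forms.\<close>

definition riccati :: "real^'l^'l \<Rightarrow> real^'l^'l \<Rightarrow> bool" where
  "riccati A P \<longleftrightarrow> (\<forall>x. dissipation A P x (- (gain P *v x)) = 0)"

abbreviation closed_loop :: "real^'l^'l \<Rightarrow> real^'l^'l \<Rightarrow> real^'l^'l" where
  "closed_loop A P \<equiv> A - B ** gain P"

lemma S_nonneg: "0 \<le> z \<bullet> (S *v z)"
  using S by (cases "z = 0") (auto simp: sym_pos_def_def intro: less_imp_le)

lemma S_sym: "transpose S = S"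
  using S by (simp add: sym_pos_def_def)

lemma cost_nonneg: "0 \<le> cost x g"
  by (simp add: cost_def S_nonneg)

lemma cost_lower:
  obtains c where "c > 0" "\<And>x g. c * (x \<bullet> x) \<le> cost x g"
proof -
  obtain m where m: "m > 0" "\<And>x. m * (x \<bullet> x) \<le> x \<bullet> (S *v x)"
    using quadratic_form_lower[of S] S unfolding sym_pos_def_def by blast
  obtain b where b: "b > 0" "\<And>x. \<bar>x \<bullet> ((transpose N ** N) *v x)\<bar> \<le> b * (x \<bullet> x)"
    using quadratic_form_upper[of "transpose N ** N"] by blast
  show ?thesis
  proof (rule that)
    show "m / b > 0" using m b by simp
    fix x g
    let ?z = "C *v x + D *v g"
    have Nz: "N *v ?z = x" by (simp add: mv_simps matrix_vector_mul_assoc NC ND)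
    have "x \<bullet> x = ?z \<bullet> ((transpose N ** N) *v ?z)"
      using inner_matrix_vector_transpose[of ?z "transpose N" "N *v ?z"]
      by (simp add: Nz flip: matrix_vector_mul_assoc)
    also have "\<dots> \<le> b * (?z \<bullet> ?z)" using b(2)[of ?z] by simp
    finally have "m / b * (x \<bullet> x) \<le> m * (?z \<bullet> ?z)"
      using m b by (simp add: field_simps)
    also have "\<dots> \<le> cost x g" unfolding cost_def by (rule m(2))
    finally show "m / b * (x \<bullet> x) \<le> cost x g" .
  qed
qed

lemma gain_eq:
  "transpose D *v (S *v (D *v (gain P *v x))) = transpose B *v (P *v x) + transpose D *v (S *v (C *v x))"
proof -
  have "transpose D ** S ** D ** gain P = transpose B ** P + transpose D ** S ** C"
    unfolding gain_def
    by (simp add: matrix_add_ldistrib matrix_mul_assoc WiB WiD)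
  from arg_cong[OF this, of "\<lambda>M. M *v x"] show ?thesis
    by (simp add: mv_simps matrix_vector_mul_assoc matrix_mul_assoc)
qed

lemma cost_add:
  "cost x (g + h) = cost x g + 2 * (h \<bullet> (transpose D *v (S *v (C *v x + D *v g)))) + (D *v h) \<bullet> (S *v (D *v h))"
proof -
  have "C *v x + D *v (g + h) = (C *v x + D *v g) + D *v h" by (simp add: mv_simps)
  moreover have "(D *v h) \<bullet> y = h \<bullet> (transpose D *v y)" for y
    using inner_matrix_vector_transpose[of h "transpose D" y] by simp
  ultimately show ?thesis
    using symmetric_inner(2)[OF S_sym, of "C *v x + D *v g" "D *v h"]
    by (simp add: cost_def mv_simps(1) inner_add_left inner_add_right)
qed

text \<open>Completion of squares: the gain minimises the dissipation over the input.\<close>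

lemma dissipation_completion:
  assumes sym: "transpose P = P"
  shows "dissipation A P x g = dissipation A P x (- (gain P *v x))
    + (D *v (g + gain P *v x)) \<bullet> (S *v (D *v (g + gain P *v x)))"
proof -
  define k where "k = gain P *v x"
  define h where "h = g + k"
  have e1: "transpose D *v (S *v (C *v x + D *v (- k))) = - (transpose B *v (P *v x))"
    using gain_eq[of P x] by (simp add: k_def mv_simps algebra_simps)
  have e2: "h \<bullet> (transpose B *v (P *v x)) = x \<bullet> (P *v (B *v h))"
    using inner_matrix_vector_transpose[of h "transpose B" "P *v x"] symmetric_inner[OF sym]
    by (simp add: inner_commute)
  have "cost x (- k + h) = cost x (- k) - 2 * (x \<bullet> (P *v (B *v h))) + (D *v h) \<bullet> (S *v (D *v h))"
    unfolding cost_add e1 inner_minus_right e2 by simp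
  moreover have "x \<bullet> (P *v (A *v x + B *v g)) = x \<bullet> (P *v (A *v x + B *v (- k))) + x \<bullet> (P *v (B *v h))"
    by (simp add: h_def mv_simps inner_add_right inner_diff_right)
  moreover have "g = - k + h" by (simp add: h_def)
  ultimately show ?thesis
    by (simp add: dissipation_def flip: k_def h_def)
qed

lemma dissipation_gain_le:
  assumes "transpose P = P"
  shows "dissipation A P x (- (gain P *v x)) \<le> dissipation A P x g"
  using dissipation_completion[OF assms, of A x g] S_nonneg by simp

lemma riccati_dissipation_nonneg:
  assumes "transpose P = P" "riccati A P"
  shows "0 \<le> dissipation A P x g"
  using dissipation_gain_le[OF assms(1), of A x g] assms(2) by (simp add: riccati_def)

lemma dissipation_feedback:
  "dissipation A P x (- (K *v x)) = 2 * (x \<bullet> (P *v ((A - B ** K) *v x))) + cost x (- (K *v x))"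
  by (simp add: dissipation_def mv_simps matrix_vector_mul_assoc)

text \<open>A feedback is stabilising as soon as the dissipation along it is nonpositive for some positive
  definite \<open>P\<close>, because the running cost is coercive.\<close>

lemma subsolution_stable:
  assumes P: "sym_pos_def P" and le: "\<And>x. dissipation A P x (- (K *v x)) \<le> 0"
  shows "stable_matrix (A - B ** K)"
proof (rule lyapunov_stable[OF P])
  fix x :: "real^'l" assume "x \<noteq> 0"
  obtain c where c: "c > 0" "\<And>x g. c * (x \<bullet> x) \<le> cost x g" using cost_lower by blast
  have "0 < c * (x \<bullet> x)" using c \<open>x \<noteq> 0\<close> by simp
  then have "0 < cost x (- (K *v x))" using c(2) by (rule less_le_trans)
  then show "x \<bullet> (P *v ((A - B ** K) *v x)) < 0"
    using le[of x] by (simp add: dissipation_feedback)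
qed

lemma riccati_stable:
  assumes "sym_pos_def P" "riccati A P"
  shows "stable_matrix (closed_loop A P)"
  using subsolution_stable[OF assms(1)] assms(2) by (simp add: riccati_def)

text \<open>Minimality: the gain of \<open>P2\<close> is an admissible competitor for \<open>P1\<close>.\<close>

lemma riccati_le:
  assumes P1: "sym_pos_def P1" "riccati A P1" and P2: "sym_pos_def P2" "riccati A P2"
  shows "x \<bullet> (P1 *v x) \<le> x \<bullet> (P2 *v x)"
proof -
  have sym: "transpose P1 = P1" "transpose P2 = P2" using P1 P2 by (auto simp: sym_pos_def_def)
  have "0 \<le> x \<bullet> ((P2 - P1) *v x)"
  proof (rule lyapunov_psd[OF riccati_stable[OF P2]])
    show "transpose (P2 - P1) = P2 - P1" using sym by (simp add: transpose_diff)
    fix x :: "real^'l"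
    have "0 \<le> dissipation A P1 x (- (gain P2 *v x))"
      by (rule riccati_dissipation_nonneg[OF sym(1) P1(2)])
    moreover have "dissipation A P2 x (- (gain P2 *v x)) = 0" using P2 by (simp add: riccati_def)
    ultimately show "x \<bullet> ((P2 - P1) *v (closed_loop A P2 *v x)) \<le> 0"
      unfolding dissipation_feedback by (simp add: matrix_vector_mult_diff_rdistrib[of P2] inner_diff_right)
  qed
  then show ?thesis by (simp add: mv_simps inner_diff_right)
qed

lemma symmetric_matrix_eqI:
  fixes P1 P2 :: "real^'n^'n"
  assumes "transpose P1 = P1" "transpose P2 = P2" "\<And>x. x \<bullet> (P1 *v x) = x \<bullet> (P2 *v x)"
  shows "P1 = P2"
proof (rule matrix_eqI_inner)
  fix x y :: "real^'n"
  have "(x + y) \<bullet> (P *v (x + y)) = x \<bullet> (P *v x) + y \<bullet> (P *v y) + 2 * (x \<bullet> (P *v y))"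
    if "transpose P = P" for P :: "real^'n^'n"
    using symmetric_inner(2)[OF that, of x y] by (simp add: mv_simps inner_add_left inner_add_right)
  from this[OF assms(1)] this[OF assms(2)] show "x \<bullet> (P1 *v y) = x \<bullet> (P2 *v y)"
    using assms(3)[of "x + y"] assms(3)[of x] assms(3)[of y] by simp
qed

lemma riccati_unique:
  assumes P1: "sym_pos_def P1" "riccati A P1" and P2: "sym_pos_def P2" "riccati A P2"
  shows "P1 = P2"
  by (rule symmetric_matrix_eqI)
     (use P1 P2 riccati_le[OF P1 P2] riccati_le[OF P2 P1] in \<open>auto simp: sym_pos_def_def intro: antisym\<close>)

text \<open>The cost of a stabilising feedback is a positive definite quadratic form, given by a Lyapunov
  equation. Passing to the gain of this form is one step of Newton's method (Kleinman).\<close>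

lemma feedback_cost:
  assumes st: "stable_matrix (A - B ** K)"
  obtains P where "sym_pos_def P" "\<And>x. dissipation A P x (- (K *v x)) = 0"
proof -
  define G where "G = A - B ** K"
  define M where "M = - (transpose (C - D ** K) ** S ** (C - D ** K))"
  have cost: "cost x (- (K *v x)) = - (x \<bullet> (M *v x))" for x
  proof -
    let ?z = "(C - D ** K) *v x"
    have "M *v x = - (transpose (C - D ** K) *v (S *v ?z))"
      unfolding M_def matrix_vector_mult_minus_left by (simp only: matrix_vector_mul_assoc matrix_mul_assoc)
    then have "x \<bullet> (M *v x) = - (?z \<bullet> (S *v ?z))"
      by (simp only: inner_minus_right inner_matrix_vector_transpose[of x "transpose (C - D ** K)"]
          transpose_transpose)
    moreover have "C *v x + D *v (- (K *v x)) = ?z"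
      by (simp add: mv_simps matrix_vector_mul_assoc)
    ultimately show ?thesis by (simp only: cost_def minus_minus)
  qed
  have "transpose M = M"
    by (simp add: M_def matrix_transpose_mul S_sym matrix_mul_assoc transpose_minus)
  then obtain P where sym: "transpose P = P" and eq: "transpose G ** P + P ** G = M"
    using lyapunov_equation_solvable[OF st] unfolding G_def by blast
  have form: "2 * (x \<bullet> (P *v (G *v x))) = x \<bullet> (M *v x)" for x
  proof -
    have "x \<bullet> (M *v x) = x \<bullet> (transpose G *v (P *v x)) + x \<bullet> (P *v (G *v x))"
      by (simp add: mv_simps inner_add_right matrix_vector_mul_assoc flip: eq)
    also have "x \<bullet> (transpose G *v (P *v x)) = x \<bullet> (P *v (G *v x))"
      using inner_matrix_vector_transpose[of x "transpose G" "P *v x"] symmetric_inner(2)[OF sym, of "G *v x" x]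
      by simp
    finally show ?thesis by simp
  qed
  have diss: "dissipation A P x (- (K *v x)) = 0" for x
    using form[of x] by (simp add: dissipation_feedback cost flip: G_def)
  obtain c where c: "c > 0" "\<And>x g. c * (x \<bullet> x) \<le> cost x g" using cost_lower by blast
  have neg: "x \<bullet> (P *v (G *v x)) \<le> - (c / 2) * (x \<bullet> x)" for x
    using form[of x] cost[of x] c(2)[of x "- (K *v x)"] by simp
  have psd: "0 \<le> x \<bullet> (P *v x)" for x :: "real^'l"
  proof (rule lyapunov_psd[OF st sym])
    fix x :: "real^'l"
    have "0 \<le> c / 2 * (x \<bullet> x)" using c(1) by simp
    then show "x \<bullet> (P *v ((A - B ** K) *v x)) \<le> 0" using neg[of x] by (simp flip: G_def)
  qed
  have "sym_pos_def P"
    unfolding sym_pos_def_def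
  proof (intro conjI sym allI impI)
    fix x :: "real^'l" assume "x \<noteq> 0"
    show "0 < x \<bullet> (P *v x)"
    proof (rule ccontr)
      assume "\<not> 0 < x \<bullet> (P *v x)"
      then have "P *v x = 0" using psd[of x] by (intro psd_inner_zero[OF sym psd]) auto
      then have "x \<bullet> (P *v (G *v x)) = 0" using symmetric_inner(2)[OF sym, of x "G *v x"] by simp
      moreover have "0 < c / 2 * (x \<bullet> x)" using c(1) \<open>x \<noteq> 0\<close> by simp
      ultimately show False using neg[of x] by simp
    qed
  qed
  then show ?thesis using diss by (rule that)
qed

lemma matrix_tendsto_of_quadratic_forms:
  fixes P :: "nat \<Rightarrow> real^'n^'n"
  assumes sym: "\<And>n. transpose (P n) = P n"
    and conv: "\<And>x. convergent (\<lambda>n. x \<bullet> (P n *v x))"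
  obtains L where "P \<longlonglongrightarrow> L"
proof -
  have entry: "P n $ i $ j = ((axis i 1 + axis j 1) \<bullet> (P n *v (axis i 1 + axis j 1))
      - axis i 1 \<bullet> (P n *v axis i 1) - axis j 1 \<bullet> (P n *v axis j 1)) / 2" for n i j
    using symmetric_inner(2)[OF sym, of "axis i 1" n "axis j 1"]
    by (simp add: mv_simps inner_add_left inner_add_right inner_axis' matrix_vector_mult_basis column_def)
  have "convergent (\<lambda>n. P n $ i $ j)" for i j
    unfolding entry divide_inverse by (intro convergent_diff convergent_mult convergent_const conv)
  then have "\<exists>l. (\<lambda>n. P n $ i $ j) \<longlonglongrightarrow> l" for i j by (simp add: convergent_def)
  then obtain l where "\<And>i j. (\<lambda>n. P n $ i $ j) \<longlonglongrightarrow> l i j" by metis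
  then have "P \<longlonglongrightarrow> (\<chi> i j. l i j)" by (intro vec_tendstoI) auto
  then show ?thesis by (rule that)
qed

text \<open>The iterates of Newton's method decrease and are bounded below, and their limit is a fixed
  point.\<close>

lemma riccati_exists_of_stabilizing:
  assumes st: "stable_matrix (A - B ** Ks)"
  shows "\<exists>P. sym_pos_def P \<and> riccati A P"
proof -
  define Inv where "Inv P \<longleftrightarrow> sym_pos_def P \<and> (\<forall>x. dissipation A P x (- (gain P *v x)) \<le> 0)" for P
  have sub: "Inv P" if "sym_pos_def P" "\<And>x. dissipation A P x (- (K *v x)) = 0" for P K
    using that dissipation_gain_le[of P A] unfolding Inv_def by (metis sym_pos_def_def)
  obtain P0 where "Inv P0" using feedback_cost[OF st] sub by metis
  have step: "\<exists>P'. Inv P' \<and> ((\<forall>x. dissipation A P' x (- (gain P *v x)) = 0) \<and> (\<forall>x. x \<bullet> (P' *v x) \<le> x \<bullet> (P *v x)))"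
    if P: "Inv P" for P
  proof -
    have stP: "stable_matrix (closed_loop A P)"
      using P unfolding Inv_def by (intro subsolution_stable) auto
    from feedback_cost[OF this] obtain P' where P': "sym_pos_def P'" "\<And>x. dissipation A P' x (- (gain P *v x)) = 0"
      by blast
    have "0 \<le> x \<bullet> ((P - P') *v x)" for x
    proof (rule lyapunov_psd[OF stP])
      show "transpose (P - P') = P - P'"
        using P P' by (simp add: Inv_def sym_pos_def_def transpose_diff)
      fix x :: "real^'l"
      have "dissipation A P x (- (gain P *v x)) \<le> 0" using P by (simp add: Inv_def)
      then show "x \<bullet> ((P - P') *v (closed_loop A P *v x)) \<le> 0"
        using P'(2)[of x] unfolding dissipation_feedback
        by (simp add: matrix_vector_mult_diff_rdistrib[of P] inner_diff_right)
    qed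
    then have "x \<bullet> (P' *v x) \<le> x \<bullet> (P *v x)" for x by (simp add: mv_simps inner_diff_right)
    then show ?thesis using sub[OF P'] P'(2) by blast
  qed
  obtain P where P: "\<And>n. Inv (P n)"
      "\<And>n. \<forall>x. dissipation A (P (Suc n)) x (- (gain (P n) *v x)) = 0"
      "\<And>n. \<forall>x. x \<bullet> (P (Suc n) *v x) \<le> x \<bullet> (P n *v x)"
    using dependent_nat_choice[of "\<lambda>_. Inv" "\<lambda>_ P P'. (\<forall>x. dissipation A P' x (- (gain P *v x)) = 0) \<and> (\<forall>x. x \<bullet> (P' *v x) \<le> x \<bullet> (P *v x))"]
      \<open>Inv P0\<close> step by metis
  have pd: "sym_pos_def (P n)" for n using P(1) by (simp add: Inv_def)
  then have sym: "transpose (P n) = P n" for n by (simp add: sym_pos_def_def)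
  have nonneg: "0 \<le> x \<bullet> (P n *v x)" for x n
    using pd[of n] by (cases "x = 0") (auto simp: sym_pos_def_def intro: less_imp_le)
  have conv: "convergent (\<lambda>n. x \<bullet> (P n *v x))" for x
  proof -
    have "decseq (\<lambda>n. x \<bullet> (P n *v x))" using P(3) by (intro decseq_SucI) auto
    then show ?thesis using decseq_convergent[of "\<lambda>n. x \<bullet> (P n *v x)" 0] nonneg
      by (metis convergent_def)
  qed
  obtain L where L: "P \<longlonglongrightarrow> L" using matrix_tendsto_of_quadratic_forms[OF sym conv] by blast
  have gainL: "(\<lambda>n. gain (P n)) \<longlonglongrightarrow> gain L"
    unfolding gain_def
    by (rule tendsto_matrix_mult_right, rule tendsto_add[OF tendsto_matrix_mult_right[OF L] tendsto_const])
  have dissL: "dissipation A L x (- (gain L *v x)) = 0" for x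
  proof -
    have g: "(\<lambda>n. - (gain (P n) *v x)) \<longlonglongrightarrow> - (gain L *v x)"
      by (rule tendsto_minus[OF tendsto_matrix_vector_left[OF gainL]])
    have dyn: "(\<lambda>n. A *v x + B *v (- (gain (P n) *v x))) \<longlonglongrightarrow> A *v x + B *v (- (gain L *v x))"
      by (rule tendsto_add[OF tendsto_const tendsto_matrix_vector_right[OF g]])
    have out: "(\<lambda>n. C *v x + D *v (- (gain (P n) *v x))) \<longlonglongrightarrow> C *v x + D *v (- (gain L *v x))"
      by (rule tendsto_add[OF tendsto_const tendsto_matrix_vector_right[OF g]])
    have PL: "(\<lambda>n. P (Suc n) *v (A *v x + B *v (- (gain (P n) *v x)))) \<longlonglongrightarrow> L *v (A *v x + B *v (- (gain L *v x)))"
      by (rule bounded_bilinear.tendsto[OF bounded_bilinear_matrix_vector_mult LIMSEQ_Suc[OF L] dyn])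
    have "(\<lambda>n. dissipation A (P (Suc n)) x (- (gain (P n) *v x))) \<longlonglongrightarrow> dissipation A L x (- (gain L *v x))"
      unfolding dissipation_def cost_def
      by (rule tendsto_add[OF tendsto_mult[OF tendsto_const tendsto_inner[OF tendsto_const PL]]
            tendsto_inner[OF out tendsto_matrix_vector_right[OF out]]])
    then show ?thesis using P(2) by (simp add: tendsto_const_iff)
  qed
  have ent: "(\<lambda>n. P n $ i $ j) \<longlonglongrightarrow> L $ i $ j" for i j by (intro tendsto_vec_nth L)
  have symL: "transpose L = L"
  proof -
    have "P n $ i $ j = P n $ j $ i" for n i j using sym[of n] by (metis transpose_def vec_lambda_beta)
    then have "L $ i $ j = L $ j $ i" for i j
      using LIMSEQ_unique[OF ent[of i j]] ent[of j i] by simp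
    then show ?thesis by (simp add: transpose_def vec_eq_iff)
  qed
  have psdL: "0 \<le> x \<bullet> (L *v x)" for x
    by (rule LIMSEQ_le_const[of "\<lambda>n. x \<bullet> (P n *v x)"]) (use nonneg in \<open>auto intro!: tendsto_inner tendsto_const tendsto_matrix_vector_left L\<close>)
  obtain c where c: "c > 0" "\<And>x g. c * (x \<bullet> x) \<le> cost x g" using cost_lower by blast
  have "sym_pos_def L"
    unfolding sym_pos_def_def
  proof (intro conjI symL allI impI)
    fix x :: "real^'l" assume "x \<noteq> 0"
    show "0 < x \<bullet> (L *v x)"
    proof (rule ccontr)
      assume "\<not> 0 < x \<bullet> (L *v x)"
      then have "L *v x = 0" using psdL[of x] by (intro psd_inner_zero[OF symL psdL]) auto
      then have "x \<bullet> (L *v (closed_loop A L *v x)) = 0"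
        using symmetric_inner(2)[OF symL, of x "closed_loop A L *v x"] by simp
      then have "cost x (- (gain L *v x)) = 0" using dissL[of x] by (simp add: dissipation_feedback)
      moreover have "0 < c * (x \<bullet> x)" using c(1) \<open>x \<noteq> 0\<close> by simp
      ultimately show False using c(2)[of x "- (gain L *v x)"] by simp
    qed
  qed
  then show ?thesis using dissL by (auto simp: riccati_def)
qed

lemma shift_mult: "(A - \<alpha> *\<^sub>R mat 1) *v x = A *v x - \<alpha> *\<^sub>R (x :: real^'a)"
  by (simp add: mv_simps matrix_vector_scaleR_left)

text \<open>Continuation in the shift: for a large shift \<open>A - \<alpha>I\<close> is stable, and a bound on the solutions
  that does not depend on \<open>\<alpha>\<close> allows the shift to be lowered by a fixed amount at a time.\<close>

lemma riccati_exists_of_bound: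
  assumes bound: "\<And>\<alpha> P x. \<lbrakk>\<alpha> \<ge> 0; sym_pos_def P; riccati (A - \<alpha> *\<^sub>R mat 1) P\<rbrakk> \<Longrightarrow> x \<bullet> (P *v x) \<le> C0 * (x \<bullet> x)"
    and "C0 > 0"
  shows "\<exists>P. sym_pos_def P \<and> riccati A P"
proof -
  define Q where "Q \<alpha> \<longleftrightarrow> (\<exists>P. sym_pos_def P \<and> riccati (A - \<alpha> *\<^sub>R mat 1) P)" for \<alpha>
  obtain b where b: "b > 0" "\<And>x. \<bar>x \<bullet> (A *v x)\<bar> \<le> b * (x \<bullet> x)" using quadratic_form_upper[of A] by blast
  define \<alpha>0 where "\<alpha>0 = b + 1"
  have "\<alpha>0 > 0" using b by (simp add: \<alpha>0_def)
  have start: "Q \<alpha>0"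
    unfolding Q_def
  proof (rule riccati_exists_of_stabilizing[where Ks = 0], rule lyapunov_stable)
    show "sym_pos_def (mat 1 :: real^'l^'l)" by (simp add: sym_pos_def_def transpose_mat)
    fix x :: "real^'l" assume "x \<noteq> 0"
    then have "x \<bullet> x > 0" by simp
    moreover have "x \<bullet> (A *v x) \<le> b * (x \<bullet> x)" using b(2)[of x] by simp
    ultimately have "x \<bullet> (A *v x) < \<alpha>0 * (x \<bullet> x)" unfolding \<alpha>0_def distrib_right by linarith
    moreover have "(A - \<alpha>0 *\<^sub>R mat 1 - B ** 0) *v x = A *v x - \<alpha>0 *\<^sub>R x"
      by (simp add: shift_mult)
    ultimately show "x \<bullet> (mat 1 *v ((A - \<alpha>0 *\<^sub>R mat 1 - B ** 0) *v x)) < 0"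
      by (simp add: inner_diff_right)
  qed
  obtain c where c: "c > 0" "\<And>x g. c * (x \<bullet> x) \<le> cost x g" using cost_lower by blast
  \<comment> \<open>lowering the shift by at most \<open>\<delta>\<close> changes \<open>2 x\<^sup>T P A x\<close> by at most half of the coercivity bound\<close>
  define \<delta> where "\<delta> = c / (4 * C0)"
  have "\<delta> > 0" using c \<open>C0 > 0\<close> by (simp add: \<delta>_def)
  have step: "Q \<beta>" if "Q \<alpha>" "\<alpha> \<ge> 0" "\<beta> \<ge> \<alpha> - \<delta>" for \<alpha> \<beta>
  proof -
    obtain P where P: "sym_pos_def P" "riccati (A - \<alpha> *\<^sub>R mat 1) P" using \<open>Q \<alpha>\<close> by (auto simp: Q_def)
    show ?thesis
      unfolding Q_def
    proof (rule riccati_exists_of_stabilizing[where Ks = "gain P"], rule lyapunov_stable[OF P(1)])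
      fix x :: "real^'l" assume "x \<noteq> 0"
      have "2 * (x \<bullet> (P *v (closed_loop (A - \<alpha> *\<^sub>R mat 1) P *v x))) = - cost x (- (gain P *v x))"
        using P(2) by (simp add: riccati_def dissipation_feedback eq_neg_iff_add_eq_0)
      also have "\<dots> \<le> - (c * (x \<bullet> x))" using c(2) by simp
      finally have 1: "2 * (x \<bullet> (P *v (closed_loop (A - \<alpha> *\<^sub>R mat 1) P *v x))) \<le> - (c * (x \<bullet> x))" .
      have pos: "0 < x \<bullet> (P *v x)" "0 < x \<bullet> x" using P(1) \<open>x \<noteq> 0\<close> by (auto simp: sym_pos_def_def)
      have "(\<alpha> - \<beta>) * (x \<bullet> (P *v x)) \<le> \<delta> * (x \<bullet> (P *v x))"
        using that(3) pos by (intro mult_right_mono) auto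
      also have "\<dots> \<le> \<delta> * (C0 * (x \<bullet> x))"
        using bound[OF \<open>\<alpha> \<ge> 0\<close> P] \<open>\<delta> > 0\<close> by (intro mult_left_mono) auto
      also have "\<dots> = c / 4 * (x \<bullet> x)" using \<open>C0 > 0\<close> by (simp add: \<delta>_def)
      finally have 2: "(\<alpha> - \<beta>) * (x \<bullet> (P *v x)) \<le> c / 4 * (x \<bullet> x)" .
      have "(A - \<beta> *\<^sub>R mat 1 - B ** gain P) *v x = closed_loop (A - \<alpha> *\<^sub>R mat 1) P *v x + (\<alpha> - \<beta>) *\<^sub>R x"
        by (simp add: matrix_vector_mult_diff_rdistrib matrix_vector_scaleR_left algebra_simps)
      then have "x \<bullet> (P *v ((A - \<beta> *\<^sub>R mat 1 - B ** gain P) *v x))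
          = x \<bullet> (P *v (closed_loop (A - \<alpha> *\<^sub>R mat 1) P *v x)) + (\<alpha> - \<beta>) * (x \<bullet> (P *v x))"
        by (simp add: matrix_vector_right_distrib matrix_vector_mult_scaleR inner_add_right)
      also have "\<dots> \<le> - (c / 4 * (x \<bullet> x))" using 1 2 by simp
      also have "\<dots> < 0" using c(1) pos(2) by simp
      finally show "x \<bullet> (P *v ((A - \<beta> *\<^sub>R mat 1 - B ** gain P) *v x)) < 0" .
    qed
  qed
  have "Q (max 0 (\<alpha>0 - real k * \<delta>))" for k
  proof (induction k)
    case 0
    then show ?case using start \<open>\<alpha>0 > 0\<close> by simp
  next
    case (Suc k)
    show ?case by (rule step[OF Suc]) (use \<open>\<delta> > 0\<close> in \<open>auto simp: algebra_simps max_def\<close>)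
  qed
  moreover obtain k where "\<alpha>0 / \<delta> \<le> real k" using real_arch_simple by blast
  then have "\<alpha>0 - real k * \<delta> \<le> 0" using \<open>\<delta> > 0\<close> by (simp add: field_simps)
  ultimately have "Q 0" by (metis max.absorb1)
  then show ?thesis by (simp add: Q_def)
qed

end

lemma matrix_inner_sum:
  fixes P :: "real^'n^'n"
  shows "x \<bullet> (P *v x) = (\<Sum>i\<in>UNIV. \<Sum>j\<in>UNIV. x $ i * P $ i $ j * x $ j)"
  by (simp add: inner_vec_def matrix_vector_mult_def sum_distrib_left mult.assoc)

lemma psd_quadratic_form_le_trace:
  fixes P :: "real^'n^'n"
  assumes sym: "transpose P = P" and psd: "\<And>x. 0 \<le> x \<bullet> (P *v x)"
  shows "x \<bullet> (P *v x) \<le> real CARD('n) * (\<Sum>i\<in>UNIV. P $ i $ i) * (x \<bullet> x)"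
proof -
  have ij: "axis i 1 \<bullet> (P *v axis j 1) = P $ i $ j" for i j
    by (simp add: inner_axis' matrix_vector_mult_basis column_def)
  have sym': "P $ i $ j = P $ j $ i" for i j
    using sym by (metis transpose_def vec_lambda_beta)
  have entry: "\<bar>P $ i $ j\<bar> \<le> (P $ i $ i + P $ j $ j) / 2" for i j
    using psd[of "axis i 1 + axis j 1"] psd[of "axis i 1 - axis j 1"] sym'[of i j]
    by (simp add: mv_simps inner_add_left inner_add_right inner_diff_left inner_diff_right ij abs_le_iff)
  have comp: "\<bar>x $ i\<bar> * \<bar>x $ j\<bar> \<le> x \<bullet> x" for i j
  proof -
    have "\<bar>x $ i\<bar> * \<bar>x $ j\<bar> \<le> norm x * norm x"
      by (intro mult_mono component_le_norm_cart) auto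
    then show ?thesis by (simp add: dot_square_norm power2_eq_square)
  qed
  have "x \<bullet> (P *v x) \<le> (\<Sum>i\<in>UNIV. \<Sum>j\<in>UNIV. (x \<bullet> x) * ((P $ i $ i + P $ j $ j) / 2))"
    unfolding matrix_inner_sum
  proof (intro sum_mono)
    fix i j
    have "x $ i * P $ i $ j * x $ j \<le> \<bar>x $ i * P $ i $ j * x $ j\<bar>" by simp
    also have "\<dots> = (\<bar>x $ i\<bar> * \<bar>x $ j\<bar>) * \<bar>P $ i $ j\<bar>" by (simp add: abs_mult)
    also have "\<dots> \<le> (x \<bullet> x) * ((P $ i $ i + P $ j $ j) / 2)"
      by (intro mult_mono comp entry) auto
    finally show "x $ i * P $ i $ j * x $ j \<le> (x \<bullet> x) * ((P $ i $ i + P $ j $ j) / 2)" .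
  qed
  also have "\<dots> = (x \<bullet> x) * (\<Sum>i\<in>UNIV. \<Sum>j\<in>UNIV. (P $ i $ i + P $ j $ j) / 2)"
    by (simp only: sum_distrib_left)
  also have "(\<Sum>i\<in>UNIV. \<Sum>j\<in>UNIV. (P $ i $ i + P $ j $ j) / 2) = real CARD('n) * (\<Sum>i\<in>UNIV. P $ i $ i)"
  proof -
    have "(\<Sum>i\<in>UNIV. \<Sum>j\<in>(UNIV::'n set). (P $ i $ i + P $ j $ j) / 2)
       = (\<Sum>i\<in>UNIV. \<Sum>j\<in>(UNIV::'n set). P $ i $ i / 2) + (\<Sum>i\<in>(UNIV::'n set). \<Sum>j\<in>UNIV. P $ j $ j / 2)"
      by (simp only: add_divide_distrib sum.distrib)
    also have "\<dots> = real CARD('n) * (\<Sum>i\<in>UNIV. P $ i $ i / 2) + real CARD('n) * (\<Sum>i\<in>UNIV. P $ i $ i / 2)"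
      by (simp only: sum_constant sum_distrib_left)
    also have "(\<Sum>i\<in>UNIV. P $ i $ i / 2) = (\<Sum>i\<in>UNIV. P $ i $ i) / 2"
      by (simp only: sum_divide_distrib)
    finally show ?thesis by simp
  qed
  finally show ?thesis by (simp add: ac_simps)
qed

context lq_problem
begin

lemma cost_integrable:
  assumes "L2_on {a..b} p" "L2_on {a..b} g"
  shows "integrable (lebesgue_on {a..b}) (\<lambda>t. cost (p t) (g t))"
  unfolding cost_def
  by (intro L2_on_inner_integrable L2_on_matrix L2_on_add assms)

text \<open>A solution of the equation with \<open>A - \<alpha>I\<close> is compared with a trajectory of the unshifted
  system, on which \<open>exp(- 2\<alpha>t) p\<^sup>T P p\<close> plus the accumulated cost does not decrease.\<close>

lemma riccati_le_trajectory_cost: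
  assumes "\<alpha> \<ge> 0" "sym_pos_def P" "riccati (A - \<alpha> *\<^sub>R mat 1) P" "\<tau> \<ge> 0"
    and ac: "abs_cont_on_interval 0 \<tau> p" and g: "L2_on {0..\<tau>} g"
    and ae: "AE t in lebesgue_on {0..\<tau>}. (p has_vector_derivative (A *v p t + B *v g t)) (at t within {0..\<tau>})"
  shows "p 0 \<bullet> (P *v p 0) \<le> integral {0..\<tau>} (\<lambda>t. cost (p t) (g t)) + p \<tau> \<bullet> (P *v p \<tau>)"
proof -
  have sym: "transpose P = P" using assms by (simp add: sym_pos_def_def)
  define e where "e = (\<lambda>t::real. exp (- 2 * \<alpha> * t))"
  have de: "(e has_vector_derivative (- 2 * \<alpha> * e t)) (at t within S)" for t S
    unfolding e_def has_real_derivative_iff_has_vector_derivative[symmetric]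
    by (auto intro!: derivative_eq_intros)
  define V where "V = (\<lambda>t. p t \<bullet> (P *v p t))"
  define h where "h = (\<lambda>t. e t * (2 * (p t \<bullet> (P *v (A *v p t + B *v g t)))) + (- 2 * \<alpha> * e t) * V t)"
  have acV: "abs_cont_on_interval 0 \<tau> V"
    unfolding V_def
    by (rule abs_cont_bilinear[OF bounded_bilinear_inner ac abs_cont_linear[OF matrix_vector_mul_bounded_linear ac]])
  have ace: "abs_cont_on_interval 0 \<tau> e"
    by (rule abs_cont_C1[OF de]) (auto simp: e_def intro!: continuous_intros)
  have acW: "abs_cont_on_interval 0 \<tau> (\<lambda>t. e t * V t)"
    by (rule abs_cont_bilinear[OF bounded_bilinear_mult ace acV])
  have "AE t in lebesgue_on {0..\<tau>}. ((\<lambda>t. e t * V t) has_vector_derivative h t) (at t within {0..\<tau>})"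
    using ae
  proof eventually_elim
    case (elim t)
    have "((\<lambda>t. P *v p t) has_vector_derivative P *v (A *v p t + B *v g t)) (at t within {0..\<tau>})"
      by (rule bounded_linear.has_vector_derivative[OF matrix_vector_mul_bounded_linear elim])
    from bounded_bilinear.has_vector_derivative[OF bounded_bilinear_inner elim this]
    have dV: "(V has_vector_derivative 2 * (p t \<bullet> (P *v (A *v p t + B *v g t)))) (at t within {0..\<tau>})"
      unfolding V_def
      by (simp only: symmetric_inner(2)[OF sym, of "A *v p t + B *v g t"] mult_2)
    show ?case
      using bounded_bilinear.has_vector_derivative[OF bounded_bilinear_mult de dV]
      by (simp add: h_def)
  qed
  from fundamental_theorem_AE[OF \<open>\<tau> \<ge> 0\<close> acW this]
  have int: "(h has_integral (e \<tau> * V \<tau> - e 0 * V 0)) {0..\<tau>}" .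
  have "L2_on {0..\<tau>} p" by (rule L2_on_continuous[OF abs_cont_imp_continuous_on[OF ac]])
  then have "integrable (lebesgue_on {0..\<tau>}) (\<lambda>t. cost (p t) (g t))" using g by (rule cost_integrable)
  then have "(\<lambda>t. cost (p t) (g t)) integrable_on {0..\<tau>}" by (rule integrable_on_lebesgue_on) simp
  then have cint: "((\<lambda>t. - cost (p t) (g t)) has_integral - integral {0..\<tau>} (\<lambda>t. cost (p t) (g t))) {0..\<tau>}"
    by (intro has_integral_neg integrable_integral)
  have "- cost (p t) (g t) \<le> h t" if "t \<in> {0..\<tau>}" for t
  proof -
    have e01: "0 \<le> e t" "e t \<le> 1" using that \<open>\<alpha> \<ge> 0\<close> by (auto simp: e_def)
    have "0 \<le> dissipation (A - \<alpha> *\<^sub>R mat 1) P (p t) (g t)"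
      by (rule riccati_dissipation_nonneg[OF sym assms(3)])
    then have "- cost (p t) (g t) \<le> 2 * (p t \<bullet> (P *v (A *v p t + B *v g t))) - 2 * \<alpha> * V t"
      by (simp add: dissipation_def shift_mult V_def mv_simps matrix_vector_mult_scaleR
          matrix_vector_scaleR_left inner_add_right inner_diff_right algebra_simps)
    then have "e t * (- cost (p t) (g t)) \<le> e t * (2 * (p t \<bullet> (P *v (A *v p t + B *v g t))) - 2 * \<alpha> * V t)"
      using e01 by (intro mult_left_mono) auto
    also have "\<dots> = h t" by (simp add: h_def algebra_simps)
    also have "- cost (p t) (g t) \<le> e t * (- cost (p t) (g t))"
      using mult_right_mono[OF e01(2) cost_nonneg[of "p t" "g t"]] by simp
    ultimately show ?thesis by linarith
  qed
  from has_integral_le[OF cint int this]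
  have "V 0 \<le> integral {0..\<tau>} (\<lambda>t. cost (p t) (g t)) + e \<tau> * V \<tau>" by (simp add: e_def)
  moreover have "e \<tau> * V \<tau> \<le> V \<tau>"
  proof -
    have "0 \<le> V \<tau>" using assms(2) by (cases "p \<tau> = 0") (auto simp: V_def sym_pos_def_def intro: less_imp_le)
    moreover have "e \<tau> \<le> 1" using \<open>\<alpha> \<ge> 0\<close> \<open>\<tau> \<ge> 0\<close> by (simp add: e_def)
    ultimately show ?thesis using mult_right_mono[of "e \<tau>" 1 "V \<tau>"] by simp
  qed
  ultimately show ?thesis by (simp add: V_def)
qed

text \<open>Trajectories that contract a basis bound the trace of every solution of a shifted equation.\<close>

lemma riccati_exists_of_contracting_trajectories:
  fixes p :: "'l \<Rightarrow> real \<Rightarrow> real^'l" and g :: "'l \<Rightarrow> real \<Rightarrow> real^'k"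
  assumes "\<tau> \<ge> 0"
    and ac: "\<And>i. abs_cont_on_interval 0 \<tau> (p i)" and g: "\<And>i. L2_on {0..\<tau>} (g i)"
    and ae: "\<And>i. AE t in lebesgue_on {0..\<tau>}. (p i has_vector_derivative (A *v p i t + B *v g i t)) (at t within {0..\<tau>})"
    and init: "\<And>i. p i 0 = axis i 1"
    and contr: "\<And>i. p i \<tau> \<bullet> p i \<tau> \<le> 1 / (2 * real CARD('l) * real CARD('l))"
  shows "\<exists>P. sym_pos_def P \<and> riccati A P"
proof -
  let ?n = "real CARD('l)"
  have n: "?n > 0" by simp
  define c where "c = (\<Sum>i\<in>UNIV. integral {0..\<tau>} (\<lambda>t. cost (p i t) (g i t)))"
  define C0 where "C0 = ?n * (2 * \<bar>c\<bar>) + 1"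
  show ?thesis
  proof (rule riccati_exists_of_bound[where ?C0.0 = C0])
    show "C0 > 0" by (simp add: C0_def add_nonneg_pos)
    fix \<alpha> P and x :: "real^'l"
    assume \<alpha>: "\<alpha> \<ge> 0" and P: "sym_pos_def P" "riccati (A - \<alpha> *\<^sub>R mat 1) P"
    have sym: "transpose P = P" using P by (simp add: sym_pos_def_def)
    have psd: "0 \<le> x \<bullet> (P *v x)" for x
      using P(1) by (cases "x = 0") (auto simp: sym_pos_def_def intro: less_imp_le)
    define tr where "tr = (\<Sum>i\<in>UNIV. P $ i $ i)"
    have diag: "axis i 1 \<bullet> (P *v axis i 1) = P $ i $ i" for i
      by (simp add: inner_axis' matrix_vector_mult_basis column_def)
    have "tr \<ge> 0" unfolding tr_def by (rule sum_nonneg) (metis diag psd)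
    have le: "y \<bullet> (P *v y) \<le> ?n * tr * (y \<bullet> y)" for y
      unfolding tr_def by (rule psd_quadratic_form_le_trace[OF sym psd])
    have each: "P $ i $ i \<le> integral {0..\<tau>} (\<lambda>t. cost (p i t) (g i t)) + tr / (2 * ?n)" for i
    proof -
      have "P $ i $ i \<le> integral {0..\<tau>} (\<lambda>t. cost (p i t) (g i t)) + p i \<tau> \<bullet> (P *v p i \<tau>)"
        using riccati_le_trajectory_cost[OF \<alpha> P \<open>\<tau> \<ge> 0\<close> ac g ae] by (simp add: init diag)
      also have "p i \<tau> \<bullet> (P *v p i \<tau>) \<le> ?n * tr * (p i \<tau> \<bullet> p i \<tau>)" by (rule le)
      also have "\<dots> \<le> ?n * tr * (1 / (2 * ?n * ?n))"
        using \<open>tr \<ge> 0\<close> by (intro mult_left_mono contr) auto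
      also have "\<dots> = tr / (2 * ?n)" using n by simp
      finally show ?thesis by simp
    qed
    have "tr \<le> (\<Sum>i\<in>(UNIV::'l set). integral {0..\<tau>} (\<lambda>t. cost (p i t) (g i t)) + tr / (2 * ?n))"
      unfolding tr_def[symmetric] by (subst (1) tr_def) (rule sum_mono[OF each])
    also have "\<dots> = c + tr / 2" by (simp add: sum.distrib c_def)
    finally have "tr \<le> 2 * \<bar>c\<bar>" by simp
    have "x \<bullet> (P *v x) \<le> ?n * tr * (x \<bullet> x)" by (rule le)
    also have "\<dots> \<le> C0 * (x \<bullet> x)"
    proof (rule mult_right_mono)
      have "?n * tr \<le> ?n * (2 * \<bar>c\<bar>)" using \<open>tr \<le> 2 * \<bar>c\<bar>\<close> n by (intro mult_left_mono) auto
      then show "?n * tr \<le> C0" unfolding C0_def by linarith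
    qed simp
    finally show "x \<bullet> (P *v x) \<le> C0 * (x \<bullet> x)" .
  qed
qed

lemma riccati_matrix_equation:
  assumes sym: "transpose P = P"
  shows "riccati A P \<longleftrightarrow> 0 = P ** A + transpose A ** P
    - transpose (gain P) ** (transpose D ** S ** D) ** gain P + transpose C ** S ** C"
    (is "_ \<longleftrightarrow> 0 = ?M")
proof -
  have "transpose ?M = ?M"
    by (simp add: transpose_add transpose_diff matrix_transpose_mul sym S_sym matrix_mul_assoc add.commute)
  have form: "x \<bullet> (?M *v x) = dissipation A P x (- (gain P *v x))" for x
  proof -
    have t: "x \<bullet> (transpose X *v y) = (X *v x) \<bullet> y" for X :: "real^'l^'a" and y
      using inner_matrix_vector_transpose[of x "transpose X" y] by simp
    have "x \<bullet> (?M *v x) = x \<bullet> (P *v (A *v x)) + x \<bullet> (transpose A *v (P *v x))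
      - x \<bullet> (transpose (gain P) *v (transpose D *v (S *v (D *v (gain P *v x)))))
      + x \<bullet> (transpose C *v (S *v (C *v x)))"
      by (simp only: matrix_vector_mult_add_rdistrib matrix_vector_mult_diff_rdistrib inner_add_right
          inner_diff_right matrix_vector_mul_assoc matrix_mul_assoc)
    also have "x \<bullet> (transpose A *v (P *v x)) = x \<bullet> (P *v (A *v x))"
      using inner_matrix_vector_transpose[of x "transpose A" "P *v x"] symmetric_inner(2)[OF sym, of x "A *v x"]
      by (simp add: inner_commute)
    also have "x \<bullet> (transpose (gain P) *v (transpose D *v (S *v (D *v (gain P *v x)))))
        = (D *v (gain P *v x)) \<bullet> (S *v (D *v (gain P *v x)))"
      using inner_matrix_vector_transpose[of x "transpose (gain P)"]
        inner_matrix_vector_transpose[of "gain P *v x" "transpose D"]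
      by (simp only: transpose_transpose)
    also have "x \<bullet> (transpose C *v (S *v (C *v x))) = cost x 0"
      using inner_matrix_vector_transpose[of x "transpose C"] by (simp only: transpose_transpose cost_def) simp
    finally show ?thesis
      using dissipation_completion[OF sym, of A x 0] by (simp add: dissipation_def)
  qed
  show ?thesis
  proof
    assume "riccati A P"
    then show "0 = ?M"
      using symmetric_matrix_eqI[OF _ \<open>transpose ?M = ?M\<close>, of 0] form
      by (simp add: riccati_def transpose_def vec_eq_iff)
  next
    assume "0 = ?M"
    then show "riccati A P" unfolding riccati_def form[symmetric] by simp
  qed
qed

end

section \<open>Systems associated with the dual equation\<close>

text \<open>Products with a transposed matrix are kept as they are, instead of being turned into products
  from the left.\<close>

declare transpose_matrix_vector [simp del]

lemma matrix_mult_add_left: "(X + Y) ** Z = X ** Z + Y ** (Z :: real^'a^'b)"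
  by (rule bounded_bilinear.add_left[OF bounded_bilinear_matrix_matrix_mult])

lemma matrix_mult_diff_left: "(X - Y) ** Z = X ** Z - Y ** (Z :: real^'a^'b)"
  and matrix_mult_diff_right: "Z' ** (X' - Y') = Z' ** X' - Z' ** (Y' :: real^'a^'b)"
  by (rule bounded_bilinear.diff_left[OF bounded_bilinear_matrix_matrix_mult]
      bounded_bilinear.diff_right[OF bounded_bilinear_matrix_matrix_mult])+

lemma sum_UNIV_Plus:
  "(\<Sum>i\<in>(UNIV :: ('a::finite + 'b::finite) set). f i) = (\<Sum>a\<in>UNIV. f (Inl a)) + (\<Sum>b\<in>UNIV. f (Inr b))"
  by (subst UNIV_Plus_UNIV[symmetric], subst sum.Plus) auto

text \<open>The two components of a vector, and of a matrix, whose rows are indexed by a sum type.\<close>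

definition upper_part :: "real^('m::finite + 'p::finite) \<Rightarrow> real^'m" where
  "upper_part z = (\<chi> i. z $ Inl i)"

definition lower_part :: "real^('m::finite + 'p::finite) \<Rightarrow> real^'p" where
  "lower_part z = (\<chi> i. z $ Inr i)"

definition stack_rows :: "real^'a^'m \<Rightarrow> real^'a^'p \<Rightarrow> real^'a^('m::finite + 'p::finite)" where
  "stack_rows X Y = (\<chi> i. case i of Inl a \<Rightarrow> X $ a | Inr b \<Rightarrow> Y $ b)"

lemma upper_rows_mult_vector: "upper_rows M *v x = upper_part (M *v x)"
  and lower_rows_mult_vector: "lower_rows M *v x = lower_part (M *v x)"
  by (simp_all add: upper_rows_def lower_rows_def upper_part_def lower_part_def matrix_vector_mult_def)

lemma upper_rows_mult: "upper_rows (M ** N) = upper_rows M ** N"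
  and lower_rows_mult: "lower_rows (M ** N) = lower_rows M ** N"
  by (simp_all add: upper_rows_def lower_rows_def matrix_matrix_mult_def vec_eq_iff)

lemma upper_rows_add: "upper_rows (M + N) = upper_rows M + upper_rows N"
  and lower_rows_add: "lower_rows (M + N) = lower_rows M + lower_rows N"
  and upper_rows_diff: "upper_rows (M - N) = upper_rows M - upper_rows N"
  and lower_rows_diff: "lower_rows (M - N) = lower_rows M - lower_rows N"
  by (simp_all add: upper_rows_def lower_rows_def vec_eq_iff)

lemma upper_rows_stack_rows [simp]: "upper_rows (stack_rows X Y) = X"
  and lower_rows_stack_rows [simp]: "lower_rows (stack_rows X Y) = Y"
  by (simp_all add: upper_rows_def lower_rows_def stack_rows_def vec_eq_iff)

lemma stack_eq_iff: "stack q u = z \<longleftrightarrow> q = upper_part z \<and> u = lower_part z"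
  by (auto simp: stack_def upper_part_def lower_part_def vec_eq_iff split: sum.splits)

lemma upper_part_stack [simp]: "upper_part (stack q u) = q"
  and lower_part_stack [simp]: "lower_part (stack q u) = u"
  by (simp_all add: stack_def upper_part_def lower_part_def vec_eq_iff)

lemma stack_mult: "stack (X *v v) (Y *v v) = stack_rows X Y *v v"
  by (auto simp: stack_def stack_rows_def matrix_vector_mult_def vec_eq_iff split: sum.splits)

lemma inner_sum_parts: "z \<bullet> w = upper_part z \<bullet> upper_part w + lower_part z \<bullet> lower_part w"
  by (simp add: inner_vec_def upper_part_def lower_part_def sum_UNIV_Plus)

lemma inner_sum_rows: "M \<bullet> N = upper_rows M \<bullet> upper_rows N + lower_rows M \<bullet> lower_rows N"
  by (simp add: inner_vec_def upper_rows_def lower_rows_def sum_UNIV_Plus)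

lemma block_diag_mult: "block_diag M N *v z = stack (M *v upper_part z) (N *v lower_part z)"
  unfolding vec_eq_iff
proof
  fix i
  show "(block_diag M N *v z) $ i = stack (M *v upper_part z) (N *v lower_part z) $ i"
    by (cases i) (simp_all add: block_diag_def stack_def upper_part_def lower_part_def
        matrix_vector_mult_def sum_UNIV_Plus)
qed

lemma symmetric_entry:
  assumes "transpose P = P"
  shows "P $ i $ j = P $ j $ i"
  using arg_cong[OF assms, of "\<lambda>M. M $ j $ i"] by (simp add: transpose_def)

lemma sym_pos_def_block_diag:
  assumes "sym_pos_def M" "sym_pos_def N"
  shows "sym_pos_def (block_diag M N)"
  unfolding sym_pos_def_def
proof (intro conjI allI impI)
  have "M $ i $ j = M $ j $ i" for i j using assms(1) unfolding sym_pos_def_def by (blast intro: symmetric_entry)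
  moreover have "N $ i $ j = N $ j $ i" for i j using assms(2) unfolding sym_pos_def_def by (blast intro: symmetric_entry)
  ultimately have "transpose (block_diag M N) $ i $ j = block_diag M N $ i $ j" for i j
    by (cases i; cases j) (simp_all add: transpose_def block_diag_def)
  then show "transpose (block_diag M N) = block_diag M N" by (simp add: vec_eq_iff)
  fix x :: "real^('a + 'b)" assume "x \<noteq> 0"
  then have "upper_part x \<noteq> 0 \<or> lower_part x \<noteq> 0"
    by (auto simp: upper_part_def lower_part_def vec_eq_iff) (metis sum.exhaust_sel)
  moreover have "0 \<le> y \<bullet> (M *v y)" for y using assms(1) by (cases "y = 0") (auto simp: sym_pos_def_def intro: less_imp_le)
  moreover have "0 \<le> y \<bullet> (N *v y)" for y using assms(2) by (cases "y = 0") (auto simp: sym_pos_def_def intro: less_imp_le)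
  moreover have "y \<noteq> 0 \<Longrightarrow> 0 < y \<bullet> (M *v y)" for y using assms(1) by (simp add: sym_pos_def_def)
  moreover have "y \<noteq> 0 \<Longrightarrow> 0 < y \<bullet> (N *v y)" for y using assms(2) by (simp add: sym_pos_def_def)
  ultimately show "0 < x \<bullet> (block_diag M N *v x)"
    unfolding inner_sum_parts block_diag_mult upper_part_stack lower_part_stack
    by (metis add_nonneg_pos add_pos_nonneg)
qed

lemma invertible_matrix_inv:
  fixes T :: "real^'n^'n"
  assumes "invertible T"
  shows "T ** matrix_inv T = mat 1" "matrix_inv T ** T = mat 1"
proof -
  have "\<exists>N. T ** N = mat 1 \<and> N ** T = mat 1" using assms by (simp add: invertible_def)
  from someI_ex[OF this] show "T ** matrix_inv T = mat 1" "matrix_inv T ** T = mat 1"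
    by (simp_all add: matrix_inv_def)
qed

lemma matrix_inv_of_injective:
  fixes M :: "real^'n^'n"
  assumes "\<And>x. M *v x = 0 \<Longrightarrow> x = 0"
  shows "M ** matrix_inv M = mat 1" "matrix_inv M ** M = mat 1"
proof -
  obtain M' where "M' ** M = mat 1" using matrix_left_invertible_ker[of M] assms by blast
  then have "invertible M" by (metis invertible_left_inverse)
  from invertible_matrix_inv[OF this]
  show "M ** matrix_inv M = mat 1" "matrix_inv M ** M = mat 1" .
qed

lemma sym_pos_def_inverse:
  assumes "sym_pos_def Q"
  shows "Q ** matrix_inv Q = mat 1" "matrix_inv Q ** Q = mat 1" "sym_pos_def (matrix_inv Q)"
proof -
  have sym: "transpose Q = Q" using assms by (simp add: sym_pos_def_def)
  have ker: "x = 0" if "Q *v x = 0" for x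
  proof (rule ccontr)
    assume "x \<noteq> 0"
    then have "0 < x \<bullet> (Q *v x)" using assms by (simp add: sym_pos_def_def)
    then show False using that by simp
  qed
  show 1: "Q ** matrix_inv Q = mat 1" and 2: "matrix_inv Q ** Q = mat 1"
    by (rule matrix_inv_of_injective[OF ker], assumption)+
  have "transpose (matrix_inv Q) = (matrix_inv Q ** Q) ** transpose (matrix_inv Q)" by (simp add: 2)
  also have "\<dots> = matrix_inv Q ** transpose (matrix_inv Q ** Q)"
    by (simp add: matrix_transpose_mul sym matrix_mul_assoc)
  also have "\<dots> = matrix_inv Q" by (simp add: 2 transpose_mat)
  finally have t: "transpose (matrix_inv Q) = matrix_inv Q" .
  show "sym_pos_def (matrix_inv Q)"
    unfolding sym_pos_def_def
  proof (intro conjI t allI impI)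
    fix x :: "real^'a" assume "x \<noteq> 0"
    define y where "y = matrix_inv Q *v x"
    have Qy: "Q *v y = x" by (simp add: y_def matrix_vector_mul_assoc 1)
    then have "y \<noteq> 0" using \<open>x \<noteq> 0\<close> by auto
    then have "0 < y \<bullet> (Q *v y)" using assms by (simp add: sym_pos_def_def)
    then show "0 < x \<bullet> (matrix_inv Q *v x)" by (simp add: Qy inner_commute flip: y_def)
  qed
qed

text \<open>For injective \<open>M\<close>, the matrix \<open>(M\<^sup>T M)\<^sup>-\<^sup>1 M\<^sup>T\<close> is a left inverse and solves the Penrose equations; every
  solution is a left inverse and agrees with it.\<close>

lemma pinv_left_inverse:
  fixes M :: "real^'n^'m"
  assumes inj: "\<And>x. M *v x = 0 \<Longrightarrow> x = 0"
  shows "pinv M ** M = mat 1"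
proof -
  let ?pen = "\<lambda>X. M ** X ** M = M \<and> X ** M ** X = X \<and>
                    transpose (M ** X) = M ** X \<and> transpose (X ** M) = X ** M"
  define W where "W = transpose M ** M"
  have "sym_pos_def W"
    unfolding sym_pos_def_def
  proof (intro conjI allI impI)
    show "transpose W = W" by (simp add: W_def matrix_transpose_mul)
    fix x :: "real^'n" assume "x \<noteq> 0"
    then have "M *v x \<noteq> 0" using inj by blast
    moreover have "x \<bullet> (W *v x) = (M *v x) \<bullet> (M *v x)"
      using inner_matrix_vector_transpose[of x "transpose M" "M *v x"]
      unfolding W_def matrix_vector_mul_assoc[symmetric] by (simp only: transpose_transpose)
    ultimately show "0 < x \<bullet> (W *v x)" by simp
  qed
  note W = sym_pos_def_inverse[OF this]
  define X where "X = matrix_inv W ** transpose M"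
  have XM: "X ** M = mat 1" using W(2) by (simp add: X_def W_def flip: matrix_mul_assoc)
  have Wt: "transpose (matrix_inv W) = matrix_inv W" using W(3) by (simp add: sym_pos_def_def)
  have pen: "?pen X"
  proof (intro conjI)
    show "M ** X ** M = M" by (simp add: XM flip: matrix_mul_assoc)
    show "X ** M ** X = X" by (simp add: XM)
    show "transpose (X ** M) = X ** M" by (simp add: XM transpose_mat)
    show "transpose (M ** X) = M ** X"
      by (simp add: X_def matrix_transpose_mul Wt matrix_mul_assoc)
  qed
  have uniq: "Y = X" if Y: "?pen Y" for Y
  proof -
    have YM: "Y ** M = mat 1"
    proof -
      have "X ** (M ** Y ** M) = X ** M" using Y by simp
      then show ?thesis by (simp add: XM matrix_mul_assoc)
    qed
    have "M ** Y = M ** X ** (M ** Y)" using pen by (simp add: matrix_mul_assoc)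
    also have "\<dots> = transpose (M ** X) ** transpose (M ** Y)" using Y pen by simp
    also have "\<dots> = transpose (M ** Y ** M ** X)" by (simp add: matrix_transpose_mul matrix_mul_assoc)
    also have "\<dots> = M ** X" using Y pen by simp
    finally have "X ** (M ** Y) = X ** (M ** X)" by simp
    then show ?thesis by (simp add: matrix_mul_assoc XM)
  qed
  have "pinv M = X" unfolding pinv_def by (rule the_equality[of ?pen, OF pen]) (rule uniq)
  then show ?thesis by (simp add: XM)
qed

lemma rank_full_imp_injective:
  fixes M :: "real^'n^'m"
  assumes "rank M = CARD('n)" "M *v x = 0"
  shows "x = 0"
  using assms full_rank_injective[of M] by (metis injD matrix_vector_mult_0_right)

text \<open>An LTI system associated with the dual equation.\<close>

locale associated =
  fixes F A :: "real^'n^'m" and H :: "real^'n^'p"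
    and Aa :: "real^'h^'h" and Ba :: "real^'k^'h"
    and Ca :: "real^'h^('m + 'p)" and Da :: "real^'k^('m + 'p)"
  assumes assoc: "associated_lti F A H Aa Ba Ca Da"
begin

text \<open>The matrix \<open>F\<^sup>T C\<^sub>s\<close>, which turns a state into the value of \<open>F\<^sup>T q\<close>, and its pseudoinverse, the
  state map.\<close>

definition E :: "real^'h^'n" where "E = transpose F ** upper_rows Ca"

definition EL :: "real^'n^'h" where "EL = state_map F Ca"

lemma FD: "transpose F ** upper_rows Da = 0"
  using assoc by (simp add: associated_lti_def)

lemma dual_iff: "horizon I \<Longrightarrow> dual_solution F A H I q u \<longleftrightarrow>
   (\<exists>p g. lti_trajectory Aa Ba I p g \<and> (AE t in lebesgue_on I. stack (q t) (u t) = Ca *v p t + Da *v g t))"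
  using assoc unfolding associated_lti_def by blast

lemma E_inj: "E *v x = 0 \<Longrightarrow> x = 0"
  using assoc rank_full_imp_injective[of E x] by (simp add: associated_lti_def E_def)

lemma EL_E: "EL ** E = mat 1"
  unfolding EL_def state_map_def E_def[symmetric] by (rule pinv_left_inverse[OF E_inj])

lemma E_output: "transpose F *v upper_part (Ca *v p + Da *v g) = E *v p"
proof -
  have "upper_part (Ca *v p + Da *v g) = upper_rows Ca *v p + upper_rows Da *v g"
    by (simp add: upper_rows_mult_vector upper_part_def vec_eq_iff)
  then have "transpose F *v upper_part (Ca *v p + Da *v g)
      = (transpose F ** upper_rows Ca) *v p + (transpose F ** upper_rows Da) *v g"
    by (simp only: matrix_vector_right_distrib matrix_vector_mul_assoc)
  then show ?thesis by (simp add: E_def FD)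
qed

text \<open>Smooth closed-loop trajectories \<open>g = Kp\<close> satisfy the dual equation at time 0.\<close>

lemma closed_loop_identity:
  "E ** (Aa + Ba ** K) = transpose A ** upper_rows (Ca + Da ** K) - transpose H ** lower_rows (Ca + Da ** K)"
proof -
  define M where "M = Aa + Ba ** K"
  define CK where "CK = Ca + Da ** K"
  have "E *v (M *v x) = transpose A *v (upper_rows CK *v x) - transpose H *v (lower_rows CK *v x)" for x
  proof -
    define p where "p = (\<lambda>t. matrix_flow M t *v x)"
    define g where "g = (\<lambda>t. K *v p t)"
    define q where "q = (\<lambda>t. upper_rows CK *v p t)"
    define u where "u = (\<lambda>t. lower_rows CK *v p t)"
    have dp: "(p has_vector_derivative M *v p t) (at t within S)" for t S
      unfolding p_def by (rule matrix_flow_vector_derivative)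
    have contp: "continuous_on S p" for S
      by (rule continuous_on_vector_derivative[OF dp])
    have hor: "horizon {0..1::real}" by (simp add: horizon_Icc)
    have ACp: "AC {0..1} p" by (rule AC_C1[OF dp linear_continuous_on_compose[OF contp matrix_vector_mul_linear]])
    have "lti_trajectory Aa Ba {0..1} p g"
      unfolding lti_trajectory_def
    proof (intro conjI ACp)
      show "L2_loc {0..1} g"
        unfolding L2_loc_def g_def by (intro allI impI L2_on_continuous linear_continuous_on_compose[OF contp matrix_vector_mul_linear])
      have "M *v p t = Aa *v p t + Ba *v g t" for t
        by (simp add: M_def g_def matrix_vector_mult_add_rdistrib matrix_vector_mul_assoc)
      then show "AE t in lebesgue_on {0..1}. (p has_vector_derivative Aa *v p t + Ba *v g t) (at t within {0..1})"
        using dp by (intro always_eventually allI) metis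
    qed
    moreover have "stack (q t) (u t) = Ca *v p t + Da *v g t" for t
    proof -
      have "Ca *v p t + Da *v g t = CK *v p t"
        by (simp add: CK_def g_def matrix_vector_mult_add_rdistrib matrix_vector_mul_assoc)
      then show ?thesis by (simp add: stack_eq_iff q_def u_def upper_rows_mult_vector lower_rows_mult_vector)
    qed
    ultimately have sol: "dual_solution F A H {0..1} q u"
      using dual_iff[OF hor, of q u] by blast
    have Fq: "transpose F *v q t = E *v p t" for t
    proof -
      have "q t = upper_part (Ca *v p t + Da *v g t)"
        by (simp add: q_def CK_def g_def upper_rows_mult_vector matrix_vector_mult_add_rdistrib matrix_vector_mul_assoc)
      then show ?thesis by (simp only: E_output)
    qed
    have ver: "AC_version {0..1} (\<lambda>t. transpose F *v q t) t = E *v p t" if "t \<in> {0..1}" for t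
      by (rule AC_version_eq[OF hor AC_linear[OF matrix_vector_mul_bounded_linear ACp] _ that]) (simp add: Fq)
    define w where "w = (\<lambda>t. transpose A *v q t - transpose H *v u t)"
    have contw: "continuous_on S w" for S
      unfolding w_def q_def u_def matrix_vector_mul_assoc
      by (intro continuous_on_diff linear_continuous_on_compose[OF contp matrix_vector_mul_linear])
    have Ep: "E *v p t = E *v x + integral {0..t} w" if t: "t \<in> {0..1}" for t
    proof -
      have "(LINT s|lebesgue_on {0..t}. w s) = integral {0..t} w"
        by (rule LINT_eq_integral[OF L2_on_imp_integrable[OF L2_on_continuous[OF contw]] order_refl])
      moreover have "E *v p t = E *v p 0 + (LINT s|lebesgue_on {0..t}. w s)"
        using sol t ver[OF t] ver[of 0] unfolding dual_solution_def w_def by simp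
      ultimately show ?thesis by (simp add: p_def)
    qed
    have "((\<lambda>t. E *v x + integral {0..t} w) has_vector_derivative (0 + w 0)) (at 0 within {0..1})"
      by (rule has_vector_derivative_add[OF has_vector_derivative_const
            integral_has_vector_derivative[OF contw]]) simp
    then have "((\<lambda>t. E *v p t) has_vector_derivative (0 + w 0)) (at 0 within {0..1})"
      by (rule has_vector_derivative_transform[rotated 2]) (simp_all add: Ep)
    moreover have "((\<lambda>t. E *v p t) has_vector_derivative (E *v (M *v p 0))) (at 0 within {0..1})"
      by (rule bounded_linear.has_vector_derivative[OF matrix_vector_mul_bounded_linear dp])
    ultimately have "0 + w 0 = E *v (M *v p 0)"
      by (intro vector_derivative_unique_within_closed_interval[of 0 1 0 "\<lambda>t. E *v p t"]) (auto simp: cbox_interval)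
    then show ?thesis by (simp add: w_def q_def u_def p_def)
  qed
  then have "E ** M = transpose A ** upper_rows CK - transpose H ** lower_rows CK"
    by (simp add: matrix_eq mv_simps flip: matrix_vector_mul_assoc)
  then show ?thesis by (simp add: M_def CK_def)
qed

lemma E_Aa: "E ** Aa = transpose A ** upper_rows Ca - transpose H ** lower_rows Ca"
  using closed_loop_identity[of 0] by simp

lemma E_Ba: "E ** Ba = transpose A ** upper_rows Da - transpose H ** lower_rows Da"
proof -
  have K: "E ** Ba ** K = (transpose A ** upper_rows Da - transpose H ** lower_rows Da) ** K" for K :: "real^'h^'k"
    using closed_loop_identity[of K]
    by (simp add: upper_rows_add lower_rows_add upper_rows_mult lower_rows_mult matrix_add_ldistrib E_Aa
        matrix_mul_assoc matrix_mult_diff_right matrix_mult_diff_left algebra_simps)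
  have "(E ** Ba) *v x = (transpose A ** upper_rows Da - transpose H ** lower_rows Da) *v x" for x
  proof -
    \<comment> \<open>a feedback that produces the input \<open>x\<close> at some state\<close>
    define K :: "real^'h^'k" where "K = (\<chi> i j. x $ i)"
    have "K *v axis undefined 1 = x" by (simp add: matrix_vector_mult_basis K_def column_def vec_eq_iff)
    with arg_cong[OF K[of K], of "\<lambda>M. M *v axis undefined 1"] show ?thesis
      by (simp only: matrix_vector_mul_assoc[symmetric])
  qed
  then show ?thesis by (simp add: matrix_eq)
qed

text \<open>Every exponential solution of the dual equation comes from an exponential state and input.
  This is where it is used that the associated system produces all solutions.\<close>

lemma exponential_solution_representation:
  fixes G :: "real^'a^'a" and Yq :: "real^'a^'m" and Yu :: "real^'a^'p"
  assumes YG: "transpose F ** Yq ** G = transpose A ** Yq - transpose H ** Yu"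
  obtains Z \<Gamma> where "stack_rows Yq Yu = Ca ** Z + Da ** \<Gamma>" "Aa ** Z + Ba ** \<Gamma> = Z ** G"
proof -
  define Y where "Y = stack_rows Yq Yu"
  define Z where "Z = EL ** transpose F ** Yq"
  have "\<exists>\<gamma>. (Y - Ca ** Z) *v c = Da *v \<gamma>" for c
  proof -
    define w where "w = (\<lambda>t. matrix_flow G t *v c)"
    have dw: "(w has_vector_derivative G *v w t) (at t within S)" for t S
      unfolding w_def by (rule matrix_flow_vector_derivative)
    have contw: "continuous_on S w" for S by (rule continuous_on_vector_derivative[OF dw])
    have hor: "horizon {0..1::real}" by (simp add: horizon_Icc)
    define q where "q = (\<lambda>t. Yq *v w t)"
    define u where "u = (\<lambda>t. Yu *v w t)"
    have dFq: "((\<lambda>t. transpose F *v q t) has_vector_derivative (transpose A *v q t - transpose H *v u t)) (at t within S)" for t S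
    proof -
      have "((\<lambda>t. (transpose F ** Yq) *v w t) has_vector_derivative (transpose F ** Yq) *v (G *v w t)) (at t within S)"
        by (rule bounded_linear.has_vector_derivative[OF matrix_vector_mul_bounded_linear dw])
      moreover have "(transpose F ** Yq) *v (G *v w t) = transpose A *v q t - transpose H *v u t"
        unfolding q_def u_def matrix_vector_mul_assoc YG by (simp only: matrix_vector_mult_diff_rdistrib)
      ultimately show ?thesis by (simp only: q_def matrix_vector_mul_assoc)
    qed
    have contq: "continuous_on S q" and contu: "continuous_on S u" for S
      unfolding q_def u_def by (rule linear_continuous_on_compose[OF contw matrix_vector_mul_linear])+
    have contr: "continuous_on S (\<lambda>t. transpose A *v q t - transpose H *v u t)" for S
      by (intro continuous_on_diff linear_continuous_on_compose[OF contq matrix_vector_mul_linear]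
          linear_continuous_on_compose[OF contu matrix_vector_mul_linear])
    have ACF: "AC {0..1} (\<lambda>t. transpose F *v q t)" by (rule AC_C1[OF dFq contr])
    have ver: "AC_version {0..1} (\<lambda>t. transpose F *v q t) t = transpose F *v q t" if "t \<in> {0..1}" for t
      by (rule AC_version_eq[OF hor ACF _ that]) simp
    have "dual_solution F A H {0..1} q u"
      unfolding dual_solution_def
    proof (intro conjI ballI)
      show "L2_loc {0..1} q" "L2_loc {0..1} u"
        unfolding L2_loc_def by (intro allI impI L2_on_continuous contq contu)+
      show "is_AC_class {0..1} (\<lambda>t. transpose F *v q t)"
        unfolding is_AC_class_def using ACF by (intro exI conjI) auto
      fix t :: real assume t: "t \<in> {0..1}"
      have "(LINT s|lebesgue_on {0..t}. transpose A *v q s - transpose H *v u s) = transpose F *v q t - transpose F *v q 0"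
      proof (rule fundamental_theorem_LINT)
        show "abs_cont_on_interval 0 t (\<lambda>t. transpose F *v q t)"
          using ACF t by (simp add: AC_iff_initial[OF hor])
        show "AE s in lebesgue_on {0..t}. ((\<lambda>t. transpose F *v q t) has_vector_derivative
             (transpose A *v q s - transpose H *v u s)) (at s within {0..t})"
          by (intro always_eventually allI dFq)
        show "integrable (lebesgue_on {0..t}) (\<lambda>s. transpose A *v q s - transpose H *v u s)"
          by (rule L2_on_imp_integrable[OF L2_on_continuous[OF contr]])
      qed (use t in auto)
      then show "AC_version {0..1} (\<lambda>t. transpose F *v q t) t =
            AC_version {0..1} (\<lambda>t. transpose F *v q t) 0 +
            (LINT s|lebesgue_on {0..t}. transpose A *v q s - transpose H *v u s)"
        using ver[OF t] ver[of 0] by simp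
    qed
    then obtain p g where pg: "lti_trajectory Aa Ba {0..1} p g"
        "AE t in lebesgue_on {0..1}. stack (q t) (u t) = Ca *v p t + Da *v g t"
      using dual_iff[OF hor] by blast
    have "AE t in lebesgue_on {0..1}. (Y - Ca ** Z) *v w t \<in> range ((*v) Da)"
      using pg(2)
    proof eventually_elim
      case (elim t)
      have "transpose F *v q t = E *v p t"
        using E_output[of "p t" "g t"] by (simp flip: elim)
      then have "EL *v (transpose F *v q t) = p t" by (simp add: matrix_vector_mul_assoc EL_E)
      then have "p t = Z *v w t" by (simp add: Z_def q_def matrix_vector_mul_assoc matrix_mul_assoc)
      moreover have "stack (q t) (u t) = Y *v w t" by (simp add: Y_def q_def u_def stack_mult)
      ultimately have "Y *v w t = Ca *v (Z *v w t) + Da *v g t"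
        using elim by simp
      then have "(Y - Ca ** Z) *v w t = Da *v g t"
        by (simp add: matrix_vector_mult_diff_rdistrib flip: matrix_vector_mul_assoc)
      then show ?case by blast
    qed
    then have "(Y - Ca ** Z) *v w 0 \<in> range ((*v) Da)"
      by (rule AE_closed_imp_everywhere[OF hor linear_continuous_on_compose[OF contw matrix_vector_mul_linear], rotated])
         (auto intro!: closed_subspace linear_subspace_image matrix_vector_mul_linear)
    then show ?thesis by (auto simp: w_def)
  qed
  then obtain \<gamma> where \<gamma>: "\<And>c. (Y - Ca ** Z) *v c = Da *v \<gamma> c" by metis
  define \<Gamma> where "\<Gamma> = (\<chi> i j. \<gamma> (axis j 1) $ i)"
  have col: "column j (Da ** \<Gamma>) = column j (Y - Ca ** Z)" for j
  proof -
    have "\<Gamma> *v axis j 1 = \<gamma> (axis j 1)"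
      by (simp add: matrix_vector_mult_basis \<Gamma>_def column_def vec_eq_iff)
    then have "(Da ** \<Gamma>) *v axis j 1 = (Y - Ca ** Z) *v axis j 1"
      by (simp add: \<gamma> flip: matrix_vector_mul_assoc)
    then show ?thesis by (simp add: matrix_vector_mult_basis)
  qed
  then have "Da ** \<Gamma> = Y - Ca ** Z" by (simp add: vec_eq_iff column_def)
  then have Yeq: "Y = Ca ** Z + Da ** \<Gamma>" by simp
  have Yq: "Yq = upper_rows Ca ** Z + upper_rows Da ** \<Gamma>"
    using arg_cong[OF Yeq, of upper_rows] by (simp add: Y_def upper_rows_add upper_rows_mult)
  have Yu: "Yu = lower_rows Ca ** Z + lower_rows Da ** \<Gamma>"
    using arg_cong[OF Yeq, of lower_rows] by (simp add: Y_def lower_rows_add lower_rows_mult)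
  have FYq: "transpose F ** Yq = E ** Z"
    by (simp add: Yq matrix_add_ldistrib matrix_mul_assoc FD flip: E_def)
  have "E ** (Aa ** Z + Ba ** \<Gamma>) = E ** Aa ** Z + E ** Ba ** \<Gamma>"
    by (simp add: matrix_add_ldistrib matrix_mul_assoc)
  also have "\<dots> = transpose A ** Yq - transpose H ** Yu"
    unfolding E_Aa E_Ba Yq Yu
    by (simp add: matrix_add_ldistrib matrix_mul_assoc matrix_mult_diff_left)
  also have "\<dots> = E ** (Z ** G)" by (simp add: FYq matrix_mul_assoc flip: YG)
  finally have "EL ** (E ** (Aa ** Z + Ba ** \<Gamma>)) = EL ** (E ** (Z ** G))" by simp
  then have "Aa ** Z + Ba ** \<Gamma> = Z ** G" by (simp add: matrix_mul_assoc EL_E)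
  with Yeq show ?thesis unfolding Y_def by (rule that)
qed

text \<open>Detectability provides a state in the stabilizability subspace that represents \<open>F\<^sup>T \<ell>\<close>.\<close>

lemma detectable_initial_state:
  assumes "detectable F A H ell"
  obtains p0 where "p0 \<in> stabilizability_subspace Aa Ba" "E *v p0 = transpose F *v ell"
proof -
  obtain q u where sol: "dual_solution F A H {0..} q u"
    and init: "AC_version {0..} (\<lambda>t. transpose F *v q t) 0 = transpose F *v ell"
    and lim: "(AC_version {0..} (\<lambda>t. transpose F *v q t) \<longlongrightarrow> 0) at_top"
    using assms by (auto simp: detectable_def)
  obtain p g where pg: "lti_trajectory Aa Ba {0..} p g"
      "AE t in lebesgue_on {0..}. stack (q t) (u t) = Ca *v p t + Da *v g t"
    using sol dual_iff[OF horizon_Ici] by blast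
  have "AC {0..} (\<lambda>t. E *v p t)"
    using pg(1) by (auto simp: lti_trajectory_def intro: AC_linear[OF matrix_vector_mul_bounded_linear])
  moreover have "AE t in lebesgue_on {0..}. E *v p t = transpose F *v q t"
    using pg(2)
  proof eventually_elim
    case (elim t)
    show ?case using E_output[of "p t" "g t"] by (simp flip: elim)
  qed
  ultimately have ver: "AC_version {0..} (\<lambda>t. transpose F *v q t) t = E *v p t" if "t \<in> {0..}" for t
    using AC_version_eq[OF horizon_Ici _ _ that, of "\<lambda>t. E *v p t" "\<lambda>t. transpose F *v q t"] by blast
  have "((\<lambda>t. E *v p t) \<longlongrightarrow> 0) at_top"
    by (rule Lim_transform_eventually[OF lim])
      (use eventually_ge_at_top[of "0::real"] in eventually_elim, simp add: ver)
  then have "((\<lambda>t. EL *v (E *v p t)) \<longlongrightarrow> EL *v 0) at_top"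
    by (rule tendsto_matrix_vector_right)
  then have "(p \<longlongrightarrow> 0) at_top" by (simp add: matrix_vector_mul_assoc EL_E)
  then have "p 0 \<in> stabilizability_subspace Aa Ba"
    using pg(1) unfolding stabilizability_subspace_def by blast
  moreover have "E *v p 0 = transpose F *v ell" using ver[of 0] init by simp
  ultimately show ?thesis by (rule that)
qed

end

section \<open>Restriction to the stabilizability subspace\<close>

lemma transpose_zero: "transpose (0 :: real^'a^'b) = 0"
  by (simp add: transpose_def vec_eq_iff)

text \<open>An associated system together with its restriction to the stabilizability subspace. The
  columns of \<open>J\<close> are a basis of the subspace, and \<open>L\<close> reads off coordinates.\<close>

locale reduced_system = associated F A H Aa Ba Ca Da
  for F A :: "real^'n^'m" and H :: "real^'n^'p"
    and Aa :: "real^'h^'h" and Ba :: "real^'k^'h"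
    and Ca :: "real^'h^('m + 'p)" and Da :: "real^'k^('m + 'p)" +
  fixes Ag :: "real^'l^'l" and Bg :: "real^'k^'l" and Cg :: "real^'l^('m + 'p)"
    and J :: "real^'l^'h" and L :: "real^'h^'l"
    and Q0 Q :: "real^'m^'m" and R :: "real^'p^'p"
  assumes LJ: "L ** J = mat 1" and AJ: "Aa ** J = J ** Ag" and BJ: "Ba = J ** Bg"
    and CJ: "Ca ** J = Cg"
    and range_J: "stabilizability_subspace Aa Ba = range ((*v) J)"
    and Q0: "sym_pos_def Q0" and Q: "sym_pos_def Q" and R: "sym_pos_def R"
begin

text \<open>The weight of the dual running cost, and the inverse and the left inverse that turn the reduced
  system into a linear quadratic problem.\<close>

definition S :: "real^('m + 'p)^('m + 'p)" where
  "S = block_diag (matrix_inv Q) (matrix_inv R)"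

definition Wi :: "real^'k^'k" where
  "Wi = (if Da \<noteq> 0 then matrix_inv (transpose Da ** S ** Da) else 0)"

definition N :: "real^('m + 'p)^'l" where
  "N = L ** EL ** transpose F ** upper_rows (mat 1)"

lemma S_spd: "sym_pos_def S"
  unfolding S_def by (intro sym_pos_def_block_diag sym_pos_def_inverse(3) Q R)

lemma Bg_eq: "Bg = L ** Ba"
  by (simp add: BJ matrix_mul_assoc LJ)

lemma Wi_right_inverse:
  assumes "Da \<noteq> 0"
  shows "transpose Da ** S ** Da ** Wi = mat 1"
proof -
  have rank: "rank Da = CARD('k)" using assoc assms by (auto simp: associated_lti_def)
  have "x = 0" if "(transpose Da ** S ** Da) *v x = 0" for x
  proof (rule ccontr)
    assume "x \<noteq> 0"
    then have "Da *v x \<noteq> 0" using rank_full_imp_injective[OF rank] by blast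
    then have "0 < (Da *v x) \<bullet> (S *v (Da *v x))" using S_spd by (simp add: sym_pos_def_def)
    also have "\<dots> = x \<bullet> ((transpose Da ** S ** Da) *v x)"
      using inner_matrix_vector_transpose[of x "transpose Da" "S *v (Da *v x)"]
      by (simp flip: matrix_vector_mul_assoc)
    finally show False using that by simp
  qed
  from matrix_inv_of_injective(1)[OF this] show ?thesis using assms by (simp add: Wi_def)
qed

lemma Da_0_imp_Ba_0: "Da = 0 \<Longrightarrow> Ba = 0"
proof -
  assume "Da = 0"
  moreover have "rank (0 :: real^'k^('m + 'p)) = 0" by (simp add: rank_0)
  ultimately show "Ba = 0" using assoc by (auto simp: associated_lti_def)
qed

sublocale lq: lq_problem Bg Cg Da S Wi N
proof
  show "sym_pos_def S" by (rule S_spd)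
  have "transpose Da ** S ** Da ** Wi = mat 1 \<or> Da = 0 \<and> Bg = 0"
    using Wi_right_inverse Da_0_imp_Ba_0 by (cases "Da = 0") (simp_all add: Bg_eq)
  then show "transpose Da ** S ** Da ** Wi ** transpose Bg = transpose Bg"
    and "transpose Da ** S ** Da ** Wi ** transpose Da = transpose Da"
    by (elim disjE conjE; simp add: transpose_zero)+
  have up: "upper_rows (mat 1) ** M = upper_rows M" for M :: "real^'z^('m + 'p)"
    using upper_rows_mult[of "mat 1" M] by simp
  show "N ** Cg = mat 1"
  proof -
    have "N ** Cg = L ** EL ** (transpose F ** (upper_rows (mat 1) ** Ca)) ** J"
      by (simp add: N_def matrix_mul_assoc flip: CJ)
    also have "\<dots> = L ** EL ** E ** J"
      using upper_rows_mult[of "mat 1" Ca] by (simp add: E_def)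
    also have "\<dots> = mat 1" using EL_E LJ by (simp flip: matrix_mul_assoc)
    finally show ?thesis .
  qed
  show "N ** Da = 0"
  proof -
    have "N ** Da = L ** EL ** (transpose F ** (upper_rows (mat 1) ** Da))"
      by (simp add: N_def matrix_mul_assoc)
    also have "\<dots> = 0" using upper_rows_mult[of "mat 1" Da] FD by simp
    finally show ?thesis .
  qed
qed

lemma are_gain_eq: "are_gain S Bg Cg Da P = lq.gain P"
  by (simp only: are_gain_def lq.gain_def) (simp add: Wi_def)

lemma solves_are_iff:
  assumes "transpose P = P"
  shows "solves_are S Ag Bg Cg Da P \<longleftrightarrow> lq.riccati Ag P"
  using lq.riccati_matrix_equation[OF assms, of Ag] by (simp add: solves_are_def are_gain_eq Let_def)

text \<open>A trajectory that starts in the range of \<open>J\<close> stays there: its distance \<open>p - JLp\<close> satisfies a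
  homogeneous linear equation.\<close>

lemma reduced_trajectory:
  obtains y g where "lti_trajectory Ag Bg {0..} y g" "y 0 = y0" "(y \<longlongrightarrow> 0) at_top"
proof -
  have "J *v y0 \<in> stabilizability_subspace Aa Ba" by (simp add: range_J)
  then obtain p g where pg: "lti_trajectory Aa Ba {0..} p g" "p 0 = J *v y0" "(p \<longlongrightarrow> 0) at_top"
    by (auto simp: stabilizability_subspace_def)
  have ACp: "AC {0..} p" and g: "L2_loc {0..} g"
    and dp: "AE t in lebesgue_on {0..}. (p has_vector_derivative (Aa *v p t + Ba *v g t)) (at t within {0..})"
    using pg(1) by (auto simp: lti_trajectory_def)
  \<comment> \<open>the projection along the range of \<open>J\<close>\<close>
  define X where "X = mat 1 - J ** L"
  define d where "d = (\<lambda>t. X *v p t)"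
  have XJ: "X ** J = 0"
    by (simp add: X_def matrix_mult_diff_left LJ flip: matrix_mul_assoc)
  have XBa: "X *v (Ba *v w) = 0" for w
    by (simp add: BJ matrix_vector_mul_assoc matrix_mul_assoc XJ)
  have XAa: "X *v (Aa *v z) = (X ** Aa) *v (X *v z)" for z
  proof -
    have "X ** Aa ** J = 0"
    proof -
      have "X ** Aa ** J = X ** J ** Ag" by (simp add: AJ flip: matrix_mul_assoc)
      then show ?thesis by (simp add: XJ)
    qed
    moreover have "Y ** X = Y" if "Y ** J = 0" for Y :: "real^'h^'h"
      by (simp add: X_def matrix_mult_diff_right matrix_mul_assoc that)
    ultimately have "(X ** Aa) ** X = X ** Aa" by blast
    then show ?thesis by (simp add: matrix_vector_mul_assoc)
  qed
  have d0: "d t = 0" if "t \<ge> 0" for t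
  proof -
    have "d t = matrix_flow (X ** Aa) t *v d 0"
    proof (rule matrix_flow_unique_AE)
      have "AC {0..} d" unfolding d_def by (rule AC_linear[OF matrix_vector_mul_bounded_linear ACp])
      then show "abs_cont_on_interval 0 t d" using that by (simp add: AC_iff_initial[OF horizon_Ici])
      have "AE s in lebesgue_on {0..t}. (p has_vector_derivative (Aa *v p s + Ba *v g s)) (at s within {0..t})"
        by (rule AE_derivative_subset[OF horizon_Ici dp]) (use that in simp)
      then show "AE s in lebesgue_on {0..t}. (d has_vector_derivative ((X ** Aa) *v d s)) (at s within {0..t})"
      proof eventually_elim
        case (elim s)
        from bounded_linear.has_vector_derivative[OF matrix_vector_mul_bounded_linear elim, of X]
        show ?case by (simp add: d_def matrix_vector_right_distrib XBa XAa)
      qed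
    qed (use that in simp)
    moreover have "d 0 = 0" by (simp add: d_def pg(2) matrix_vector_mul_assoc XJ)
    ultimately show ?thesis by simp
  qed
  define y where "y = (\<lambda>t. L *v p t)"
  have py: "p t = J *v y t" if "t \<ge> 0" for t
    using d0[OF that] by (simp add: d_def X_def y_def mv_simps matrix_vector_mul_assoc)
  have "lti_trajectory Ag Bg {0..} y g"
    unfolding lti_trajectory_def
  proof (intro conjI g)
    show "AC {0..} y" unfolding y_def by (rule AC_linear[OF matrix_vector_mul_bounded_linear ACp])
    have "AE t in lebesgue_on {0..}. t \<in> {0..}" using AE_space[of "lebesgue_on {0..}"] by simp
    with dp show "AE t in lebesgue_on {0..}. (y has_vector_derivative (Ag *v y t + Bg *v g t)) (at t within {0..})"
    proof eventually_elim
      case (elim t)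
      have "L *v (Aa *v p t) = (L ** (Aa ** J)) *v y t"
        using py[of t] elim by (simp add: matrix_vector_mul_assoc matrix_mul_assoc)
      also have "\<dots> = Ag *v y t" by (simp add: AJ matrix_mul_assoc LJ)
      finally have 1: "L *v (Aa *v p t) = Ag *v y t" .
      have 2: "L *v (Ba *v g t) = Bg *v g t" by (simp add: Bg_eq matrix_vector_mul_assoc)
      from bounded_linear.has_vector_derivative[OF matrix_vector_mul_bounded_linear elim(1), of L]
      show ?case by (simp only: y_def[symmetric] matrix_vector_right_distrib 1 2)
    qed
  qed
  moreover have "y 0 = y0" by (simp add: y_def pg(2) matrix_vector_mul_assoc LJ)
  moreover have "(y \<longlongrightarrow> 0) at_top"
    using tendsto_matrix_vector_right[OF pg(3), of L] by (simp add: y_def)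
  ultimately show ?thesis by (rule that)
qed

text \<open>Every state of the reduced system can be steered to 0, so a basis is contracted within finite
  time. No bound on the cost over the infinite horizon is needed.\<close>

lemma riccati_solution_exists: "\<exists>P. sym_pos_def P \<and> lq.riccati Ag P"
proof -
  have "\<forall>i. \<exists>y g. lti_trajectory Ag Bg {0..} y g \<and> y 0 = axis i 1 \<and> (y \<longlongrightarrow> 0) at_top"
    using reduced_trajectory by metis
  then obtain y g where tr: "\<And>i. lti_trajectory Ag Bg {0..} (y i) (g i)"
      and init: "\<And>i. y i 0 = axis i 1" and lim: "\<And>i. (y i \<longlongrightarrow> 0) at_top" by metis
  \<comment> \<open>so small that the values of \<open>P\<close> at the end points add up to at most half of its trace\<close>
  define b where "b = 1 / (2 * real CARD('l) * real CARD('l))"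
  have "b > 0" by (simp add: b_def)
  have "\<forall>\<^sub>F t in at_top. y i t \<bullet> y i t < b" for i
  proof -
    have "((\<lambda>t. y i t \<bullet> y i t) \<longlongrightarrow> 0 \<bullet> (0::real^'l)) at_top"
      by (rule tendsto_inner[OF lim lim])
    then show ?thesis using \<open>b > 0\<close> by (auto dest: order_tendstoD(2))
  qed
  then have "\<forall>\<^sub>F t in at_top. \<forall>i. y i t \<bullet> y i t < b" by (rule eventually_all_finite)
  then have "\<forall>\<^sub>F t in at_top. (\<forall>i. y i t \<bullet> y i t < b) \<and> t \<ge> 0"
    using eventually_ge_at_top by (rule eventually_conj)
  then obtain \<tau> where \<tau>: "\<And>i. y i \<tau> \<bullet> y i \<tau> < b" "\<tau> \<ge> 0" by (auto simp: eventually_at_top_linorder)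
  show ?thesis
  proof (rule lq.riccati_exists_of_contracting_trajectories[OF \<tau>(2), of y g Ag])
    fix i
    have AC: "AC {0..} (y i)" and L2: "L2_loc {0..} (g i)"
      and ae: "AE t in lebesgue_on {0..}. (y i has_vector_derivative (Ag *v y i t + Bg *v g i t)) (at t within {0..})"
      using tr[of i] by (auto simp: lti_trajectory_def)
    show "abs_cont_on_interval 0 \<tau> (y i)" using AC \<tau>(2) by (simp add: AC_iff_initial[OF horizon_Ici])
    show "L2_on {0..\<tau>} (g i)" using L2 \<tau>(2) by (simp add: L2_loc_iff_initial[OF horizon_Ici])
    show "AE t in lebesgue_on {0..\<tau>}. (y i has_vector_derivative (Ag *v y i t + Bg *v g i t)) (at t within {0..\<tau>})"
      by (rule AE_derivative_subset[OF horizon_Ici ae]) (use \<tau>(2) in simp)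
    show "y i 0 = axis i 1" by (rule init)
    show "y i \<tau> \<bullet> y i \<tau> \<le> 1 / (2 * real CARD('l) * real CARD('l))"
      using \<tau>(1)[of i] by (simp add: b_def)
  qed
qed

text \<open>The state \<open>M\<^sub>g F\<^sup>T \<ell>\<close> represents \<open>F\<^sup>T \<ell>\<close>.\<close>

lemma detectable_state:
  assumes "detectable F A H ell"
  shows "E *v (J *v ((L ** EL) *v (transpose F *v ell))) = transpose F *v ell"
proof -
  obtain p0 where p0: "p0 \<in> stabilizability_subspace Aa Ba" "E *v p0 = transpose F *v ell"
    using detectable_initial_state[OF assms] by blast
  then obtain y where y: "p0 = J *v y" by (auto simp: range_J)
  have "EL *v (transpose F *v ell) = p0" by (simp add: matrix_vector_mul_assoc EL_E flip: p0(2))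
  then have "L *v (EL *v (transpose F *v ell)) = L *v (J *v y)" by (simp only: y)
  then have "(L ** EL) *v (transpose F *v ell) = y"
    by (simp only: matrix_vector_mul_assoc matrix_mul_assoc LJ matrix_vector_mul_lid)
  then show ?thesis using p0(2) y by simp
qed

end

text \<open>Adjoints with respect to the Frobenius inner product of matrices.\<close>

lemma inner_matrix_adjoint_left: "(Y :: real^'a^'b) \<bullet> (M ** X) = (transpose M ** Y) \<bullet> X"
proof -
  have "Y \<bullet> (M ** X) = (\<Sum>i\<in>UNIV. \<Sum>j\<in>UNIV. \<Sum>k\<in>UNIV. Y $ i $ j * (M $ i $ k * X $ k $ j))"
    by (simp add: inner_vec_def matrix_matrix_mult_def sum_distrib_left)
  also have "\<dots> = (\<Sum>k\<in>UNIV. \<Sum>j\<in>UNIV. \<Sum>i\<in>UNIV. Y $ i $ j * (M $ i $ k * X $ k $ j))"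
    by (subst sum.swap, subst (2) sum.swap, subst sum.swap) (rule refl)
  also have "\<dots> = (transpose M ** Y) \<bullet> X"
    by (simp add: inner_vec_def matrix_matrix_mult_def transpose_def sum_distrib_left sum_distrib_right ac_simps)
  finally show ?thesis .
qed

lemma inner_transpose: "transpose X \<bullet> transpose Y = X \<bullet> (Y :: real^'a^'b)"
  unfolding inner_vec_def transpose_def by (simp add: inner_vec_def) (rule sum.swap)

lemma inner_matrix_adjoint_right: "(Y :: real^'a^'b) \<bullet> (X ** M) = (Y ** transpose M) \<bullet> X"
proof -
  have "Y \<bullet> (X ** M) = transpose Y \<bullet> (transpose M ** transpose X)"
    by (simp only: inner_transpose flip: matrix_transpose_mul)
  also have "\<dots> = (transpose (transpose M) ** transpose Y) \<bullet> transpose X" by (rule inner_matrix_adjoint_left)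
  also have "\<dots> = transpose (Y ** transpose M) \<bullet> transpose X" by (simp only: matrix_transpose_mul)
  finally show ?thesis by (simp only: inner_transpose)
qed

context associated
begin

text \<open>Existence of exponential solutions of the primal equation. By the Fredholm alternative the
  right-hand side has to be orthogonal to the exponential solutions of the dual equation, and these
  are known.\<close>

lemma primal_exponential_solution:
  fixes Gh :: "real^'h^'h" and Nh :: "real^'h^('m + 'p)"
  assumes Gh: "Gh = - transpose Aa - transpose Ca ** Nh"
    and Bh: "transpose Ba + transpose Da ** Nh = 0"
  obtains X :: "real^'h^'n" where "F ** X ** Gh + A ** X = - upper_rows Nh" "H ** X = lower_rows Nh"
proof -
  define Lop where "Lop = (\<lambda>X :: real^'h^'n. (F ** X ** Gh + A ** X, H ** X))"
  have lin: "linear Lop"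
    by (rule linearI) (simp_all add: Lop_def bounded_bilinear.add_right[OF bounded_bilinear_matrix_matrix_mult]
        bounded_bilinear.add_left[OF bounded_bilinear_matrix_matrix_mult]
        bounded_bilinear.scaleR_right[OF bounded_bilinear_matrix_matrix_mult]
        bounded_bilinear.scaleR_left[OF bounded_bilinear_matrix_matrix_mult] scaleR_add_right)
  have sub: "subspace (range Lop)" by (rule linear_subspace_image[OF lin]) (rule subspace_UNIV)
  let ?b = "(- upper_rows Nh, lower_rows Nh)"
  have orth: "?b \<bullet> (Yq, Yu) = 0" if perp: "\<And>X. Lop X \<bullet> (Yq, Yu) = 0" for Yq :: "real^'h^'m" and Yu :: "real^'h^'p"
  proof -
    define M where "M = transpose F ** Yq ** transpose Gh + transpose A ** Yq + transpose H ** Yu"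
    have "X \<bullet> M = 0" for X
    proof -
      have "Lop X \<bullet> (Yq, Yu) = Yq \<bullet> (F ** X ** Gh) + Yq \<bullet> (A ** X) + Yu \<bullet> (H ** X)"
        by (simp add: Lop_def inner_add_left inner_add_right inner_commute)
      also have "Yq \<bullet> (F ** X ** Gh) = (transpose F ** Yq ** transpose Gh) \<bullet> X"
        by (simp only: inner_matrix_adjoint_right[of Yq "F ** X" Gh] inner_matrix_adjoint_left[of _ F X]
            matrix_mul_assoc)
      also have "Yq \<bullet> (A ** X) = (transpose A ** Yq) \<bullet> X" by (rule inner_matrix_adjoint_left)
      also have "Yu \<bullet> (H ** X) = (transpose H ** Yu) \<bullet> X" by (rule inner_matrix_adjoint_left)
      finally show ?thesis using perp[of X] by (simp add: M_def inner_add_left inner_add_right inner_commute)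
    qed
    then have "M \<bullet> M = 0" by blast
    then have "M = 0" by simp
    have neg1: "transpose H ** (- Yu) = - (transpose H ** Yu)" and
      neg2: "transpose F ** Yq ** (- transpose Gh) = - (transpose F ** Yq ** transpose Gh)"
      by (rule bounded_bilinear.minus_right[OF bounded_bilinear_matrix_matrix_mult])+
    have "transpose F ** Yq ** (- transpose Gh) = transpose A ** Yq - transpose H ** (- Yu)"
    proof -
      have "transpose F ** Yq ** transpose Gh + (transpose A ** Yq + transpose H ** Yu) = 0"
        using \<open>M = 0\<close> by (simp add: M_def add.assoc)
      from minus_unique[OF this] show ?thesis by (simp only: neg1 neg2 diff_minus_eq_add)
    qed
    then obtain Z \<Gamma> where Z: "stack_rows Yq (- Yu) = Ca ** Z + Da ** \<Gamma>"
        "Aa ** Z + Ba ** \<Gamma> = Z ** (- transpose Gh)"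
      by (rule exponential_solution_representation)
    have "- (?b \<bullet> (Yq, Yu)) = stack_rows Yq (- Yu) \<bullet> Nh"
      by (simp add: inner_sum_rows inner_commute)
    also have "\<dots> = Nh \<bullet> (Ca ** Z) + Nh \<bullet> (Da ** \<Gamma>)"
      by (simp add: Z(1) inner_add_right inner_commute[of _ Nh])
    also have "Nh \<bullet> (Ca ** Z) = (transpose Ca ** Nh) \<bullet> Z" by (rule inner_matrix_adjoint_left)
    also have "Nh \<bullet> (Da ** \<Gamma>) = (transpose Da ** Nh) \<bullet> \<Gamma>" by (rule inner_matrix_adjoint_left)
    also have "transpose Da ** Nh = - transpose Ba" using Bh by (simp add: eq_neg_iff_add_eq_0 add.commute)
    also have "transpose Ca ** Nh = - transpose Aa - Gh" by (simp add: Gh)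
    also have "(- transpose Aa - Gh) \<bullet> Z + (- transpose Ba) \<bullet> \<Gamma>
        = - (transpose Aa \<bullet> Z + transpose Ba \<bullet> \<Gamma> + Gh \<bullet> Z)"
      by (simp add: inner_diff_left)
    also have "transpose Aa \<bullet> Z = mat 1 \<bullet> (Aa ** Z)" by (simp add: inner_matrix_adjoint_left)
    also have "transpose Ba \<bullet> \<Gamma> = mat 1 \<bullet> (Ba ** \<Gamma>)" by (simp add: inner_matrix_adjoint_left)
    also have "Gh \<bullet> Z = mat 1 \<bullet> (Z ** transpose Gh)" by (simp add: inner_matrix_adjoint_right)
    also have "mat 1 \<bullet> (Aa ** Z) + mat 1 \<bullet> (Ba ** \<Gamma>) + mat 1 \<bullet> (Z ** transpose Gh)
        = mat 1 \<bullet> (Aa ** Z + Ba ** \<Gamma> + Z ** transpose Gh)" by (simp add: inner_add_right)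
    also have "Aa ** Z + Ba ** \<Gamma> + Z ** transpose Gh = 0"
      unfolding Z(2) by (simp add: bounded_bilinear.minus_right[OF bounded_bilinear_matrix_matrix_mult])
    finally show ?thesis by simp
  qed
  have "?b \<in> orthogonal_comp (orthogonal_comp (range Lop))"
    unfolding orthogonal_comp_def orthogonal_def
  proof (clarify)
    fix Yq Yu assume "\<forall>y\<in>range Lop. y \<bullet> (Yq, Yu) = 0"
    then have "?b \<bullet> (Yq, Yu) = 0" by (intro orth) auto
    then show "(Yq, Yu) \<bullet> ?b = 0" by (simp only: inner_commute)
  qed
  then have "?b \<in> range Lop" by (simp add: orthogonal_comp_self[OF sub])
  then obtain X where "Lop X = ?b" by (metis imageE)
  then show ?thesis by (intro that[of X]) (auto simp: Lop_def)
qed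

end

section \<open>The minimax estimation error\<close>

lemma range_matrix_closed: "closed (range ((*v) (M :: real^'a^'b)))"
  by (intro closed_subspace linear_subspace_image matrix_vector_mul_linear subspace_UNIV)

lemma dae_state_in_range:
  assumes I: "horizon I" and sol: "dae_solution F A H I x f y \<eta>" and "t \<in> I"
  shows "AC_version I (\<lambda>t. F *v x t) t \<in> range ((*v) F)"
proof -
  have cl: "is_AC_class I (\<lambda>t. F *v x t)" using sol by (simp add: dae_solution_def)
  show ?thesis
  proof (rule AE_closed_imp_everywhere[OF I _ range_matrix_closed _ \<open>t \<in> I\<close>])
    show "continuous_on I (AC_version I (\<lambda>t. F *v x t))"
      by (rule AC_imp_continuous_on[OF I AC_version_props(1)[OF cl]])
    show "AE t in lebesgue_on I. AC_version I (\<lambda>t. F *v x t) t \<in> range ((*v) F)"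
      using AC_version_props(2)[OF cl] by eventually_elim auto
  qed
qed

lemma dae_solution_derivative:
  assumes I: "horizon I" and sol: "dae_solution F A H I x f y \<eta>"
  defines "z \<equiv> AC_version I (\<lambda>t. F *v x t)"
  shows "AC I z" "AE t in lebesgue_on I. z t = F *v x t"
    "AE t in lebesgue_on I. (z has_vector_derivative (A *v x t + f t)) (at t within I)"
proof -
  have cl: "is_AC_class I (\<lambda>t. F *v x t)" using sol by (simp add: dae_solution_def)
  show "AC I z" "AE t in lebesgue_on I. z t = F *v x t"
    unfolding z_def by (rule AC_version_props[OF cl])+
  have "L2_loc I (\<lambda>t. A *v x t + f t)"
    unfolding L2_loc_def
  proof (intro allI impI)
    fix a b assume "{a..b} \<subseteq> I"
    then have "L2_on {a..b} x" "L2_on {a..b} f" using sol by (auto simp: dae_solution_def L2_loc_def)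
    then show "L2_on {a..b} (\<lambda>t. A *v x t + f t)" by (intro L2_on_add[OF L2_on_matrix])
  qed
  from indefinite_integral_horizon(2)[OF I this, of "z 0"]
  have "AE t in lebesgue_on I. ((\<lambda>t. z 0 + (LINT s|lebesgue_on {0..t}. A *v x s + f s))
      has_vector_derivative (A *v x t + f t)) (at t within I)" .
  moreover have "AE t in lebesgue_on I. t \<in> I" using AE_space[of "lebesgue_on I"] by simp
  ultimately show "AE t in lebesgue_on I. (z has_vector_derivative (A *v x t + f t)) (at t within I)"
  proof eventually_elim
    case (elim t)
    show ?case
      by (rule has_vector_derivative_transform[OF elim(2) _ elim(1)])
         (use sol in \<open>simp add: dae_solution_def z_def\<close>)
  qed
qed

lemma zero_admissible:
  fixes F A :: "real^'n^'m"
  assumes "t > 0"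
  shows "((\<lambda>_. 0), (\<lambda>_. 0), (\<lambda>_. 0), (\<lambda>_. 0)) \<in> admissible_solutions F A H Q0 Q R {0..t}"
proof -
  have hor: "horizon {0..t}" using assms by (rule horizon_Icc)
  have AC0: "AC {0..t} (\<lambda>_. 0 :: real^'m)" by (simp add: AC_def abs_cont_const)
  have ver: "AC_version {0..t} (\<lambda>s. F *v (0::real^'n)) s = 0" if "s \<in> {0..t}" for s
    by (rule AC_version_eq[OF hor AC0 _ that]) simp
  have "dae_solution F A H {0..t} (\<lambda>_. 0) (\<lambda>_. 0) (\<lambda>_. 0) (\<lambda>_. 0)"
    unfolding dae_solution_def
  proof (intro conjI ballI)
    show "is_AC_class {0..t} (\<lambda>t. F *v 0)"
      unfolding is_AC_class_def using AC0 by (intro exI[of _ "\<lambda>_. 0"]) simp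
  qed (use assms ver in \<open>auto simp: L2_loc_def L2_on_const\<close>)
  then show ?thesis using assms ver[of 0] by (simp add: admissible_solutions_def)
qed

lemma error_at_nonneg:
  assumes "t > 0"
  shows "0 \<le> error_at F A H Q0 Q R U ell t"
proof -
  have "ereal 0 \<le> ereal ((ell \<bullet> AC_version {0..t} (\<lambda>t. F *v 0) t - (LINT s|lebesgue_on {0..t}. 0 \<bullet> U s))\<^sup>2)" by simp
  also have "\<dots> \<le> error_at F A H Q0 Q R U ell t"
    unfolding error_at_def by (rule SUP_upper2[OF zero_admissible[OF assms]]) simp
  finally show ?thesis by (simp add: zero_ereal_def)
qed

lemma asymptotic_error_nonneg: "0 \<le> asymptotic_error F A H Q0 Q R V ell"
proof -
  have "Limsup at_top (\<lambda>_::real. 0::ereal) \<le> asymptotic_error F A H Q0 Q R V ell"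
    unfolding asymptotic_error_def
    by (rule Limsup_mono) (use eventually_gt_at_top[of "0::real"] in \<open>eventually_elim, simp add: error_at_nonneg\<close>)
  then show ?thesis by (simp add: Limsup_const)
qed

lemma error_at_cong:
  assumes "\<And>s. s \<in> {0..t} \<Longrightarrow> U s = U' s"
  shows "error_at F A H Q0 Q R U ell t = error_at F A H Q0 Q R U' ell t"
proof -
  have "(LINT s|lebesgue_on {0..t}. y s \<bullet> U s) = (LINT s|lebesgue_on {0..t}. y s \<bullet> U' s)" for y
    by (rule Bochner_Integration.integral_cong) (use assms in auto)
  then show ?thesis unfolding error_at_def by simp
qed

lemma young_sym_pos_def:
  assumes M: "sym_pos_def M"
  shows "2 * (a \<bullet> b) \<le> a \<bullet> (matrix_inv M *v a) + b \<bullet> (M *v b)"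
proof -
  note inv = sym_pos_def_inverse[OF M]
  have sym: "transpose M = M" using M by (simp add: sym_pos_def_def)
  define c where "c = matrix_inv M *v a"
  have Mc: "M *v c = a" by (simp add: c_def matrix_vector_mul_assoc inv)
  have "0 \<le> (b - c) \<bullet> (M *v (b - c))"
    using M by (cases "b - c = 0") (auto simp: sym_pos_def_def intro: less_imp_le)
  also have "\<dots> = b \<bullet> (M *v b) - 2 * (a \<bullet> b) + a \<bullet> c"
    using symmetric_inner(2)[OF sym, of c b]
    by (simp add: mv_simps inner_diff_left inner_diff_right Mc inner_commute)
  finally show ?thesis by (simp add: c_def)
qed

text \<open>A scalar form of the Cauchy-Schwarz inequality that can be applied after integrating.\<close>

lemma square_le_of_parametric_bound:
  fixes a n :: real
  assumes "n \<ge> 0" and bound: "\<And>r. 2 * r * a \<le> r\<^sup>2 * n + 1"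
  shows "a\<^sup>2 \<le> n"
proof (cases "n = 0")
  case True
  have "2 * a\<^sup>2 * r \<le> 1" for r using bound[of "r * a"] True by (simp add: power2_eq_square ac_simps)
  from this[of "1 / a\<^sup>2"] have "a = 0" by (cases "a = 0") auto
  then show ?thesis using True by simp
next
  case False
  then have "n > 0" using assms by simp
  have "2 * (a / n) * a \<le> (a / n)\<^sup>2 * n + 1" by (rule bound)
  then show ?thesis using \<open>n > 0\<close> by (simp add: field_simps power2_eq_square)
qed

text \<open>A positive definite solution \<open>P\<close> of the Riccati equation and a state \<open>v0\<close> that represents
  \<open>F\<^sup>T \<ell>\<close>.\<close>

locale minimax_problem = reduced_system F A H Aa Ba Ca Da Ag Bg Cg J L Q0 Q R
  for F A :: "real^'n^'m" and H :: "real^'n^'p"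
    and Aa :: "real^'h^'h" and Ba :: "real^'k^'h"
    and Ca :: "real^'h^('m + 'p)" and Da :: "real^'k^('m + 'p)"
    and Ag :: "real^'l^'l" and Bg :: "real^'k^'l" and Cg :: "real^'l^('m + 'p)"
    and J :: "real^'l^'h" and L :: "real^'h^'l"
    and Q0 Q :: "real^'m^'m" and R :: "real^'p^'p" +
  fixes P :: "real^'l^'l" and ell :: "real^'m" and v0 :: "real^'l"
  assumes P: "sym_pos_def P" and riccati: "lq.riccati Ag P"
    and v0: "E *v (J *v v0) = transpose F *v ell"
begin

text \<open>Feedback, closed loop and output of the optimal dual system, and the optimal dual trajectory:
  state \<open>v\<close>, output \<open>(q, u)\<close>.\<close>

definition K :: "real^'l^'k" where "K = lq.gain P"
definition G :: "real^'l^'l" where "G = Ag - Bg ** K"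
definition CK :: "real^'l^('m + 'p)" where "CK = Cg - Da ** K"
definition v :: "real \<Rightarrow> real^'l" where "v t = matrix_flow G t *v v0"
definition q :: "real \<Rightarrow> real^'m" where "q t = upper_rows CK *v v t"
definition u :: "real \<Rightarrow> real^'p" where "u t = lower_rows CK *v v t"

text \<open>The cost to go of the optimal dual trajectory.\<close>

definition W :: "real \<Rightarrow> real" where "W t = v t \<bullet> (P *v v t)"

lemma P_sym: "transpose P = P"
  using P by (simp add: sym_pos_def_def)

lemma stable_G: "stable_matrix G"
  using lq.riccati_stable[OF P riccati] by (simp add: G_def K_def)

lemma v_lim: "(v \<longlongrightarrow> 0) at_top"
  using stable_G unfolding stable_matrix_def v_def by blast

lemma v_0: "v 0 = v0"
  by (simp add: v_def)

lemma v_derivative: "(v has_vector_derivative G *v v t) (at t within T)"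
  unfolding v_def by (rule matrix_flow_vector_derivative)

lemma continuous_v: "continuous_on T v"
  by (rule continuous_on_vector_derivative[OF v_derivative])

lemma continuous_mv: "continuous_on T (\<lambda>s. M *v v (t - s))"
  by (rule linear_continuous_on_compose[OF _ matrix_vector_mul_linear])
     (intro continuous_on_compose2[OF continuous_v[of UNIV]] continuous_intros subset_UNIV)

lemma continuous_q: "continuous_on T (\<lambda>s. q (t - s))"
  and continuous_u: "continuous_on T (\<lambda>s. u (t - s))"
  unfolding q_def u_def by (rule continuous_mv)+

lemma W_nonneg: "0 \<le> W t"
  using P by (cases "v t = 0") (auto simp: W_def sym_pos_def_def intro: less_imp_le)

lemma W_lim: "(W \<longlongrightarrow> 0) at_top"
proof -
  have "(W \<longlongrightarrow> 0 \<bullet> (P *v 0)) at_top"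
    unfolding W_def by (rule tendsto_inner[OF v_lim tendsto_matrix_vector_right[OF v_lim]])
  then show ?thesis by simp
qed

lemma running_cost:
  "(CK *v x) \<bullet> (S *v (CK *v x)) = (upper_rows CK *v x) \<bullet> (matrix_inv Q *v (upper_rows CK *v x))
    + (lower_rows CK *v x) \<bullet> (matrix_inv R *v (lower_rows CK *v x))"
  by (simp add: inner_sum_parts S_def block_diag_mult upper_rows_mult_vector lower_rows_mult_vector)

lemma W_derivative:
  "(W has_real_derivative - (q t \<bullet> (matrix_inv Q *v q t) + u t \<bullet> (matrix_inv R *v u t))) (at t within T)"
proof -
  have "lq.dissipation Ag P (v t) (- (K *v v t)) = 0"
    using riccati by (simp add: lq.riccati_def K_def)
  then have "2 * (v t \<bullet> (P *v (G *v v t))) + lq.cost (v t) (- (K *v v t)) = 0"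
    by (simp add: lq.dissipation_feedback G_def)
  moreover have "lq.cost (v t) (- (K *v v t)) = (CK *v v t) \<bullet> (S *v (CK *v v t))"
    by (simp add: lq.cost_def CK_def mv_simps matrix_vector_mul_assoc)
  ultimately have "2 * (v t \<bullet> (P *v (G *v v t)))
      = - (q t \<bullet> (matrix_inv Q *v q t) + u t \<bullet> (matrix_inv R *v u t))"
    by (simp add: running_cost q_def u_def)
  then show ?thesis
    using quadratic_form_along_flow[OF P_sym, of G v0 t T] by (simp add: W_def[abs_def] v_def)
qed

lemma Cg_rows: "upper_rows Cg = upper_rows Ca ** J" "lower_rows Cg = lower_rows Ca ** J"
  by (simp_all only: CJ[symmetric] upper_rows_mult lower_rows_mult)

lemma F_CK: "transpose F ** upper_rows CK = E ** J"
proof -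
  have "transpose F ** upper_rows CK = transpose F ** upper_rows Ca ** J - transpose F ** upper_rows Da ** K"
    by (simp add: CK_def upper_rows_diff upper_rows_mult Cg_rows matrix_mult_diff_right matrix_mul_assoc)
  then show ?thesis by (simp add: FD E_def)
qed

lemma dual_equation: "E ** J ** G = transpose A ** upper_rows CK - transpose H ** lower_rows CK"
proof -
  have "E ** J ** G = E ** (Aa ** J) - E ** Ba ** K"
    by (simp add: G_def matrix_mult_diff_right AJ BJ matrix_mul_assoc)
  also have "\<dots> = transpose A ** upper_rows CK - transpose H ** lower_rows CK"
    unfolding matrix_mul_assoc E_Aa E_Ba CK_def upper_rows_diff lower_rows_diff upper_rows_mult
      lower_rows_mult Cg_rows matrix_mult_diff_left matrix_mult_diff_right matrix_mul_assoc
    by simp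
  finally show ?thesis .
qed

lemma q_derivative: "((\<lambda>s. q (t - s)) has_vector_derivative - (upper_rows CK *v (G *v v (t - s)))) (at s within T)"
proof -
  have "((\<lambda>s. t - s) has_vector_derivative -1) (at s within T)"
    by (auto intro!: derivative_eq_intros)
  from vector_diff_chain_within[OF this v_derivative]
  have "((\<lambda>s. v (t - s)) has_vector_derivative - (G *v v (t - s))) (at s within T)" by (simp add: o_def)
  from bounded_linear.has_vector_derivative[OF matrix_vector_mul_bounded_linear this]
  show ?thesis by (simp add: q_def matrix_vector_mult_minus_right)
qed

lemma energy_integral:
  assumes "0 \<le> \<tau>"
  shows "integrable (lebesgue_on {0..\<tau>}) (\<lambda>s. q (t - s) \<bullet> (matrix_inv Q *v q (t - s)) + u (t - s) \<bullet> (matrix_inv R *v u (t - s)))"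
    and "(LINT s|lebesgue_on {0..\<tau>}. q (t - s) \<bullet> (matrix_inv Q *v q (t - s)) + u (t - s) \<bullet> (matrix_inv R *v u (t - s)))
      = W (t - \<tau>) - W t"
proof -
  let ?e = "\<lambda>s. q (t - s) \<bullet> (matrix_inv Q *v q (t - s)) + u (t - s) \<bullet> (matrix_inv R *v u (t - s))"
  have cont: "continuous_on T ?e" for T
    by (intro continuous_on_add continuous_on_inner continuous_q continuous_u
        linear_continuous_on_compose[OF continuous_q matrix_vector_mul_linear]
        linear_continuous_on_compose[OF continuous_u matrix_vector_mul_linear])
  show int: "integrable (lebesgue_on {0..\<tau>}) ?e"
    by (rule L2_on_imp_integrable[OF L2_on_continuous[OF cont]])
  have der: "((\<lambda>s. W (t - s)) has_vector_derivative ?e s) (at s within T)" for s T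
  proof -
    have "((\<lambda>s. t - s) has_real_derivative -1) (at s within T)"
      by (auto intro!: derivative_eq_intros)
    from DERIV_chain2[OF W_derivative this]
    show ?thesis unfolding has_real_derivative_iff_has_vector_derivative by (simp add: add.commute)
  qed
  have "(LINT s|lebesgue_on {0..\<tau>}. ?e s) = W (t - \<tau>) - W (t - 0)"
    by (rule fundamental_theorem_LINT[OF assms abs_cont_C1[OF der cont] _ int])
       (intro always_eventually allI der)
  then show "(LINT s|lebesgue_on {0..\<tau>}. ?e s) = W (t - \<tau>) - W t" by simp
qed

lemma energy_nonneg: "0 \<le> q s \<bullet> (matrix_inv Q *v q s) + u s \<bullet> (matrix_inv R *v u s)"
proof -
  have "0 \<le> a \<bullet> (matrix_inv Q *v a)" for a
    using sym_pos_def_inverse(3)[OF Q] by (cases "a = 0") (auto simp: sym_pos_def_def intro: less_imp_le)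
  moreover have "0 \<le> a \<bullet> (matrix_inv R *v a)" for a
    using sym_pos_def_inverse(3)[OF R] by (cases "a = 0") (auto simp: sym_pos_def_def intro: less_imp_le)
  ultimately show ?thesis by (simp add: add_nonneg_nonneg)
qed

lemma W_antimono:
  assumes "0 \<le> \<tau>"
  shows "W t \<le> W (t - \<tau>)"
proof -
  have "0 \<le> (LINT s|lebesgue_on {0..\<tau>}. q (t - s) \<bullet> (matrix_inv Q *v q (t - s)) + u (t - s) \<bullet> (matrix_inv R *v u (t - s)))"
    by (intro Bochner_Integration.integral_nonneg energy_nonneg)
  then show ?thesis by (simp add: energy_integral(2)[OF assms])
qed

text \<open>Duality: the estimation error of the observer is expressed by the initial state and the
  disturbances alone. It is the integrated derivative of \<open>q(t - s)\<^sup>T F x(s)\<close>.\<close>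

lemma error_identity:
  assumes "t > 0" and sol: "dae_solution F A H {0..t} x f y \<eta>"
  defines "z \<equiv> AC_version {0..t} (\<lambda>t. F *v x t)"
  shows "integrable (lebesgue_on {0..t}) (\<lambda>s. q (t - s) \<bullet> f s - u (t - s) \<bullet> \<eta> s)"
    and "ell \<bullet> z t - (LINT s|lebesgue_on {0..t}. y s \<bullet> u (t - s))
      = q t \<bullet> z 0 + (LINT s|lebesgue_on {0..t}. q (t - s) \<bullet> f s - u (t - s) \<bullet> \<eta> s)"
proof -
  have hor: "horizon {0..t}" by (rule horizon_Icc[OF \<open>t > 0\<close>])
  note zz = dae_solution_derivative[OF hor sol, folded z_def]
  have L2: "L2_on {0..t} f" "L2_on {0..t} y" "L2_on {0..t} \<eta>"
    using sol by (auto simp: dae_solution_def L2_loc_def)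
  have L2q: "L2_on {0..t} (\<lambda>s. q (t - s))" and L2u: "L2_on {0..t} (\<lambda>s. u (t - s))"
    by (intro L2_on_continuous continuous_q continuous_u)+
  show int1: "integrable (lebesgue_on {0..t}) (\<lambda>s. q (t - s) \<bullet> f s - u (t - s) \<bullet> \<eta> s)"
    by (intro Bochner_Integration.integrable_diff L2_on_inner_integrable L2 L2q L2u)
  have int2: "integrable (lebesgue_on {0..t}) (\<lambda>s. y s \<bullet> u (t - s))"
    by (intro L2_on_inner_integrable L2 L2u)
  let ?h = "\<lambda>s. (q (t - s) \<bullet> f s - u (t - s) \<bullet> \<eta> s) + y s \<bullet> u (t - s)"
  let ?\<psi> = "\<lambda>s. q (t - s) \<bullet> z s"
  have acz: "abs_cont_on_interval 0 t z" using zz(1) \<open>t > 0\<close> by (auto simp: AC_iff_initial[OF hor])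
  have acq: "abs_cont_on_interval 0 t (\<lambda>s. q (t - s))"
    by (rule abs_cont_C1[OF q_derivative])
       (intro continuous_on_minus, simp only: matrix_vector_mul_assoc, rule continuous_mv)
  have ac\<psi>: "abs_cont_on_interval 0 t ?\<psi>" by (rule abs_cont_bilinear[OF bounded_bilinear_inner acq acz])
  have aey: "AE s in lebesgue_on {0..t}. y s = H *v x s + \<eta> s" using sol by (simp add: dae_solution_def)
  have "AE s in lebesgue_on {0..t}. (?\<psi> has_vector_derivative ?h s) (at s within {0..t})"
    using zz(2) zz(3) aey
  proof eventually_elim
    case (elim s)
    let ?w = "v (t - s)"
    from bounded_bilinear.has_vector_derivative[OF bounded_bilinear_inner q_derivative elim(2)]
    have d: "(?\<psi> has_vector_derivative (q (t - s) \<bullet> (A *v x s + f s) + (- (upper_rows CK *v (G *v ?w))) \<bullet> z s)) (at s within {0..t})" .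
    have "(upper_rows CK *v (G *v ?w)) \<bullet> z s = (transpose F *v (upper_rows CK *v (G *v ?w))) \<bullet> x s"
      by (simp only: elim(1) inner_matrix_vector_transpose)
    also have "transpose F *v (upper_rows CK *v (G *v ?w)) = (E ** J ** G) *v ?w"
      by (simp only: matrix_vector_mul_assoc matrix_mul_assoc F_CK)
    also have "\<dots> = transpose A *v q (t - s) - transpose H *v u (t - s)"
      by (simp only: dual_equation matrix_vector_mult_diff_rdistrib matrix_vector_mul_assoc q_def u_def)
    also have "\<dots> \<bullet> x s = q (t - s) \<bullet> (A *v x s) - u (t - s) \<bullet> (H *v x s)"
      by (simp only: inner_diff_left inner_matrix_vector_transpose)
    finally have e: "(upper_rows CK *v (G *v ?w)) \<bullet> z s = q (t - s) \<bullet> (A *v x s) - u (t - s) \<bullet> (H *v x s)" .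
    have "q (t - s) \<bullet> (A *v x s + f s) + (- (upper_rows CK *v (G *v ?w))) \<bullet> z s = ?h s"
      unfolding inner_minus_left e elim(3)
      by (simp add: inner_add_right inner_add_left inner_commute[of _ "u (t - s)"])
    with d show ?case by simp
  qed
  from fundamental_theorem_LINT[OF _ ac\<psi> this] int1 int2 \<open>t > 0\<close>
  have "(LINT s|lebesgue_on {0..t}. ?h s) = q 0 \<bullet> z t - q t \<bullet> z 0"
    by simp
  moreover have "(LINT s|lebesgue_on {0..t}. ?h s)
      = (LINT s|lebesgue_on {0..t}. q (t - s) \<bullet> f s - u (t - s) \<bullet> \<eta> s) + (LINT s|lebesgue_on {0..t}. y s \<bullet> u (t - s))"
    by (rule Bochner_Integration.integral_add[OF int1 int2])
  moreover have "q 0 \<bullet> z t = ell \<bullet> z t"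
  proof -
    have "z t \<in> range ((*v) F)"
      unfolding z_def by (rule dae_state_in_range[OF hor sol]) (use \<open>t > 0\<close> in simp)
    then obtain \<zeta> where \<zeta>: "z t = F *v \<zeta>" by blast
    have "transpose F *v q 0 = transpose F *v ell"
      by (simp only: q_def v_0 matrix_vector_mul_assoc F_CK) (simp only: matrix_vector_mul_assoc[symmetric] v0)
    then show ?thesis by (simp only: \<zeta> inner_matrix_vector_transpose)
  qed
  ultimately show "ell \<bullet> z t - (LINT s|lebesgue_on {0..t}. y s \<bullet> u (t - s))
      = q t \<bullet> z 0 + (LINT s|lebesgue_on {0..t}. q (t - s) \<bullet> f s - u (t - s) \<bullet> \<eta> s)"
    by linarith
qed

text \<open>Weak duality: Young's inequality is applied pointwise to the error identity, with a free
  scaling \<open>r\<close>.\<close>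

lemma error_upper_bound:
  assumes "t > 0"
  shows "error_at F A H Q0 Q R (\<lambda>s. u (t - s)) ell t \<le> ereal (q t \<bullet> (matrix_inv Q0 *v q t) + (W 0 - W t))"
  unfolding error_at_def
proof (rule SUP_least, clarify)
  fix x f y \<eta> assume adm: "(x, f, y, \<eta>) \<in> admissible_solutions F A H Q0 Q R {0..t}"
  define z where "z = AC_version {0..t} (\<lambda>t. F *v x t)"
  have sol: "dae_solution F A H {0..t} x f y \<eta>" using adm by (simp add: admissible_solutions_def)
  have cost: "z 0 \<bullet> (Q0 *v z 0) + (LINT s|lebesgue_on {0..t}. f s \<bullet> (Q *v f s) + \<eta> s \<bullet> (R *v \<eta> s)) \<le> 1"
    using adm \<open>t > 0\<close> by (simp add: admissible_solutions_def z_def Let_def)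
  have L2: "L2_on {0..t} f" "L2_on {0..t} \<eta>"
    using sol by (auto simp: dae_solution_def L2_loc_def)
  have intc: "integrable (lebesgue_on {0..t}) (\<lambda>s. f s \<bullet> (Q *v f s) + \<eta> s \<bullet> (R *v \<eta> s))"
    by (intro Bochner_Integration.integrable_add L2_on_inner_integrable L2_on_matrix L2)
  let ?N = "q t \<bullet> (matrix_inv Q0 *v q t) + (W 0 - W t)"
  let ?a = "ell \<bullet> z t - (LINT s|lebesgue_on {0..t}. y s \<bullet> u (t - s))"
  let ?e = "\<lambda>s. q (t - s) \<bullet> (matrix_inv Q *v q (t - s)) + u (t - s) \<bullet> (matrix_inv R *v u (t - s))"
  note id = error_identity[OF \<open>t > 0\<close> sol, folded z_def]
  have en: "integrable (lebesgue_on {0..t}) ?e" "(LINT s|lebesgue_on {0..t}. ?e s) = W 0 - W t"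
    using energy_integral[of t t] \<open>t > 0\<close> by auto
  have "?a\<^sup>2 \<le> ?N"
  proof (rule square_le_of_parametric_bound)
    have "0 \<le> q t \<bullet> (matrix_inv Q0 *v q t)"
      using sym_pos_def_inverse(3)[OF Q0] by (cases "q t = 0") (auto simp: sym_pos_def_def intro: less_imp_le)
    moreover have "W t \<le> W 0" using W_antimono[of t t] \<open>t > 0\<close> by simp
    ultimately show "0 \<le> ?N" by simp
    fix r :: real
    have point: "2 * r * (q (t - s) \<bullet> f s - u (t - s) \<bullet> \<eta> s) \<le> r\<^sup>2 * ?e s + (f s \<bullet> (Q *v f s) + \<eta> s \<bullet> (R *v \<eta> s))" for s
      using young_sym_pos_def[OF Q, of "r *\<^sub>R q (t - s)" "f s"] young_sym_pos_def[OF R, of "- r *\<^sub>R u (t - s)" "\<eta> s"]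
      by (simp add: matrix_vector_mult_scaleR mv_simps power2_eq_square algebra_simps)
    have "2 * r * (LINT s|lebesgue_on {0..t}. q (t - s) \<bullet> f s - u (t - s) \<bullet> \<eta> s)
        = (LINT s|lebesgue_on {0..t}. 2 * r * (q (t - s) \<bullet> f s - u (t - s) \<bullet> \<eta> s))"
      by (rule integral_mult_right_zero[symmetric])
    also have "\<dots> \<le> (LINT s|lebesgue_on {0..t}. r\<^sup>2 * ?e s + (f s \<bullet> (Q *v f s) + \<eta> s \<bullet> (R *v \<eta> s)))"
      by (rule integral_mono[OF integrable_mult_right[OF id(1)]
            Bochner_Integration.integrable_add[OF integrable_mult_right[OF en(1)] intc] point])
    also have "\<dots> = (LINT s|lebesgue_on {0..t}. r\<^sup>2 * ?e s) + (LINT s|lebesgue_on {0..t}. f s \<bullet> (Q *v f s) + \<eta> s \<bullet> (R *v \<eta> s))"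
      by (rule Bochner_Integration.integral_add[OF integrable_mult_right[OF en(1)] intc])
    also have "(LINT s|lebesgue_on {0..t}. r\<^sup>2 * ?e s) = r\<^sup>2 * (W 0 - W t)"
      using en(2) by (subst integral_mult_right_zero) simp
    finally have 1: "2 * r * (LINT s|lebesgue_on {0..t}. q (t - s) \<bullet> f s - u (t - s) \<bullet> \<eta> s)
      \<le> r\<^sup>2 * (W 0 - W t) + (LINT s|lebesgue_on {0..t}. f s \<bullet> (Q *v f s) + \<eta> s \<bullet> (R *v \<eta> s))" .
    have 2: "2 * r * (q t \<bullet> z 0) \<le> r\<^sup>2 * (q t \<bullet> (matrix_inv Q0 *v q t)) + z 0 \<bullet> (Q0 *v z 0)"
      using young_sym_pos_def[OF Q0, of "r *\<^sub>R q t" "z 0"]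
      by (simp add: matrix_vector_mult_scaleR power2_eq_square algebra_simps)
    show "2 * r * ?a \<le> r\<^sup>2 * ?N + 1"
      unfolding id(2) distrib_left using 1 2 cost by (simp add: algebra_simps)
  qed
  then show "ereal ((ell \<bullet> AC_version {0..t} (\<lambda>t. F *v x t) t - (LINT s|lebesgue_on {0..t}. y s \<bullet> u (t - s)))\<^sup>2) \<le> ereal ?N"
    by (simp add: z_def)
qed

end

context minimax_problem
begin

lemma gain_matrix_eq: "transpose Da ** S ** Da ** K = transpose Bg ** P + transpose Da ** S ** Cg"
proof -
  have "(transpose Da ** S ** Da ** K) *v x = (transpose Bg ** P + transpose Da ** S ** Cg) *v x" for x
    using lq.gain_eq[of P x]
    by (simp add: K_def matrix_vector_mult_add_rdistrib flip: matrix_vector_mul_assoc)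
  then show ?thesis by (simp add: matrix_eq)
qed

text \<open>The Riccati equation for \<open>P\<close> says that \<open>P v\<close> is a costate of \<open>v\<close>.\<close>

lemma costate_equation: "P ** G + transpose Ag ** P + transpose Cg ** S ** CK = 0"
proof -
  have eq: "0 = P ** Ag + transpose Ag ** P - transpose K ** (transpose Da ** S ** Da) ** K + transpose Cg ** S ** Cg"
    using lq.riccati_matrix_equation[OF P_sym, of Ag] riccati by (simp add: K_def)
  have "transpose K ** (transpose Da ** S ** Da) = transpose (transpose Da ** S ** Da ** K)"
    by (simp add: matrix_transpose_mul lq.S_sym matrix_mul_assoc)
  also have "\<dots> = P ** Bg + transpose Cg ** S ** Da"
    by (simp add: gain_matrix_eq transpose_add matrix_transpose_mul lq.S_sym P_sym matrix_mul_assoc)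
  finally have KW: "transpose K ** (transpose Da ** S ** Da) = P ** Bg + transpose Cg ** S ** Da" .
  have expand: "P ** G + transpose Ag ** P + transpose Cg ** S ** CK
    = P ** Ag + transpose Ag ** P - (P ** Bg + transpose Cg ** S ** Da) ** K + transpose Cg ** S ** Cg"
    by (simp add: G_def CK_def matrix_mult_diff_right matrix_mul_assoc matrix_mult_add_left)
  show ?thesis unfolding expand using eq[unfolded KW] by (rule sym)
qed

lemma upper_rows_S: "upper_rows (S ** Y) = matrix_inv Q ** upper_rows Y"
  and lower_rows_S: "lower_rows (S ** Y) = matrix_inv R ** lower_rows Y"
proof -
  have "upper_rows (S ** Y) *v x = (matrix_inv Q ** upper_rows Y) *v x" for x
    by (simp add: upper_rows_mult_vector S_def block_diag_mult flip: matrix_vector_mul_assoc)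
  then show "upper_rows (S ** Y) = matrix_inv Q ** upper_rows Y" by (simp add: matrix_eq)
  have "lower_rows (S ** Y) *v x = (matrix_inv R ** lower_rows Y) *v x" for x
    by (simp add: lower_rows_mult_vector S_def block_diag_mult flip: matrix_vector_mul_assoc)
  then show "lower_rows (S ** Y) = matrix_inv R ** lower_rows Y" by (simp add: matrix_eq)
qed

text \<open>The worst case for the observation \<open>y = 0\<close>. The primal state is driven, backwards in time, by
  the costate of the optimal dual trajectory in the coordinates of the whole associated system. The
  components of the costate outside the stabilizability subspace are fixed by a terminal condition
  that is linear in \<open>v(t)\<close>, so that the initial value \<open>F x(0)\<close> of the worst case fades with \<open>t\<close>.\<close>

lemma worst_case:
  obtains Y0 :: "real^'l^'m" where
    "\<And>t V r. \<lbrakk>t > 0; r\<^sup>2 * ((Y0 *v v t) \<bullet> (Q0 *v (Y0 *v v t)) + (W 0 - W t)) \<le> 1\<rbrakk> \<Longrightarrow>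
      ereal ((r * (q t \<bullet> (Y0 *v v t) + (W 0 - W t)))\<^sup>2) \<le> error_at F A H Q0 Q R V ell t"
proof -
  \<comment> \<open>\<open>M\<close> recovers \<open>v\<close> from a full costate, whose dynamics in the time of the dual system is \<open>Gh\<close>\<close>
  define M where "M = matrix_inv P ** transpose J"
  define Nh where "Nh = S ** CK ** M"
  define Gh where "Gh = - transpose Aa - transpose Ca ** Nh"
  note Pinv = sym_pos_def_inverse[OF P]
  have PM: "P ** M = transpose J" by (simp add: M_def matrix_mul_assoc Pinv)
  have JA: "transpose J ** transpose Aa = transpose Ag ** transpose J"
    by (simp add: AJ flip: matrix_transpose_mul)
  have JC: "transpose J ** transpose Ca = transpose Cg"
    by (simp add: CJ flip: matrix_transpose_mul)
  have Bh: "transpose Ba + transpose Da ** Nh = 0"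
  proof -
    have "transpose Ba = transpose Bg ** (P ** M)" by (simp add: BJ matrix_transpose_mul PM)
    then have "transpose Ba + transpose Da ** Nh = (transpose Bg ** P + transpose Da ** S ** CK) ** M"
      by (simp add: Nh_def matrix_mult_add_left matrix_mul_assoc)
    also have "transpose Bg ** P + transpose Da ** S ** CK
        = transpose Bg ** P + transpose Da ** S ** Cg - transpose Da ** S ** Da ** K"
      by (simp add: CK_def matrix_mult_diff_right matrix_mul_assoc)
    also have "\<dots> = 0" by (simp add: gain_matrix_eq)
    finally show ?thesis by simp
  qed
  have MG: "M ** Gh = G ** M"
  proof -
    have "transpose J ** Gh = - (transpose J ** transpose Aa) - transpose J ** transpose Ca ** Nh"
      by (simp add: Gh_def matrix_mult_diff_right matrix_mul_assoc
          bounded_bilinear.minus_right[OF bounded_bilinear_matrix_matrix_mult])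
    also have "\<dots> = - (transpose Ag ** (P ** M)) - transpose Cg ** Nh" by (simp only: JA JC PM)
    also have "\<dots> = - ((transpose Ag ** P + transpose Cg ** S ** CK) ** M)"
      by (simp add: Nh_def matrix_mult_add_left matrix_mul_assoc)
    also have "transpose Ag ** P + transpose Cg ** S ** CK = - (P ** G)"
      using minus_unique[of "P ** G" "transpose Ag ** P + transpose Cg ** S ** CK"] costate_equation
      by (simp add: add.assoc)
    also have "- ((- (P ** G)) ** M) = P ** (G ** M)"
      by (simp add: bounded_bilinear.minus_left[OF bounded_bilinear_matrix_matrix_mult] matrix_mul_assoc)
    finally have "matrix_inv P ** (transpose J ** Gh) = matrix_inv P ** (P ** (G ** M))" by simp
    then show ?thesis by (simp add: matrix_mul_assoc Pinv M_def)
  qed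
  obtain X where X: "F ** X ** Gh + A ** X = - upper_rows Nh" "H ** X = lower_rows Nh"
    using primal_exponential_solution[OF Gh_def Bh] by blast
  define Y0 where "Y0 = F ** X ** transpose L ** P"
  show ?thesis
  proof (rule that)
    fix t r :: real and V assume "t > 0"
      and r: "r\<^sup>2 * ((Y0 *v v t) \<bullet> (Q0 *v (Y0 *v v t)) + (W 0 - W t)) \<le> 1"
    have hor: "horizon {0..t}" by (rule horizon_Icc[OF \<open>t > 0\<close>])
    \<comment> \<open>\<open>J\<^sup>T lam\<close> has to agree with \<open>P v\<close>; the other components of \<open>lam\<close> are free at time 0\<close>
    define l0 where "l0 = transpose L *v (P *v v t)"
    define lam where "lam = (\<lambda>s. matrix_flow Gh (0 - s) *v l0)"
    have dlam: "(lam has_vector_derivative - (Gh *v lam s)) (at s within T)" for s T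
      using bounded_linear.has_vector_derivative[OF
          bounded_bilinear.bounded_linear_left[OF bounded_bilinear_matrix_vector_mult]
          matrix_flow_reverse_derivative[of Gh 0 s T], of l0]
      by (simp add: lam_def matrix_vector_mult_minus_left matrix_vector_mul_assoc)
    have contlam: "continuous_on T lam" for T by (rule continuous_on_vector_derivative[OF dlam])
    have Mlam: "M *v lam s = v (t - s)" for s
    proof -
      have "transpose J *v (transpose L *v y) = y" for y
        by (simp add: matrix_vector_mul_assoc LJ transpose_mat flip: matrix_transpose_mul)
      then have "M *v l0 = matrix_inv P *v (P *v v t)"
        by (simp only: M_def l0_def matrix_vector_mul_assoc[symmetric])
      then have "M *v l0 = v t" by (simp add: matrix_vector_mul_assoc Pinv)
      then have "M *v lam s = matrix_flow G (0 - s) *v v t"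
        using matrix_flow_intertwine[OF MG, of "0 - s"]
        by (simp add: lam_def matrix_vector_mul_assoc) (simp flip: matrix_vector_mul_assoc)
      also have "\<dots> = v (t - s)"
        using matrix_flow_add[of G "0 - s" t] by (simp add: v_def matrix_vector_mul_assoc)
      finally show ?thesis .
    qed
    have upN: "upper_rows Nh *v lam s = matrix_inv Q *v q (t - s)" for s
    proof -
      have "upper_rows Nh = matrix_inv Q ** upper_rows (CK ** M)"
        by (simp only: Nh_def matrix_mul_assoc[symmetric] upper_rows_S)
      then show ?thesis
        by (simp only: upper_rows_mult matrix_vector_mul_assoc[symmetric] Mlam q_def)
    qed
    have loN: "lower_rows Nh *v lam s = matrix_inv R *v u (t - s)" for s
    proof -
      have "lower_rows Nh = matrix_inv R ** lower_rows (CK ** M)"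
        by (simp only: Nh_def matrix_mul_assoc[symmetric] lower_rows_S)
      then show ?thesis
        by (simp only: lower_rows_mult matrix_vector_mul_assoc[symmetric] Mlam u_def)
    qed
    define x where "x = (\<lambda>s. r *\<^sub>R (X *v lam s))"
    define f where "f = (\<lambda>s. r *\<^sub>R (matrix_inv Q *v q (t - s)))"
    define \<eta> where "\<eta> = (\<lambda>s. - (r *\<^sub>R (matrix_inv R *v u (t - s))))"
    have contx: "continuous_on T x" for T
      unfolding x_def
      by (intro continuous_on_scaleR continuous_on_const linear_continuous_on_compose[OF contlam matrix_vector_mul_linear])
    have contf: "continuous_on T f" for T
      unfolding f_def
      by (intro continuous_on_scaleR continuous_on_const linear_continuous_on_compose[OF continuous_q matrix_vector_mul_linear])
    have conte: "continuous_on T \<eta>" for T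
      unfolding \<eta>_def
      by (intro continuous_on_minus continuous_on_scaleR continuous_on_const
          linear_continuous_on_compose[OF continuous_u matrix_vector_mul_linear])
    have dz: "((\<lambda>s. F *v x s) has_vector_derivative (A *v x s + f s)) (at s within T)" for s T
    proof -
      have "((\<lambda>s. r *\<^sub>R ((F ** X) *v lam s)) has_vector_derivative r *\<^sub>R ((F ** X) *v (- (Gh *v lam s)))) (at s within T)"
        by (rule bounded_linear.has_vector_derivative[OF bounded_linear_scaleR_right
              bounded_linear.has_vector_derivative[OF matrix_vector_mul_bounded_linear dlam]])
      moreover have "(F ** X) *v (- (Gh *v lam s)) = A *v (X *v lam s) + upper_rows Nh *v lam s"
      proof -
        have "(F ** X ** Gh + A ** X) *v lam s = - (upper_rows Nh *v lam s)"
          by (simp only: X(1) matrix_vector_mult_minus_left)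
        then have "(F ** X ** Gh) *v lam s + ((A ** X) *v lam s + upper_rows Nh *v lam s) = 0"
          by (simp add: matrix_vector_mult_add_rdistrib add.assoc[symmetric])
        from minus_unique[OF this] show ?thesis
          by (simp only: matrix_vector_mult_minus_right matrix_vector_mul_assoc)
      qed
      ultimately show ?thesis
        by (simp add: x_def f_def upN matrix_vector_mult_scaleR scaleR_add_right matrix_vector_mul_assoc)
    qed
    have contr: "continuous_on T (\<lambda>s. A *v x s + f s)" for T
      by (intro continuous_on_add contf linear_continuous_on_compose[OF contx matrix_vector_mul_linear])
    have ACz: "AC {0..t} (\<lambda>s. F *v x s)" by (rule AC_C1[OF dz contr])
    have ver: "AC_version {0..t} (\<lambda>s. F *v x s) s = F *v x s" if "s \<in> {0..t}" for s
      by (rule AC_version_eq[OF hor ACz _ that]) simp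
    have Hx: "H *v x s + \<eta> s = 0" for s
      using arg_cong[OF X(2), of "\<lambda>N. N *v lam s"]
      by (simp add: x_def \<eta>_def loN matrix_vector_mult_scaleR matrix_vector_mul_assoc)
    have sol: "dae_solution F A H {0..t} x f (\<lambda>_. 0) \<eta>"
      unfolding dae_solution_def
    proof (intro conjI ballI)
      show "L2_loc {0..t} x" "L2_loc {0..t} f" "L2_loc {0..t} \<eta>"
        unfolding L2_loc_def by (intro allI impI L2_on_continuous contx contf conte)+
      show "L2_loc {0..t} (\<lambda>_. 0 :: real^'p)" unfolding L2_loc_def by (intro allI impI L2_on_const)
      show "is_AC_class {0..t} (\<lambda>s. F *v x s)"
        unfolding is_AC_class_def using ACz by (intro exI conjI) auto
      show "AE s in lebesgue_on {0..t}. 0 = H *v x s + \<eta> s" by (simp add: Hx)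
      fix \<tau> assume \<tau>: "\<tau> \<in> {0..t}"
      have "(LINT s|lebesgue_on {0..\<tau>}. A *v x s + f s) = F *v x \<tau> - F *v x 0"
        by (rule fundamental_theorem_LINT[OF _ abs_cont_C1[OF dz contr] always_eventually
              L2_on_imp_integrable[OF L2_on_continuous[OF contr]]])
           (use \<tau> dz in auto)
      then show "AC_version {0..t} (\<lambda>s. F *v x s) \<tau> = AC_version {0..t} (\<lambda>s. F *v x s) 0
          + (LINT s|lebesgue_on {0..\<tau>}. A *v x s + f s)"
        using ver[OF \<tau>] ver[of 0] \<open>t > 0\<close> by simp
    qed
    have x0: "F *v x 0 = r *\<^sub>R (Y0 *v v t)"
      by (simp add: x_def lam_def l0_def Y0_def matrix_vector_mult_scaleR matrix_vector_mul_assoc matrix_mul_assoc)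
    let ?e = "\<lambda>s. q (t - s) \<bullet> (matrix_inv Q *v q (t - s)) + u (t - s) \<bullet> (matrix_inv R *v u (t - s))"
    have QQ: "Q *v (matrix_inv Q *v a) = a" for a
      using sym_pos_def_inverse(1)[OF Q] by (simp add: matrix_vector_mul_assoc)
    have RR: "R *v (matrix_inv R *v a) = a" for a
      using sym_pos_def_inverse(1)[OF R] by (simp add: matrix_vector_mul_assoc)
    have fe: "f s \<bullet> (Q *v f s) + \<eta> s \<bullet> (R *v \<eta> s) = r\<^sup>2 * ?e s" for s
      by (simp add: f_def \<eta>_def matrix_vector_mult_scaleR matrix_vector_mult_minus_right QQ RR
          inner_commute power2_eq_square algebra_simps)
    have "(x, f, (\<lambda>_. 0), \<eta>) \<in> admissible_solutions F A H Q0 Q R {0..t}"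
      unfolding admissible_solutions_def
    proof (clarsimp simp: sol Let_def simp del: atLeastAtMost_iff)
      fix \<tau> assume \<tau>: "\<tau> \<in> {0..t}"
      have "(LINT s|lebesgue_on {0..\<tau>}. f s \<bullet> (Q *v f s) + \<eta> s \<bullet> (R *v \<eta> s)) = r\<^sup>2 * (W (t - \<tau>) - W t)"
        unfolding fe using energy_integral(2)[of \<tau> t] \<tau> by (subst integral_mult_right_zero) simp
      also have "\<dots> \<le> r\<^sup>2 * (W 0 - W t)"
        using W_antimono[of "t - \<tau>" "t - \<tau>"] \<tau> by (intro mult_left_mono) auto
      finally show "AC_version {0..t} (\<lambda>s. F *v x s) 0 \<bullet> (Q0 *v AC_version {0..t} (\<lambda>s. F *v x s) 0)
          + (LINT s|lebesgue_on {0..\<tau>}. f s \<bullet> (Q *v f s) + \<eta> s \<bullet> (R *v \<eta> s)) \<le> 1"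
        using r ver[of 0] \<open>t > 0\<close>
        by (simp add: x0 matrix_vector_mult_scaleR power2_eq_square algebra_simps)
    qed
    then have "ereal ((ell \<bullet> AC_version {0..t} (\<lambda>s. F *v x s) t - (LINT s|lebesgue_on {0..t}. 0 \<bullet> V s))\<^sup>2)
        \<le> error_at F A H Q0 Q R V ell t"
      unfolding error_at_def by (rule SUP_upper2) simp
    moreover have "ell \<bullet> AC_version {0..t} (\<lambda>s. F *v x s) t = r * (q t \<bullet> (Y0 *v v t) + (W 0 - W t))"
    proof -
      have "q (t - s) \<bullet> f s - u (t - s) \<bullet> \<eta> s = r * ?e s" for s
        by (simp add: f_def \<eta>_def algebra_simps)
      then have "(LINT s|lebesgue_on {0..t}. q (t - s) \<bullet> f s - u (t - s) \<bullet> \<eta> s) = r * (W 0 - W t)"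
        using energy_integral(2)[of t t] \<open>t > 0\<close> by simp
      then show ?thesis
        using error_identity(2)[OF \<open>t > 0\<close> sol] ver[of 0] \<open>t > 0\<close> by (simp add: x0 algebra_simps)
    qed
    ultimately show "ereal ((r * (q t \<bullet> (Y0 *v v t) + (W 0 - W t)))\<^sup>2) \<le> error_at F A H Q0 Q R V ell t"
      by simp
  qed
qed

lemma q_lim: "(q \<longlongrightarrow> 0) at_top"
  using tendsto_matrix_vector_right[OF v_lim, of "upper_rows CK"] by (simp add: q_def[abs_def])

text \<open>The worst case does not depend on the observer, since its observation vanishes. It is scaled to
  cost 1.\<close>

lemma asymptotic_error_lower: "ereal (W 0) \<le> asymptotic_error F A H Q0 Q R V ell"
proof (cases "W 0 = 0")
  case True
  then show ?thesis using asymptotic_error_nonneg by (simp add: zero_ereal_def)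
next
  case False
  then have "W 0 > 0" using W_nonneg[of 0] by simp
  obtain Y0 :: "real^'l^'m" where Y0: "\<And>t V r. \<lbrakk>t > 0; r\<^sup>2 * ((Y0 *v v t) \<bullet> (Q0 *v (Y0 *v v t)) + (W 0 - W t)) \<le> 1\<rbrakk> \<Longrightarrow>
      ereal ((r * (q t \<bullet> (Y0 *v v t) + (W 0 - W t)))\<^sup>2) \<le> error_at F A H Q0 Q R V ell t"
    using worst_case by blast
  define n where "n = (\<lambda>t. (Y0 *v v t) \<bullet> (Q0 *v (Y0 *v v t)) + (W 0 - W t))"
  define a where "a = (\<lambda>t. q t \<bullet> (Y0 *v v t) + (W 0 - W t))"
  have z: "((\<lambda>t. Y0 *v v t) \<longlongrightarrow> Y0 *v 0) at_top" by (rule tendsto_matrix_vector_right[OF v_lim])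
  have "(n \<longlongrightarrow> (Y0 *v 0) \<bullet> (Q0 *v (Y0 *v 0)) + (W 0 - 0)) at_top"
    unfolding n_def
    by (intro tendsto_add tendsto_diff tendsto_const W_lim tendsto_inner[OF z tendsto_matrix_vector_right[OF z]])
  then have nlim: "(n \<longlongrightarrow> W 0) at_top" by simp
  have "(a \<longlongrightarrow> 0 \<bullet> (Y0 *v 0) + (W 0 - 0)) at_top"
    unfolding a_def
    by (intro tendsto_add tendsto_diff tendsto_const W_lim tendsto_inner[OF q_lim z])
  then have alim: "(a \<longlongrightarrow> W 0) at_top" by simp
  have "((\<lambda>t. (a t)\<^sup>2 / n t) \<longlongrightarrow> (W 0)\<^sup>2 / W 0) at_top"
    by (intro tendsto_divide tendsto_power alim nlim False)
  then have lim: "((\<lambda>t. ereal ((a t)\<^sup>2 / n t)) \<longlongrightarrow> ereal (W 0)) at_top"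
    using False by (simp add: power2_eq_square)
  have "\<forall>\<^sub>F t in at_top. n t > 0" using order_tendstoD(1)[OF nlim \<open>W 0 > 0\<close>] .
  then have "\<forall>\<^sub>F t in at_top. ereal ((a t)\<^sup>2 / n t) \<le> error_at F A H Q0 Q R (V t) ell t"
    using eventually_gt_at_top[of "0::real"]
  proof eventually_elim
    case (elim t)
    have "(1 / sqrt (n t))\<^sup>2 * n t \<le> 1" using elim by (simp add: power_divide)
    then have "ereal ((1 / sqrt (n t) * a t)\<^sup>2) \<le> error_at F A H Q0 Q R (V t) ell t"
      unfolding n_def a_def by (intro Y0) (use elim in auto)
    moreover have "(1 / sqrt (n t) * a t)\<^sup>2 = (a t)\<^sup>2 / n t" using elim by (simp add: power_divide)
    ultimately show ?case by simp
  qed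
  then have "Limsup at_top (\<lambda>t. ereal ((a t)\<^sup>2 / n t)) \<le> asymptotic_error F A H Q0 Q R V ell"
    unfolding asymptotic_error_def by (rule Limsup_mono)
  then show ?thesis using lim_imp_Limsup[OF _ lim] by simp
qed

lemma asymptotic_error_upper:
  assumes U: "\<And>t s. 0 \<le> s \<Longrightarrow> s \<le> t \<Longrightarrow> U t s = u (t - s)"
  shows "asymptotic_error F A H Q0 Q R U ell \<le> ereal (W 0)"
proof -
  define n where "n = (\<lambda>t. q t \<bullet> (matrix_inv Q0 *v q t) + (W 0 - W t))"
  have "(n \<longlongrightarrow> 0 \<bullet> (matrix_inv Q0 *v 0) + (W 0 - 0)) at_top"
    unfolding n_def
    by (intro tendsto_add tendsto_diff tendsto_const W_lim tendsto_inner[OF q_lim tendsto_matrix_vector_right[OF q_lim]])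
  then have lim: "((\<lambda>t. ereal (n t)) \<longlongrightarrow> ereal (W 0)) at_top" by simp
  have "\<forall>\<^sub>F t in at_top. error_at F A H Q0 Q R (U t) ell t \<le> ereal (n t)"
    using eventually_gt_at_top[of "0::real"]
  proof eventually_elim
    case (elim t)
    have "error_at F A H Q0 Q R (U t) ell t = error_at F A H Q0 Q R (\<lambda>s. u (t - s)) ell t"
      by (rule error_at_cong) (use U in auto)
    then show ?case using error_upper_bound[OF elim] by (simp add: n_def)
  qed
  then have "asymptotic_error F A H Q0 Q R U ell \<le> Limsup at_top (\<lambda>t. ereal (n t))"
    unfolding asymptotic_error_def by (rule Limsup_mono)
  then show ?thesis using lim_imp_Limsup[OF _ lim] by simp
qed

lemma minimax_observer_optimal:
  assumes U: "\<And>t s. 0 \<le> s \<Longrightarrow> s \<le> t \<Longrightarrow> U t s = u (t - s)"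
  shows "minimax_observer F A H Q0 Q R ell U" "asymptotic_error F A H Q0 Q R U ell = ereal (W 0)"
proof -
  show eq: "asymptotic_error F A H Q0 Q R U ell = ereal (W 0)"
    by (rule antisym[OF asymptotic_error_upper[OF U] asymptotic_error_lower])
  have obs: "U \<in> observers"
    unfolding observers_def
  proof (clarify)
    fix t :: real assume "t > 0"
    have "continuous_on {0..t} (U t)"
      by (rule continuous_on_eq[OF continuous_u[of "{0..t}" t]]) (use U in auto)
    then show "L2_on {0..t} (U t)" by (rule L2_on_continuous)
  qed
  have "(INF V \<in> observers. asymptotic_error F A H Q0 Q R V ell) = ereal (W 0)"
  proof (rule antisym)
    show "(INF V \<in> observers. asymptotic_error F A H Q0 Q R V ell) \<le> ereal (W 0)"
      using INF_lower[OF obs, of "\<lambda>V. asymptotic_error F A H Q0 Q R V ell"] eq by simp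
    show "ereal (W 0) \<le> (INF V \<in> observers. asymptotic_error F A H Q0 Q R V ell)"
      by (rule INF_greatest) (rule asymptotic_error_lower)
  qed
  then show "minimax_observer F A H Q0 Q R ell U"
    using obs eq by (simp add: minimax_observer_def)
qed

text \<open>Variation of constants for the transposed closed loop.\<close>

lemma observer_representation:
  assumes U: "\<And>t s. 0 \<le> s \<Longrightarrow> s \<le> t \<Longrightarrow> U t s = u (t - s)"
    and Co: "\<And>s. (Co *v s) $ 1 = v0 \<bullet> s"
  shows "represented_by U (transpose G) (transpose (lower_rows CK)) Co"
  unfolding represented_by_def
proof (intro allI impI)
  fix I and y :: "real \<Rightarrow> real^'p" assume "horizon I \<and> L2_loc I y"
  then have I: "horizon I" and y: "L2_loc I y" by auto
  let ?Bo = "transpose (lower_rows CK)"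
  let ?\<Phi> = "matrix_flow (transpose G)"
  define h where "h = (\<lambda>s. ?\<Phi> (0 - s) *v (?Bo *v y s))"
  have cont\<Phi>: "continuous_on T (\<lambda>s. ?\<Phi> (0 - s))" for T by (intro continuous_intros)
  have h: "L2_loc I h"
    unfolding L2_loc_def h_def
  proof (intro allI impI continuous_bilinear_L2_on[OF bounded_bilinear_matrix_vector_mult cont\<Phi>] L2_on_matrix)
    fix a b assume "{a..b} \<subseteq> I"
    then show "L2_on {a..b} y" using y by (simp add: L2_loc_def)
  qed
  define j where "j = (\<lambda>t. LINT s|lebesgue_on {0..t}. h s)"
  have ACj: "AC I j" and dj: "AE t in lebesgue_on I. (j has_vector_derivative h t) (at t within I)"
    using indefinite_integral_horizon[OF I h, of 0] by (simp_all add: j_def)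
  define s where "s = (\<lambda>t. ?\<Phi> t *v j t)"
  have AC\<Phi>: "AC I ?\<Phi>"
    by (rule AC_C1[OF matrix_flow_has_vector_derivative])
       (intro bounded_bilinear.continuous_on[OF bounded_bilinear_matrix_matrix_mult] continuous_on_const continuous_on_matrix_flow)
  have ACs: "AC I s"
    unfolding s_def by (rule AC_bilinear[OF bounded_bilinear_matrix_vector_mult AC\<Phi> ACj])
  have ds: "AE t in lebesgue_on I. (s has_vector_derivative (transpose G *v s t + ?Bo *v y t)) (at t within I)"
    using dj
  proof eventually_elim
    case (elim t)
    have "?\<Phi> t *v (?\<Phi> (0 - t) *v w) = w" for w
      by (simp only: matrix_vector_mul_assoc matrix_flow_add[symmetric]) simp
    then have "?\<Phi> t *v h t = ?Bo *v y t" by (simp only: h_def)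
    with bounded_bilinear.has_vector_derivative[OF bounded_bilinear_matrix_vector_mult
        matrix_flow_has_vector_derivative[of "transpose G" t I] elim]
    show ?case by (simp add: s_def matrix_vector_mul_assoc add.commute)
  qed
  have out: "observer_output U y t = (Co *v s t) $ 1" if "t \<in> I" for t
  proof -
    have "{0..t} \<subseteq> I" by (rule horizon_Icc_subset[OF I that])
    then have int: "integrable (lebesgue_on {0..t}) h"
      using h by (auto simp: L2_loc_def intro: L2_on_imp_integrable)
    have "(Co *v s t) $ 1 = (transpose (?\<Phi> t) *v v0) \<bullet> j t"
      unfolding Co s_def by (rule inner_matrix_vector_transpose)
    also have "\<dots> = (LINT r|lebesgue_on {0..t}. (transpose (?\<Phi> t) *v v0) \<bullet> h r)"
      unfolding j_def by (rule integral_inner_right[symmetric]) (use int in auto)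
    also have "\<dots> = (LINT r|lebesgue_on {0..t}. y r \<bullet> U t r)"
    proof (rule Bochner_Integration.integral_cong[OF refl])
      fix r assume "r \<in> space (lebesgue_on {0..t})"
      then have r: "0 \<le> r" "r \<le> t" by auto
      have "(transpose (?\<Phi> t) *v v0) \<bullet> h r = v0 \<bullet> (?\<Phi> t *v h r)"
        by (rule inner_matrix_vector_transpose[symmetric])
      also have "?\<Phi> t *v h r = ?\<Phi> (t - r) *v (?Bo *v y r)"
      proof -
        have "?\<Phi> t *v (?\<Phi> (0 - r) *v w) = ?\<Phi> (t - r) *v w" for w
          by (simp only: matrix_vector_mul_assoc matrix_flow_add[symmetric]) simp
        then show ?thesis by (simp only: h_def)
      qed
      also have "\<dots> = transpose (matrix_flow G (t - r)) *v (?Bo *v y r)" by (simp only: matrix_flow_transpose)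
      also have "v0 \<bullet> \<dots> = u (t - r) \<bullet> y r"
        by (simp add: inner_matrix_vector_transpose u_def v_def)
      finally show "(transpose (?\<Phi> t) *v v0) \<bullet> h r = y r \<bullet> U t r"
        using U[OF r] by (simp add: inner_commute)
    qed
    finally show ?thesis by (simp add: observer_output_def)
  qed
  have "s 0 = 0"
  proof -
    have "j 0 = 0"
    proof -
      have "L2_on {0..0} h" using h horizon_0[OF I] L2_loc_iff_initial[OF I] by blast
      then have "integrable (lebesgue_on {0..0}) h" by (rule L2_on_imp_integrable)
      from LINT_eq_integral[OF this, of 0] show ?thesis by (simp add: j_def)
    qed
    then show ?thesis by (simp add: s_def)
  qed
  then show "\<exists>s. lti_trajectory (transpose G) ?Bo I s y \<and> s 0 = 0 \<and> (\<forall>t\<in>I. observer_output U y t = (Co *v s t) $ 1)"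
    using ACs ds y out by (auto simp: lti_trajectory_def)
qed

end

section \<open>The infinite horizon observer\<close>

lemma select_columns: "(X ** (\<chi> i j. M $ i $ \<iota> j)) $ i $ j = (X ** M) $ i $ \<iota> j"
  by (simp add: matrix_matrix_mult_def)

lemma select_rows: "((\<chi> j. M $ \<iota> j) ** X) $ i = (M ** X) $ \<iota> i"
  by (simp add: matrix_matrix_mult_def vec_eq_iff)

lemma selection_matrix_mult:
  assumes "\<And>i j. X $ i $ j = (if i = \<iota> j then 1 else 0 :: real)" and "inj \<iota>"
  shows "(X ** Y) $ \<iota> k = Y $ k" "i \<notin> range \<iota> \<Longrightarrow> (X ** Y) $ i = 0"
    "(X *v y) $ \<iota> k = y $ k" "i \<notin> range \<iota> \<Longrightarrow> (X *v y) $ i = 0"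
proof -
  have eq: "\<iota> k = \<iota> j \<longleftrightarrow> k = j" for k j using \<open>inj \<iota>\<close> by (auto dest: injD)
  show "(X ** Y) $ \<iota> k = Y $ k"
    by (simp add: vec_eq_iff matrix_matrix_mult_def assms(1) eq if_distrib[of "\<lambda>x. x * _"] cong: if_cong)
  show "(X *v y) $ \<iota> k = y $ k"
    by (simp add: matrix_vector_mult_def assms(1) eq if_distrib[of "\<lambda>x. x * _"] cong: if_cong)
  assume i: "i \<notin> range \<iota>"
  then have "i \<noteq> \<iota> j" for j by auto
  then show "(X ** Y) $ i = 0" "(X *v y) $ i = 0"
    by (simp_all add: vec_eq_iff matrix_matrix_mult_def matrix_vector_mult_def assms(1))
qed

text \<open>The columns of \<open>T\<^sup>-\<^sup>1\<close> and the rows of \<open>T\<close> that \<open>\<iota>\<close> selects describe the stabilizability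
  subspace.\<close>

lemma stabilizable_lti_reduced_system:
  fixes F A :: "real^'n^'m" and H :: "real^'n^'p" and Q0 Q :: "real^'m^'m" and R :: "real^'p^'p"
    and Aa :: "real^'h^'h" and Ba :: "real^'k^'h"
    and Ca :: "real^'h^('m + 'p)" and Da :: "real^'k^('m + 'p)"
    and \<iota> :: "'l::finite \<Rightarrow> 'h" and T :: "real^'h^'h"
    and Ag :: "real^'l^'l" and Bg :: "real^'k^'l"
    and Cg :: "real^'l^('m + 'p)" and Dg :: "real^'k^('m + 'p)" and Mg :: "real^'n^'l"
  assumes spd: "sym_pos_def Q0" "sym_pos_def Q" "sym_pos_def R"
    and assoc: "associated_lti F A H Aa Ba Ca Da"
    and st: "stabilizable_lti F Aa Ba Ca Da \<iota> T Ag Bg Cg Dg Mg"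
  defines "J \<equiv> \<chi> i j. matrix_inv T $ i $ \<iota> j" and "L \<equiv> \<chi> j. T $ \<iota> j"
  shows "reduced_system F A H Aa Ba Ca Da Ag Bg Cg J L Q0 Q R"
    and "Mg = L ** state_map F Ca"
proof -
  have inj: "inj \<iota>" and inv: "invertible T"
    and V: "(\<lambda>x. T *v x) ` stabilizability_subspace Aa Ba = {z. \<forall>i. i \<notin> range \<iota> \<longrightarrow> z $ i = 0}"
    and Ag: "\<And>i j. (T ** Aa ** matrix_inv T) $ \<iota> i $ \<iota> j = Ag $ i $ j"
    and A0: "\<And>i j. i \<notin> range \<iota> \<Longrightarrow> (T ** Aa ** matrix_inv T) $ i $ \<iota> j = 0"
    and Bg: "\<And>i. (T ** Ba) $ \<iota> i = Bg $ i"
    and B0: "\<And>i. i \<notin> range \<iota> \<Longrightarrow> (T ** Ba) $ i = 0"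
    and Cg: "\<And>i j. (Ca ** matrix_inv T) $ i $ \<iota> j = Cg $ i $ j"
    and Mg: "\<And>i. Mg $ i = (T ** state_map F Ca) $ \<iota> i"
    using st by (auto simp: stabilizable_lti_def)
  note T = invertible_matrix_inv[OF inv]
  have TJ: "(T ** J) $ i $ j = (if i = \<iota> j then 1 else 0)" for i j
    unfolding J_def select_columns T by (simp add: mat_def)
  note sel = selection_matrix_mult[of "T ** J", OF TJ inj]
  have cancel: "X = Y" if "T ** X = T ** Y" for X Y :: "real^'l^'h"
    using arg_cong[OF that, of "\<lambda>X. matrix_inv T ** X"] by (simp add: matrix_mul_assoc T)
  have cancelk: "X = Y" if "T ** X = T ** Y" for X Y :: "real^'k^'h"
    using arg_cong[OF that, of "\<lambda>X. matrix_inv T ** X"] by (simp add: matrix_mul_assoc T)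
  have cancelv: "x = y" if "T *v x = T *v y" for x y
    using arg_cong[OF that, of "\<lambda>x. matrix_inv T *v x"] by (simp add: matrix_vector_mul_assoc T)
  show "Mg = L ** state_map F Ca" by (simp add: vec_eq_iff Mg L_def select_rows)
  show "reduced_system F A H Aa Ba Ca Da Ag Bg Cg J L Q0 Q R"
  proof unfold_locales
    show "associated_lti F A H Aa Ba Ca Da" by (rule assoc)
    show "sym_pos_def Q0" "sym_pos_def Q" "sym_pos_def R" by (rule spd)+
    show "L ** J = mat 1"
    proof -
      have "(L ** J) $ i $ j = mat 1 $ i $ j" for i j
        using injD[OF inj, of i j] unfolding L_def select_rows TJ by (auto simp: mat_def)
      then show ?thesis by (simp add: vec_eq_iff)
    qed
    show "Aa ** J = J ** Ag"
    proof (rule cancel)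
      have "(T ** Aa ** J) $ i $ j = (T ** J ** Ag) $ i $ j" for i j
      proof (cases "i \<in> range \<iota>")
        case True
        then obtain k where "i = \<iota> k" by blast
        then show ?thesis using sel(1)[of Ag k] Ag[of k j] by (simp add: J_def select_columns)
      next
        case False
        then show ?thesis using sel(2)[of i Ag] A0[of i j] by (simp add: J_def select_columns)
      qed
      then show "T ** (Aa ** J) = T ** (J ** Ag)" by (simp add: vec_eq_iff matrix_mul_assoc)
    qed
    show "Ba = J ** Bg"
    proof (rule cancelk)
      have "(T ** Ba) $ i = (T ** J ** Bg) $ i" for i
      proof (cases "i \<in> range \<iota>")
        case True
        then obtain k where "i = \<iota> k" by blast
        then show ?thesis using sel(1)[of Bg k] Bg[of k] by simp
      next
        case False
        then show ?thesis using sel(2)[of i Bg] B0[of i] by simp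
      qed
      then show "T ** Ba = T ** (J ** Bg)" by (simp add: vec_eq_iff matrix_mul_assoc)
    qed
    show "Ca ** J = Cg" by (simp add: vec_eq_iff J_def select_columns Cg)
    show "stabilizability_subspace Aa Ba = range ((*v) J)"
    proof (intro set_eqI iffI)
      fix x assume "x \<in> stabilizability_subspace Aa Ba"
      then have x0: "(T *v x) $ i = 0" if "i \<notin> range \<iota>" for i using V that by blast
      define y where "y = (\<chi> k. (T *v x) $ \<iota> k)"
      have "(T *v x) $ i = ((T ** J) *v y) $ i" for i
      proof (cases "i \<in> range \<iota>")
        case True
        then obtain k where "i = \<iota> k" by blast
        then show ?thesis using sel(3)[of y k] by (simp add: y_def)
      next
        case False
        then show ?thesis using sel(4)[of i y] x0 by simp
      qed
      then have "T *v x = T *v (J *v y)" by (simp add: vec_eq_iff matrix_vector_mul_assoc)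
      then show "x \<in> range ((*v) J)" using cancelv by blast
    next
      fix x assume "x \<in> range ((*v) J)"
      then obtain y where "x = J *v y" by blast
      then have "T *v x \<in> {z. \<forall>i. i \<notin> range \<iota> \<longrightarrow> z $ i = 0}"
        using sel(4)[of _ y] by (simp add: matrix_vector_mul_assoc)
      then obtain x' where "x' \<in> stabilizability_subspace Aa Ba" "T *v x = T *v x'" using V by blast
      then show "x \<in> stabilizability_subspace Aa Ba" using cancelv by metis
    qed
  qed
qed

text \<open>If \<open>F\<^sup>T \<ell> = 0\<close> then \<open>\<ell>\<^sup>T F x(t)\<close> vanishes identically and is estimated by 0 without error.\<close>

lemma zero_observer_optimal:
  fixes F A :: "real^'n^'m" and H :: "real^'n^'p"
  assumes "transpose F *v ell = 0"
  shows "asymptotic_error F A H Q0 Q R (\<lambda>t s. 0) ell = 0"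
    "minimax_observer F A H Q0 Q R ell (\<lambda>t s. 0)"
proof -
  have err: "error_at F A H Q0 Q R (\<lambda>s. 0) ell t = 0" if "t > 0" for t
  proof (rule antisym[OF _ error_at_nonneg[OF that]])
    show "error_at F A H Q0 Q R (\<lambda>s. 0) ell t \<le> 0"
      unfolding error_at_def
    proof (rule SUP_least, clarify)
      fix x f y \<eta> assume "(x, f, y, \<eta>) \<in> admissible_solutions F A H Q0 Q R {0..t}"
      then have "dae_solution F A H {0..t} x f y \<eta>" by (simp add: admissible_solutions_def)
      from dae_state_in_range[OF horizon_Icc[OF that] this, of t]
      have "AC_version {0..t} (\<lambda>t. F *v x t) t \<in> range ((*v) F)" using that by simp
      then obtain \<zeta> where \<zeta>: "AC_version {0..t} (\<lambda>t. F *v x t) t = F *v \<zeta>" by blast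
      have "ell \<bullet> (F *v \<zeta>) = 0" by (simp add: inner_matrix_vector_transpose assms)
      then show "ereal ((ell \<bullet> AC_version {0..t} (\<lambda>t. F *v x t) t - (LINT s|lebesgue_on {0..t}. y s \<bullet> 0))\<^sup>2) \<le> 0"
        by (simp add: \<zeta>)
    qed
  qed
  have "Limsup at_top (\<lambda>t. error_at F A H Q0 Q R (\<lambda>s. 0) ell t) = Limsup at_top (\<lambda>_::real. 0::ereal)"
    by (rule Limsup_eq) (use eventually_gt_at_top[of "0::real"] in \<open>eventually_elim, simp add: err\<close>)
  then show asym: "asymptotic_error F A H Q0 Q R (\<lambda>t s. 0) ell = 0"
    by (simp add: asymptotic_error_def Limsup_const)
  have obs: "(\<lambda>t s. 0 :: real^'p) \<in> observers" by (simp add: observers_def L2_on_const)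
  have "(INF V \<in> observers. asymptotic_error F A H Q0 Q R V ell) = 0"
  proof (rule antisym)
    show "(INF V \<in> observers. asymptotic_error F A H Q0 Q R V ell) \<le> 0"
      using INF_lower[OF obs, of "\<lambda>V. asymptotic_error F A H Q0 Q R V ell"] asym by simp
    show "0 \<le> (INF V \<in> observers. asymptotic_error F A H Q0 Q R V ell)"
      by (rule INF_greatest) (rule asymptotic_error_nonneg)
  qed
  then show "minimax_observer F A H Q0 Q R ell (\<lambda>t s. 0)"
    using obs asym by (simp add: minimax_observer_def)
qed

theorem theorem4:
  fixes F A :: "real^'n^'m" and H :: "real^'n^'p"
    and Q0 Q :: "real^'m^'m" and R :: "real^'p^'p" and ell :: "real^'m"
    and Aa :: "real^'h^'h" and Ba :: "real^'k^'h"
    and Ca :: "real^'h^('m + 'p)" and Da :: "real^'k^('m + 'p)"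
    and \<iota> :: "'l::finite \<Rightarrow> 'h" and T :: "real^'h^'h"
    and Ag :: "real^'l^'l" and Bg :: "real^'k^'l"
    and Cg :: "real^'l^('m + 'p)" and Dg :: "real^'k^('m + 'p)" and Mg :: "real^'n^'l"
    and S :: "real^('m + 'p)^('m + 'p)"
  assumes "sym_pos_def Q0" and "sym_pos_def Q" and "sym_pos_def R"
    and "associated_lti F A H Aa Ba Ca Da"
    and "detectable F A H ell"
    and S_def: "S = block_diag (matrix_inv Q) (matrix_inv R)"
  shows
    "(stabilizable_lti F Aa Ba Ca Da \<iota> T Ag Bg Cg Dg Mg \<longrightarrow>
        (\<exists>!P. sym_pos_def P \<and> solves_are S Ag Bg Cg Dg P) \<and>
        (\<forall>P. sym_pos_def P \<and> solves_are S Ag Bg Cg Dg P \<longrightarrow>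
          (let K = are_gain S Bg Cg Dg P;
               Cu = lower_rows Cg;
               Du = lower_rows Dg;
               Ao = transpose (Ag - Bg ** K);
               Bo = transpose (Cu - Du ** K);
               Co = rowvector ell ** F ** transpose Mg;
               v = linear_ivp (Ag - Bg ** K) (Mg *v (transpose F *v ell));
               u = (\<lambda>t. (Cu - Du ** K) *v v t);
               U = (\<lambda>t s. u (t - s))
           in hurwitz Ao \<and>
              minimax_observer F A H Q0 Q R ell U \<and>
              asymptotic_error F A H Q0 Q R U ell =
                ereal (ell \<bullet> ((F ** transpose Mg ** P ** Mg ** transpose F) *v ell)) \<and>
              represented_by U Ao Bo Co)))
     \<and> \<comment> \<open>the case \<open>l = 0\<close>, not covered by the index type \<open>'l\<close>\<close>
     (stabilizability_subspace Aa Ba = {0} \<longrightarrow>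
        minimax_observer F A H Q0 Q R ell (\<lambda>t s. 0) \<and>
        asymptotic_error F A H Q0 Q R (\<lambda>t s. 0) ell = 0 \<and>
        (\<forall>I (y :: real \<Rightarrow> real^'p). horizon I \<and> L2_loc I y \<longrightarrow>
           (\<forall>t\<in>I. observer_output (\<lambda>t s. 0) y t = 0)))"
proof (intro conjI impI)
  note spd = assms(1-3) and assoc = assms(4) and det = assms(5)
  assume st: "stabilizable_lti F Aa Ba Ca Da \<iota> T Ag Bg Cg Dg Mg"
  have Dg: "Dg = Da" using st by (simp add: stabilizable_lti_def)
  define J where "J = (\<chi> i j. matrix_inv T $ i $ \<iota> j)"
  define L where "L = (\<chi> j. T $ \<iota> j)"
  note red = stabilizable_lti_reduced_system[OF spd assoc st, folded J_def L_def]
  interpret rs: reduced_system F A H Aa Ba Ca Da Ag Bg Cg J L Q0 Q R by (rule red(1))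
  have S: "S = rs.S" by (simp add: S_def rs.S_def)
  have Mg: "Mg = L ** rs.EL" by (simp add: red(2) rs.EL_def)
  have are: "sym_pos_def P \<and> solves_are S Ag Bg Cg Dg P \<longleftrightarrow> sym_pos_def P \<and> rs.lq.riccati Ag P" for P
    unfolding Dg S using rs.solves_are_iff[of P] by (auto simp: sym_pos_def_def)
  show "\<exists>!P. sym_pos_def P \<and> solves_are S Ag Bg Cg Dg P"
    unfolding are using rs.riccati_solution_exists rs.lq.riccati_unique by blast
  show "\<forall>P. sym_pos_def P \<and> solves_are S Ag Bg Cg Dg P \<longrightarrow>
          (let K = are_gain S Bg Cg Dg P;
               Cu = lower_rows Cg;
               Du = lower_rows Dg;
               Ao = transpose (Ag - Bg ** K);
               Bo = transpose (Cu - Du ** K);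
               Co = rowvector ell ** F ** transpose Mg;
               v = linear_ivp (Ag - Bg ** K) (Mg *v (transpose F *v ell));
               u = (\<lambda>t. (Cu - Du ** K) *v v t);
               U = (\<lambda>t s. u (t - s))
           in hurwitz Ao \<and>
              minimax_observer F A H Q0 Q R ell U \<and>
              asymptotic_error F A H Q0 Q R U ell =
                ereal (ell \<bullet> ((F ** transpose Mg ** P ** Mg ** transpose F) *v ell)) \<and>
              represented_by U Ao Bo Co)"
  proof (intro allI impI)
    fix P assume "sym_pos_def P \<and> solves_are S Ag Bg Cg Dg P"
    then have P: "sym_pos_def P" "rs.lq.riccati Ag P" unfolding are by auto
    define v0 where "v0 = Mg *v (transpose F *v ell)"
    interpret mp: minimax_problem F A H Aa Ba Ca Da Ag Bg Cg J L Q0 Q R P ell v0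
    proof unfold_locales
      show "sym_pos_def P" "rs.lq.riccati Ag P" by (rule P)+
      show "rs.E *v (J *v v0) = transpose F *v ell"
        unfolding v0_def Mg by (rule rs.detectable_state[OF det])
    qed
    have K: "are_gain S Bg Cg Dg P = mp.K" unfolding S Dg mp.K_def by (rule rs.are_gain_eq)
    have CK: "lower_rows Cg - lower_rows Dg ** mp.K = lower_rows mp.CK"
      by (simp add: Dg mp.CK_def lower_rows_diff lower_rows_mult)
    define U where "U = (\<lambda>t s. lower_rows mp.CK *v linear_ivp mp.G v0 (t - s))"
    have U: "U t s = mp.u (t - s)" if "0 \<le> s" "s \<le> t" for t s
      using that by (simp add: U_def mp.u_def mp.v_def linear_ivp_eq_flow)
    have inner: "ell \<bullet> (F *v (transpose Mg *v y)) = v0 \<bullet> y" for y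
      by (simp add: v0_def inner_matrix_vector_transpose)
    have W0: "mp.W 0 = ell \<bullet> ((F ** transpose Mg ** P ** Mg ** transpose F) *v ell)"
    proof -
      have "(F ** transpose Mg ** P ** Mg ** transpose F) *v ell = F *v (transpose Mg *v (P *v v0))"
        by (simp only: v0_def matrix_vector_mul_assoc matrix_mul_assoc)
      then show ?thesis by (simp only: inner mp.W_def mp.v_0)
    qed
    have row: "((rowvector ell :: real^'m^1) *v w) $ 1 = ell \<bullet> w" for w
      by (simp add: rowvector_def matrix_vector_mult_def inner_vec_def)
    have Co: "(((rowvector ell :: real^'m^1) ** F ** transpose Mg) *v y) $ 1 = v0 \<bullet> y" for y
    proof -
      have "(((rowvector ell :: real^'m^1) ** F ** transpose Mg) *v y) $ 1
          = ((rowvector ell :: real^'m^1) *v (F *v (transpose Mg *v y))) $ 1"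
        by (simp only: matrix_vector_mul_assoc matrix_mul_assoc)
      also have "\<dots> = ell \<bullet> (F *v (transpose Mg *v y))"
        by (rule row)
      finally show ?thesis by (simp only: inner)
    qed
    have "hurwitz (transpose mp.G)" by (rule stable_imp_hurwitz_transpose[OF mp.stable_G])
    moreover have "minimax_observer F A H Q0 Q R ell U" "asymptotic_error F A H Q0 Q R U ell = ereal (mp.W 0)"
      by (rule mp.minimax_observer_optimal, erule (1) U)+
    moreover have "represented_by U (transpose mp.G) (transpose (lower_rows mp.CK)) (rowvector ell ** F ** transpose Mg)"
      by (rule mp.observer_representation[OF _ Co]) (erule (1) U)
    ultimately show "let K = are_gain S Bg Cg Dg P;
               Cu = lower_rows Cg;
               Du = lower_rows Dg;
               Ao = transpose (Ag - Bg ** K);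
               Bo = transpose (Cu - Du ** K);
               Co = rowvector ell ** F ** transpose Mg;
               v = linear_ivp (Ag - Bg ** K) (Mg *v (transpose F *v ell));
               u = (\<lambda>t. (Cu - Du ** K) *v v t);
               U = (\<lambda>t s. u (t - s))
           in hurwitz Ao \<and>
              minimax_observer F A H Q0 Q R ell U \<and>
              asymptotic_error F A H Q0 Q R U ell =
                ereal (ell \<bullet> ((F ** transpose Mg ** P ** Mg ** transpose F) *v ell)) \<and>
              represented_by U Ao Bo Co"
      unfolding Let_def K CK mp.G_def[symmetric] v0_def[symmetric] U_def[symmetric] W0 by blast
  qed
next
  assume V0: "stabilizability_subspace Aa Ba = {0}"
  interpret associated F A H Aa Ba Ca Da by unfold_locales (rule assms(4))
  obtain p0 where "p0 \<in> stabilizability_subspace Aa Ba" "E *v p0 = transpose F *v ell"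
    using detectable_initial_state[OF assms(5)] by blast
  then have Fl: "transpose F *v ell = 0" using V0 by auto
  show "minimax_observer F A H Q0 Q R ell (\<lambda>t s. 0)" by (rule zero_observer_optimal(2)[OF Fl])
  show "asymptotic_error F A H Q0 Q R (\<lambda>t s. 0) ell = 0" by (rule zero_observer_optimal(1)[OF Fl])
  show "\<forall>I (y :: real \<Rightarrow> real^'p). horizon I \<and> L2_loc I y \<longrightarrow>
           (\<forall>t\<in>I. observer_output (\<lambda>t s. 0) y t = 0)"
    by (simp add: observer_output_def)
qed

end
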